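(* Let $U:\mathcal M\to\mathbb R$ be a smooth function and $\mathcal D\subset\mathcal M$ a bounded domain such that $\lambda_U(x)>0$ for all $x\in\mathrm{cl}(\mathcal D)$ and $\min\{\langle\nabla U(x),f(\varphi,x)\rangle:(\varphi,x)\in\mathbb T^k\times\mathrm{cl}(\mathcal D)\}<0$. Let $x:[s,\infty)\to\mathrm{cl}(\mathcal D)$ be a solution of the system $\nabla_{\dot x}\dot x=f(t\omega,x)+P(t\omega,x)\dot x$ such that $\|\dot x(s)\|\le z_+$. Then $$\sup_{t\ge s}\|\dot x(t)\|\le z_*,$$ where: if $P(\varphi,x)\equiv0$, then $z_*:=q\,\zeta_*(C_fC_U/q^2)$ with $\zeta_*(m)$ the greatest (real) root of the polynomial $\zeta\mapsto\zeta^3-3\zeta+2-3m$; otherwise, $z_*\in[z_+,\infty)$ is the root of the equation $I(z)=C_fC_Uz_+$. The numbers $q,C_f,C_U,z_+$ and the function $I$ are those defined in the context.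
   Context: $(\mathcal M,\langle\cdot,\cdot\rangle)$ is a smooth complete connected $m$-dimensional Riemannian manifold, $\nabla$ its Levi-Civita connection, $\|\cdot\|=\sqrt{\langle\cdot,\cdot\rangle}$; $\nabla_{\dot x}\dot x$ is the covariant derivative of $\dot x$ along the curve $x(t)$. $\mathbb T^k=\mathbb R^k/2\pi\mathbb Z^k$; $\omega\in\mathbb R^k$ has rationally independent components; $f(\varphi,\cdot)$ and $P(\varphi,\cdot)$, $\varphi\in\mathbb T^k$, are smooth families of vector fields and $(1,1)$-tensor fields on $\mathcal M$. $P^*$ is the adjoint of $P$ with respect to $\langle\cdot,\cdot\rangle$. For smooth $U$, $\langle H_U(x)\xi,\eta\rangle=\langle\nabla_\xi\nabla U(x),\eta\rangle$ and $\lambda_U(x):=\min\{\langle H_U(x)\xi,\xi\rangle:\xi\in T_x\mathcal M,\|\xi\|=1\}$. Set $M_f(x):=\max_{\varphi\in\mathbb T^k}\|f(\varphi,x)\|$, $\Lambda_P(x):=\max\{|\langle P(\varphi,x)\xi,\xi\rangle|:\varphi\in\mathbb T^k,\xi\in T_x\mathcal M,\|\xi\|=1\}$, and $$C_f:=\max_{x\in\mathrm{cl}(\mathcal D)}\frac{M_f(x)}{\lambda_U(x)},\quad C_U:=\max_{x\in\mathrm{cl}(\mathcal D)}\|\nabla U(x)\|,\quad q:=\sqrt{\max_{\mathbb T^k\times\mathrm{cl}(\mathcal D)}\left(-\frac{\langle\nabla U(x),f(\varphi,x)\rangle}{\lambda_U(x)}\right)},$$ $$p:=\max_{\mathbb T^k\times\mathrm{cl}(\mathcal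 D)}\frac{\|P^*(\varphi,x)\nabla U(x)\|}{\lambda_U(x)},\quad z_+:=\frac{p+\sqrt{4q^2+p^2}}2,\quad l:=\max_{x\in\mathrm{cl}(\mathcal D)}\frac{\Lambda_P(x)}{M_f(x)},\quad I(z):=\int_{z_+}^z\frac{w^2-pw-q^2}{lw+1}\,dw .$$ (If $P\equiv0$ then $p=0$ and $z_+=q$.) When $P\not\equiv0$ it is understood that $M_f>0$ on $\mathrm{cl}(\mathcal D)$, so that $l$ is well defined. *)

theory Defs
  imports "HOL-Analysis.Analysis"
begin

section \<open>Smooth maps between Euclidean spaces\<close>

primrec Ck_on :: "nat \<Rightarrow> 'a::euclidean_space set \<Rightarrow> ('a \<Rightarrow> 'b::real_normed_vector) \<Rightarrow> bool" where
  "Ck_on 0 S f \<longleftrightarrow> continuous_on S f"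
| "Ck_on (Suc k) S f \<longleftrightarrow>
     (\<forall>x\<in>S. f differentiable (at x)) \<and> (\<forall>v. Ck_on k S (\<lambda>x. frechet_derivative f (at x) v))"

text \<open>Only used for open sets.\<close>
definition smooth_on :: "'a::euclidean_space set \<Rightarrow> ('a \<Rightarrow> 'b::real_normed_vector) \<Rightarrow> bool" where
  "smooth_on S f \<longleftrightarrow> (\<forall>k. Ck_on k S f)"


section \<open>Charts and tangent vectors\<close>

text \<open>A manifold is the whole type \<open>'a\<close> with an atlas; its dimension is \<open>CARD('m)\<close>. A chart is
  a pair of a domain and a coordinate map, whose values off the domain are irrelevant.\<close>

type_synonym ('a, 'm) chart = "'a set \<times> ('a \<Rightarrow> real ^ 'm)"

abbreviation cdom :: "('a, 'm) chart \<Rightarrow> 'a set" where "cdom c \<equiv> fst c"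
abbreviation cmap :: "('a, 'm) chart \<Rightarrow> 'a \<Rightarrow> real ^ 'm" where "cmap c \<equiv> snd c"
abbreviation crange :: "('a, 'm) chart \<Rightarrow> (real ^ 'm) set" where "crange c \<equiv> cmap c ` cdom c"
abbreviation cinv :: "('a, 'm) chart \<Rightarrow> real ^ 'm \<Rightarrow> 'a" where "cinv c \<equiv> inv_into (cdom c) (cmap c)"

definition smooth_atlas ::
    "('a::{t2_space,second_countable_topology}, 'm::finite) chart set \<Rightarrow> bool" where
  "smooth_atlas A \<longleftrightarrow>
     \<Union>(cdom ` A) = UNIV \<and>
     (\<forall>c\<in>A. open (cdom c) \<and> open (crange c) \<and>
            homeomorphism (cdom c) (crange c) (cmap c) (cinv c)) \<and>
     (\<forall>c\<in>A. \<forall>c'\<in>A. smooth_on (cmap c ` (cdom c \<inter> cdom c')) (cmap c' \<circ> cinv c))"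

definition charts_at :: "('a, 'm) chart set \<Rightarrow> 'a \<Rightarrow> ('a, 'm) chart set" where
  "charts_at A p = {c\<in>A. p \<in> cdom c}"

text \<open>A tangent vector at \<open>p\<close> assigns to every chart around \<open>p\<close> a component vector, and the
  components in different charts are related by the Jacobians of the coordinate changes. The value
  \<open>0\<close> at all other charts only makes the representation unique. The linear structure is pointwise.\<close>

type_synonym ('a, 'm) tvec = "('a, 'm) chart \<Rightarrow> real ^ 'm"

definition tangent_space :: "('a, 'm::finite) chart set \<Rightarrow> 'a \<Rightarrow> ('a, 'm) tvec set" where
  "tangent_space A p =
     {v. (\<forall>c\<in>charts_at A p. \<forall>c'\<in>charts_at A p.
            v c' = frechet_derivative (cmap c' \<circ> cinv c) (at (cmap c p)) (v c)) \<and>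
         (\<forall>c. c \<notin> charts_at A p \<longrightarrow> v c = 0)}"

definition tcomb :: "real \<Rightarrow> ('a, 'm::finite) tvec \<Rightarrow> real \<Rightarrow> ('a, 'm) tvec \<Rightarrow> ('a, 'm) tvec" where
  "tcomb a u b v = (\<lambda>c. a *\<^sub>R u c + b *\<^sub>R v c)"

text \<open>The tangent vector at \<open>p\<close> whose components in the chart \<open>c\<close> are \<open>a\<close>.\<close>
definition coord_tvec ::
    "('a, 'm::finite) chart set \<Rightarrow> ('a, 'm) chart \<Rightarrow> 'a \<Rightarrow> real ^ 'm \<Rightarrow> ('a, 'm) tvec" where
  "coord_tvec A c p a =
     (\<lambda>c'. if c' \<in> charts_at A p
           then frechet_derivative (cmap c' \<circ> cinv c) (at (cmap c p)) a else 0)"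


section \<open>Smooth functions, vector fields and \<open>(1,1)\<close>-tensor fields\<close>

definition smooth_function :: "('a, 'm::finite) chart set \<Rightarrow> ('a \<Rightarrow> real) \<Rightarrow> bool" where
  "smooth_function A U \<longleftrightarrow> (\<forall>c\<in>A. smooth_on (crange c) (U \<circ> cinv c))"

text \<open>Functions on the torus are functions on \<open>real ^ 'k\<close> that are \<open>2 * pi\<close>-periodic in every
  coordinate.\<close>
definition torus_periodic :: "(real ^ 'k::finite \<Rightarrow> 'b) \<Rightarrow> bool" where
  "torus_periodic F \<longleftrightarrow> (\<forall>\<phi> i. F (\<phi> + axis i (2 * pi)) = F \<phi>)"

definition smooth_vector_field_family ::
    "('a, 'm::finite) chart set \<Rightarrow> (real ^ 'k::finite \<Rightarrow> 'a \<Rightarrow> ('a, 'm) tvec) \<Rightarrow> bool" where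
  "smooth_vector_field_family A f \<longleftrightarrow>
     torus_periodic f \<and>
     (\<forall>\<phi> p. f \<phi> p \<in> tangent_space A p) \<and>
     (\<forall>c\<in>A. smooth_on (UNIV \<times> crange c) (\<lambda>(\<phi>, y). f \<phi> (cinv c y) c))"

definition tangent_endomorphism ::
    "('a, 'm::finite) chart set \<Rightarrow> 'a \<Rightarrow> (('a, 'm) tvec \<Rightarrow> ('a, 'm) tvec) \<Rightarrow> bool" where
  "tangent_endomorphism A p L \<longleftrightarrow>
     (\<forall>u\<in>tangent_space A p. L u \<in> tangent_space A p) \<and>
     (\<forall>u\<in>tangent_space A p. \<forall>v\<in>tangent_space A p. \<forall>a b.
        L (tcomb a u b v) = tcomb a (L u) b (L v))"

definition smooth_tensor_field_family ::
    "('a, 'm::finite) chart set \<Rightarrow> (real ^ 'k::finite \<Rightarrow> 'a \<Rightarrow> ('a, 'm) tvec \<Rightarrow> ('a, 'm) tvec) \<Rightarrow> bool"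
  where
  "smooth_tensor_field_family A P \<longleftrightarrow>
     (\<forall>p. \<forall>v\<in>tangent_space A p. torus_periodic (\<lambda>\<phi>. P \<phi> p v)) \<and>
     (\<forall>\<phi> p. tangent_endomorphism A p (P \<phi> p)) \<and>
     (\<forall>c\<in>A. \<forall>a. smooth_on (UNIV \<times> crange c)
        (\<lambda>(\<phi>, y). P \<phi> (cinv c y) (coord_tvec A c (cinv c y) a) c))"

definition zero_tensor_field_family ::
    "('a, 'm::finite) chart set \<Rightarrow> (real ^ 'k::finite \<Rightarrow> 'a \<Rightarrow> ('a, 'm) tvec \<Rightarrow> ('a, 'm) tvec) \<Rightarrow> bool"
  where
  "zero_tensor_field_family A P \<longleftrightarrow> (\<forall>\<phi> p. \<forall>v\<in>tangent_space A p. P \<phi> p v = (\<lambda>_. 0))"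


section \<open>Riemannian metrics\<close>

type_synonym ('a, 'm) rmetric = "'a \<Rightarrow> ('a, 'm) tvec \<Rightarrow> ('a, 'm) tvec \<Rightarrow> real"

definition riemannian_manifold ::
    "('a::{t2_space,second_countable_topology}, 'm::finite) chart set \<Rightarrow> ('a, 'm) rmetric \<Rightarrow> bool"
  where
  "riemannian_manifold A g \<longleftrightarrow>
     smooth_atlas A \<and>
     (\<forall>p. \<forall>u\<in>tangent_space A p. \<forall>v\<in>tangent_space A p. g p u v = g p v u) \<and>
     (\<forall>p. \<forall>u\<in>tangent_space A p. \<forall>v\<in>tangent_space A p. \<forall>w\<in>tangent_space A p. \<forall>a b.
        g p (tcomb a u b v) w = a * g p u w + b * g p v w) \<and>
     (\<forall>p. \<forall>u\<in>tangent_space A p. u \<noteq> (\<lambda>_. 0) \<longrightarrow> g p u u > 0) \<and>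
     (\<forall>c\<in>A. \<forall>a b. smooth_on (crange c)
        (\<lambda>y. g (cinv c y) (coord_tvec A c (cinv c y) a) (coord_tvec A c (cinv c y) b)))"

definition rnorm :: "('a, 'm) rmetric \<Rightarrow> 'a \<Rightarrow> ('a, 'm) tvec \<Rightarrow> real" where
  "rnorm g p v = sqrt (g p v v)"

definition radjoint ::
    "('a, 'm::finite) chart set \<Rightarrow> ('a, 'm) rmetric \<Rightarrow> 'a \<Rightarrow> (('a, 'm) tvec \<Rightarrow> ('a, 'm) tvec)
       \<Rightarrow> ('a, 'm) tvec \<Rightarrow> ('a, 'm) tvec" where
  "radjoint A g p L v =
     (THE w. w \<in> tangent_space A p \<and> (\<forall>u\<in>tangent_space A p. g p w u = g p v (L u)))"

definition gradient ::
    "('a, 'm::finite) chart set \<Rightarrow> ('a, 'm) rmetric \<Rightarrow> ('a \<Rightarrow> real) \<Rightarrow> 'a \<Rightarrow> ('a, 'm) tvec" where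
  "gradient A g U p =
     (THE w. w \<in> tangent_space A p \<and>
        (\<forall>u\<in>tangent_space A p. \<forall>c\<in>charts_at A p.
           g p w u = frechet_derivative (U \<circ> cinv c) (at (cmap c p)) (u c)))"


section \<open>Levi-Civita connection\<close>

definition gram ::
    "('a, 'm::finite) chart set \<Rightarrow> ('a, 'm) rmetric \<Rightarrow> ('a, 'm) chart \<Rightarrow> real ^ 'm \<Rightarrow> real ^ 'm ^ 'm"
  where
  "gram A g c y = (\<chi> i j. g (cinv c y) (coord_tvec A c (cinv c y) (axis i 1))
                                       (coord_tvec A c (cinv c y) (axis j 1)))"

text \<open>\<open>gram_deriv A g c y k i j\<close> is the partial derivative of \<open>g\<^sub>i\<^sub>j\<close> in direction \<open>k\<close>.\<close>
definition gram_deriv ::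
    "('a, 'm::finite) chart set \<Rightarrow> ('a, 'm) rmetric \<Rightarrow> ('a, 'm) chart \<Rightarrow> real ^ 'm
       \<Rightarrow> 'm \<Rightarrow> 'm \<Rightarrow> 'm \<Rightarrow> real" where
  "gram_deriv A g c y k i j = frechet_derivative (\<lambda>y. gram A g c y $ i $ j) (at y) (axis k 1)"

text \<open>Christoffel symbols \<open>\<Gamma>\<^sup>k\<^sub>i\<^sub>j\<close> of the Levi-Civita connection.\<close>
definition christoffel ::
    "('a, 'm::finite) chart set \<Rightarrow> ('a, 'm) rmetric \<Rightarrow> ('a, 'm) chart \<Rightarrow> real ^ 'm
       \<Rightarrow> 'm \<Rightarrow> 'm \<Rightarrow> 'm \<Rightarrow> real" where
  "christoffel A g c y k i j =
     (\<Sum>l\<in>UNIV. matrix_inv (gram A g c y) $ k $ l *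
        (gram_deriv A g c y i j l + gram_deriv A g c y j i l - gram_deriv A g c y l i j)) / 2"

text \<open>The lemmas \<open>christoffel_torsion_free\<close> and \<open>christoffel_metric\<close> below are the two
  properties that characterise the Levi-Civita connection.\<close>

lemma smooth_on_differentiable: "smooth_on S f \<Longrightarrow> x \<in> S \<Longrightarrow> f differentiable (at x)"
  unfolding smooth_on_def using Ck_on.simps(2)[of 0 S f] by blast

lemma chart_image_open:
  assumes "smooth_atlas A" "c \<in> A" "open W" "W \<subseteq> cdom c"
  shows "open (cmap c ` W)"
proof -
  have h: "homeomorphism (cdom c) (crange c) (cmap c) (cinv c)" "open (crange c)"
    using assms unfolding smooth_atlas_def by auto
  have "openin (top_of_set (cdom c)) W" using assms by (simp add: open_subset)
  then have "openin (top_of_set (crange c)) (cmap c ` W)"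
    using h(1) homeomorphism_imp_open_map by blast
  then show ?thesis using h(2) openin_open_trans by blast
qed

lemma transition_has_derivative:
  assumes "smooth_atlas A" "c \<in> charts_at A p" "c' \<in> charts_at A p"
  shows "((cmap c' \<circ> cinv c) has_derivative
           frechet_derivative (cmap c' \<circ> cinv c) (at (cmap c p))) (at (cmap c p))"
proof -
  have "smooth_on (cmap c ` (cdom c \<inter> cdom c')) (cmap c' \<circ> cinv c)"
       "cmap c p \<in> cmap c ` (cdom c \<inter> cdom c')"
    using assms unfolding smooth_atlas_def charts_at_def by auto
  then show ?thesis
    using smooth_on_differentiable frechet_derivative_works by blast
qed

lemma chart_inverse:
  assumes "smooth_atlas A" "c \<in> charts_at A p"
  shows "cinv c (cmap c p) = p"
  using assms inv_into_f_f[of "cmap c" "cdom c" p]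
  unfolding smooth_atlas_def charts_at_def homeomorphism_def by blast

lemma transition_chain:
  assumes at: "smooth_atlas A"
    and c: "c \<in> charts_at A p" "c1 \<in> charts_at A p" "c2 \<in> charts_at A p"
  shows "frechet_derivative (cmap c2 \<circ> cinv c) (at (cmap c p)) a =
         frechet_derivative (cmap c2 \<circ> cinv c1) (at (cmap c1 p))
           (frechet_derivative (cmap c1 \<circ> cinv c) (at (cmap c p)) a)"
proof -
  define W where "W = cdom c \<inter> cdom c1 \<inter> cdom c2"
  have W: "open W" "W \<subseteq> cdom c" "p \<in> W"
    using at c unfolding smooth_atlas_def charts_at_def W_def by auto
  have cA: "c \<in> A" using c by (simp add: charts_at_def)
  have o: "open (cmap c ` W)" "cmap c p \<in> cmap c ` W"
    using chart_image_open[OF at cA W(1,2)] W(3) by auto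
  have "((cmap c2 \<circ> cinv c1) \<circ> (cmap c1 \<circ> cinv c) has_derivative
      frechet_derivative (cmap c2 \<circ> cinv c1) (at (cmap c1 p)) \<circ>
      frechet_derivative (cmap c1 \<circ> cinv c) (at (cmap c p))) (at (cmap c p))"
    using transition_has_derivative[OF at c(1,2)] transition_has_derivative[OF at c(2,3)]
    by (intro diff_chain_at) (simp_all add: chart_inverse[OF at c(1)])
  moreover have "((cmap c2 \<circ> cinv c1) \<circ> (cmap c1 \<circ> cinv c)) z = (cmap c2 \<circ> cinv c) z"
    if z: "z \<in> cmap c ` W" for z
  proof -
    obtain q where q: "q \<in> W" "z = cmap c q" by (rule imageE[OF z]) simp
    then have "c \<in> charts_at A q" "c1 \<in> charts_at A q"
      using c by (auto simp: charts_at_def W_def)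
    then show ?thesis using q chart_inverse[OF at] by simp
  qed
  ultimately have "((cmap c2 \<circ> cinv c) has_derivative
      frechet_derivative (cmap c2 \<circ> cinv c1) (at (cmap c1 p)) \<circ>
      frechet_derivative (cmap c1 \<circ> cinv c) (at (cmap c p))) (at (cmap c p))"
    using o has_derivative_transform_within_open by blast
  from frechet_derivative_at[OF this, symmetric] show ?thesis by simp
qed

lemma coord_tvec_tangent:
  assumes "smooth_atlas A" "c \<in> charts_at A p"
  shows "coord_tvec A c p a \<in> tangent_space A p"
proof -
  have "coord_tvec A c p a c2 =
      frechet_derivative (cmap c2 \<circ> cinv c1) (at (cmap c1 p)) (coord_tvec A c p a c1)"
    if "c1 \<in> charts_at A p" "c2 \<in> charts_at A p" for c1 c2
    unfolding coord_tvec_def if_P[OF that(1)] if_P[OF that(2)]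
    by (rule transition_chain[OF assms that])
  moreover have "coord_tvec A c p a c1 = 0" if "c1 \<notin> charts_at A p" for c1
    using that by (simp add: coord_tvec_def)
  ultimately show ?thesis unfolding tangent_space_def by blast
qed

lemma coord_tvec_self:
  assumes at: "smooth_atlas A" and c: "c \<in> charts_at A p"
  shows "coord_tvec A c p a c = a"
proof -
  have cA: "c \<in> A" "p \<in> cdom c" using c by (auto simp: charts_at_def)
  have o: "open (crange c)" using at cA unfolding smooth_atlas_def by blast
  have i: "((\<lambda>z. z) has_derivative (\<lambda>z. z)) (at (cmap c p))" by simp
  have e: "z = (cmap c \<circ> cinv c) z" if "z \<in> crange c" for z
    using that by (simp add: f_inv_into_f)
  have "((cmap c \<circ> cinv c) has_derivative (\<lambda>z. z)) (at (cmap c p))"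
    by (rule has_derivative_transform_within_open[OF i o imageI[OF cA(2)] e])
  from frechet_derivative_at[OF this, symmetric] show ?thesis
    using c unfolding coord_tvec_def by simp
qed

lemma coord_tvec_tcomb:
  assumes at: "smooth_atlas A" and c: "c \<in> charts_at A p"
  shows "coord_tvec A c p (r *\<^sub>R a + t *\<^sub>R b) = tcomb r (coord_tvec A c p a) t (coord_tvec A c p b)"
proof
  fix c'
  show "coord_tvec A c p (r *\<^sub>R a + t *\<^sub>R b) c' =
        tcomb r (coord_tvec A c p a) t (coord_tvec A c p b) c'"
  proof (cases "c' \<in> charts_at A p")
    case True
    have "linear (frechet_derivative (cmap c' \<circ> cinv c) (at (cmap c p)))"
      using transition_has_derivative[OF at c True] has_derivative_linear by blast
    then show ?thesis using True by (simp add: coord_tvec_def tcomb_def linear_add linear_scale)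
  qed (simp add: coord_tvec_def tcomb_def)
qed

context
  fixes A :: "('a::{t2_space,second_countable_topology}, 'm::finite) chart set"
    and g :: "('a, 'm) rmetric" and c y
  assumes RM: "riemannian_manifold A g" and c: "c \<in> A" and y: "y \<in> crange c"
begin

lemma metric_atlas: "smooth_atlas A"
  using RM unfolding riemannian_manifold_def by blast

lemma point_chart: "c \<in> charts_at A (cinv c y)" "cmap c (cinv c y) = y"
  using c y by (auto simp: charts_at_def inv_into_into f_inv_into_f)

lemma metric_bilinear:
  shows "bilinear (\<lambda>a b. g (cinv c y) (coord_tvec A c (cinv c y) a) (coord_tvec A c (cinv c y) b))"
    (is "bilinear ?B")
    and "g (cinv c y) (coord_tvec A c (cinv c y) a) (coord_tvec A c (cinv c y) b)
       = g (cinv c y) (coord_tvec A c (cinv c y) b) (coord_tvec A c (cinv c y) a)"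
proof -
  note tg = coord_tvec_tangent[OF metric_atlas point_chart(1)]
  have sy: "?B a b = ?B b a" for a b
    using RM tg unfolding riemannian_manifold_def by blast
  show "?B a b = ?B b a" by (rule sy)
  have lin: "?B (r *\<^sub>R a + t *\<^sub>R a') b = r * ?B a b + t * ?B a' b" for r t a a' b
    unfolding coord_tvec_tcomb[OF metric_atlas point_chart(1)]
    using RM tg unfolding riemannian_manifold_def by blast
  have l1: "linear (\<lambda>a. ?B a b)" for b
  proof (rule linearI)
    fix a a' show "?B (a + a') b = ?B a b + ?B a' b" using lin[of 1 a 1 a' b] by simp
  next
    fix r a show "?B (r *\<^sub>R a) b = r *\<^sub>R ?B a b" using lin[of r a 0 0 b] by simp
  qed
  moreover have "linear (\<lambda>b. ?B a b)" for a using l1[of a] by (simp add: sy)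
  ultimately show "bilinear ?B" unfolding bilinear_def by blast
qed

lemma gram_symmetric: "gram A g c y $ i $ j = gram A g c y $ j $ i"
  unfolding gram_def by (simp add: metric_bilinear(2))

lemma gram_form:
  "a \<bullet> (gram A g c y *v b)
     = g (cinv c y) (coord_tvec A c (cinv c y) a) (coord_tvec A c (cinv c y) b)"
proof -
  let ?B = "\<lambda>a b. g (cinv c y) (coord_tvec A c (cinv c y) a) (coord_tvec A c (cinv c y) b)"
  have e: "(\<Sum>i\<in>UNIV. v $ i *\<^sub>R axis i 1) = v" for v :: "real ^ 'm"
    using basis_expansion[of v] by (simp add: scalar_mult_eq_scaleR)
  have "?B a b = ?B (\<Sum>i\<in>UNIV. a $ i *\<^sub>R axis i 1) (\<Sum>i\<in>UNIV. b $ i *\<^sub>R axis i 1)"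
    by (simp only: e)
  also have "\<dots> = (\<Sum>(i, j)\<in>UNIV \<times> UNIV. ?B (a $ i *\<^sub>R axis i 1) (b $ j *\<^sub>R axis j 1))"
    by (rule bilinear_sum[OF metric_bilinear(1)])
  also have "\<dots> = (\<Sum>i\<in>UNIV. \<Sum>j\<in>UNIV. a $ i * (b $ j * gram A g c y $ i $ j))"
    unfolding sum.cartesian_product[symmetric]
    by (simp add: bilinear_lmul[OF metric_bilinear(1)] bilinear_rmul[OF metric_bilinear(1)] gram_def mult.left_commute)
  also have "\<dots> = a \<bullet> (gram A g c y *v b)"
    by (simp add: inner_vec_def matrix_vector_mult_def sum_distrib_left algebra_simps)
  finally show ?thesis by simp
qed

lemma gram_invertible: "gram A g c y ** matrix_inv (gram A g c y) = mat 1"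
proof -
  have "b = 0" if "gram A g c y *v b = 0" for b
  proof (rule ccontr)
    assume "b \<noteq> 0"
    then have "coord_tvec A c (cinv c y) b \<noteq> (\<lambda>_. 0)"
      using coord_tvec_self[OF metric_atlas point_chart(1)] by metis
    then have "g (cinv c y) (coord_tvec A c (cinv c y) b) (coord_tvec A c (cinv c y) b) > 0"
      using RM coord_tvec_tangent[OF metric_atlas point_chart(1)]
      unfolding riemannian_manifold_def by blast
    then show False using gram_form[of b b] that by simp
  qed
  then have "invertible (gram A g c y)"
    using invertible_left_inverse matrix_left_invertible_ker by blast
  then obtain B where "gram A g c y ** B = mat 1 \<and> B ** gram A g c y = mat 1"
    unfolding invertible_def by blast
  then have "gram A g c y ** matrix_inv (gram A g c y) = mat 1 \<and>
      matrix_inv (gram A g c y) ** gram A g c y = mat 1"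
    unfolding matrix_inv_def by (rule someI)
  then show ?thesis by blast
qed

end

lemma gram_deriv_symmetric:
  assumes RM: "riemannian_manifold A g" and c: "c \<in> A" and y: "y \<in> crange c"
  shows "gram_deriv A g c y k i j = gram_deriv A g c y k j i"
proof -
  have o: "open (crange c)" 
    using RM c unfolding riemannian_manifold_def smooth_atlas_def by blast
  have "smooth_on (crange c) (\<lambda>y. gram A g c y $ i $ j)"
    using RM c unfolding riemannian_manifold_def gram_def vec_lambda_beta by blast
  then have "((\<lambda>y. gram A g c y $ i $ j) has_derivative
       frechet_derivative (\<lambda>y. gram A g c y $ i $ j) (at y)) (at y)"
    using smooth_on_differentiable y frechet_derivative_works by blast
  then have "((\<lambda>y. gram A g c y $ j $ i) has_derivative
       frechet_derivative (\<lambda>y. gram A g c y $ i $ j) (at y)) (at y)"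
    by (rule has_derivative_transform_within_open[OF _ o y]) (rule gram_symmetric[OF RM c])
  from frechet_derivative_at[OF this] show ?thesis unfolding gram_deriv_def by simp
qed

lemma christoffel_torsion_free:
  assumes "riemannian_manifold A g" "c \<in> A" "y \<in> crange c"
  shows "christoffel A g c y k i j = christoffel A g c y k j i"
  unfolding christoffel_def gram_deriv_symmetric[OF assms, of _ i j]
  by (simp only: add.commute[of "gram_deriv A g c y i j _"])

lemma christoffel_metric:
  assumes "riemannian_manifold A g" "c \<in> A" "y \<in> crange c"
  shows "gram_deriv A g c y k i j =
     (\<Sum>l\<in>UNIV. christoffel A g c y l k i * gram A g c y $ l $ j
              + christoffel A g c y l k j * gram A g c y $ i $ l)"
proof -
  let ?G = "gram A g c y"
  let ?d = "gram_deriv A g c y"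
  have low: "(\<Sum>l\<in>UNIV. ?G $ n $ l * christoffel A g c y l i j)
      = (?d i j n + ?d j i n - ?d n i j) / 2" for i j n
  proof -
    define b where "b = (\<chi> m. (?d i j m + ?d j i m - ?d m i j) / 2)"
    have "christoffel A g c y l i j = (matrix_inv ?G *v b) $ l" for l
      unfolding christoffel_def b_def matrix_vector_mult_def by (simp add: sum_divide_distrib)
    then have "(\<Sum>l\<in>UNIV. ?G $ n $ l * christoffel A g c y l i j) = (?G *v (matrix_inv ?G *v b)) $ n"
      by (simp add: matrix_vector_mult_def[of ?G])
    also have "\<dots> = b $ n"
      by (simp add: matrix_vector_mul_assoc gram_invertible[OF assms])
    finally show ?thesis by (simp add: b_def)
  qed
  have "(\<Sum>l\<in>UNIV. christoffel A g c y l k i * ?G $ l $ j + christoffel A g c y l k j * ?G $ i $ l)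
    = (\<Sum>l\<in>UNIV. ?G $ j $ l * christoffel A g c y l k i)
      + (\<Sum>l\<in>UNIV. ?G $ i $ l * christoffel A g c y l k j)"
    by (simp add: sum.distrib gram_symmetric[OF assms, of _ j] mult.commute)
  then show ?thesis
    unfolding low
    using gram_deriv_symmetric[OF assms, of k i j] gram_deriv_symmetric[OF assms, of i k j]
      gram_deriv_symmetric[OF assms, of j k i] by (simp add: field_simps)
qed

definition christoffel_form ::
    "('a, 'm::finite) chart set \<Rightarrow> ('a, 'm) rmetric \<Rightarrow> ('a, 'm) chart \<Rightarrow> real ^ 'm
       \<Rightarrow> real ^ 'm \<Rightarrow> real ^ 'm \<Rightarrow> real ^ 'm" where
  "christoffel_form A g c y a b =
     (\<chi> k. \<Sum>i\<in>UNIV. \<Sum>j\<in>UNIV. christoffel A g c y k i j * a $ i * b $ j)"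

text \<open>\<open>cov_deriv A g X p v\<close> is the covariant derivative at \<open>p\<close> of the vector field \<open>X\<close> in
  direction \<open>v\<close>.\<close>
definition cov_deriv ::
    "('a, 'm::finite) chart set \<Rightarrow> ('a, 'm) rmetric \<Rightarrow> ('a \<Rightarrow> ('a, 'm) tvec) \<Rightarrow> 'a
       \<Rightarrow> ('a, 'm) tvec \<Rightarrow> ('a, 'm) tvec" where
  "cov_deriv A g X p v =
     (\<lambda>c. if c \<in> charts_at A p
          then frechet_derivative (\<lambda>y. X (cinv c y) c) (at (cmap c p)) (v c)
                 + christoffel_form A g c (cmap c p) (v c) (X p c)
          else 0)"

text \<open>Curves are only considered on an interval \<open>I\<close>, with one-sided derivatives at its end points.\<close>
definition velocity ::
    "('a, 'm::finite) chart set \<Rightarrow> real set \<Rightarrow> (real \<Rightarrow> 'a) \<Rightarrow> real \<Rightarrow> ('a, 'm) tvec" where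
  "velocity A I x t =
     (\<lambda>c. if c \<in> charts_at A (x t) then vector_derivative (cmap c \<circ> x) (at t within I) else 0)"

definition cov_deriv_along ::
    "('a, 'm::finite) chart set \<Rightarrow> ('a, 'm) rmetric \<Rightarrow> real set \<Rightarrow> (real \<Rightarrow> 'a)
       \<Rightarrow> (real \<Rightarrow> ('a, 'm) tvec) \<Rightarrow> real \<Rightarrow> ('a, 'm) tvec" where
  "cov_deriv_along A g I x V t =
     (\<lambda>c. if c \<in> charts_at A (x t)
          then vector_derivative (\<lambda>\<tau>. V \<tau> c) (at t within I)
                 + christoffel_form A g c (cmap c (x t)) (velocity A I x t c) (V t c)
          else 0)"


section \<open>Riemannian distance\<close>

definition C1_curve_on ::
    "('a::topological_space, 'm::finite) chart set \<Rightarrow> real set \<Rightarrow> (real \<Rightarrow> 'a) \<Rightarrow> bool" where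
  "C1_curve_on A I \<gamma> \<longleftrightarrow>
     continuous_on I \<gamma> \<and>
     (\<forall>t\<in>I. \<forall>c\<in>charts_at A (\<gamma> t).
        (cmap c \<circ> \<gamma>) differentiable (at t within I) \<and>
        continuous (at t within I) (\<lambda>\<tau>. vector_derivative (cmap c \<circ> \<gamma>) (at \<tau> within I)))"

definition piecewise_C1_curve ::
    "('a::topological_space, 'm::finite) chart set \<Rightarrow> (real \<Rightarrow> 'a) \<Rightarrow> bool" where
  "piecewise_C1_curve A \<gamma> \<longleftrightarrow>
     (\<exists>S. finite S \<and> {0, 1} \<subseteq> S \<and> S \<subseteq> {0..1} \<and>
        (\<forall>a\<in>S. \<forall>b\<in>S. a < b \<and> {a<..<b} \<inter> S = {} \<longrightarrow> C1_curve_on A {a..b} \<gamma>))"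

definition curve_length ::
    "('a, 'm::finite) chart set \<Rightarrow> ('a, 'm) rmetric \<Rightarrow> (real \<Rightarrow> 'a) \<Rightarrow> real" where
  "curve_length A g \<gamma> = integral {0..1} (\<lambda>t. rnorm g (\<gamma> t) (velocity A {0..1} \<gamma> t))"

definition riem_dist ::
    "('a::topological_space, 'm::finite) chart set \<Rightarrow> ('a, 'm) rmetric \<Rightarrow> 'a \<Rightarrow> 'a \<Rightarrow> real" where
  "riem_dist A g p q =
     Inf {curve_length A g \<gamma> |\<gamma>. piecewise_C1_curve A \<gamma> \<and> \<gamma> 0 = p \<and> \<gamma> 1 = q}"

definition complete_riemannian_manifold ::
    "('a::{t2_space,second_countable_topology}, 'm::finite) chart set \<Rightarrow> ('a, 'm) rmetric \<Rightarrow> bool"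
  where
  "complete_riemannian_manifold A g \<longleftrightarrow>
     riemannian_manifold A g \<and> connected (UNIV :: 'a set) \<and>
     Metric_space.mcomplete UNIV (riem_dist A g)"

definition bounded_domain ::
    "('a::topological_space, 'm::finite) chart set \<Rightarrow> ('a, 'm) rmetric \<Rightarrow> 'a set \<Rightarrow> bool" where
  "bounded_domain A g D \<longleftrightarrow>
     open D \<and> connected D \<and> D \<noteq> {} \<and> Metric_space.mbounded UNIV (riem_dist A g) D"


section \<open>The forced system\<close>

definition rationally_independent :: "real ^ 'k::finite \<Rightarrow> bool" where
  "rationally_independent \<omega> \<longleftrightarrow>
     (\<forall>r :: 'k \<Rightarrow> rat. (\<Sum>i\<in>UNIV. of_rat (r i) * \<omega> $ i) = 0 \<longrightarrow> (\<forall>i. r i = 0))"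

definition is_solution ::
    "('a::topological_space, 'm::finite) chart set \<Rightarrow> ('a, 'm) rmetric
       \<Rightarrow> (real ^ 'k::finite \<Rightarrow> 'a \<Rightarrow> ('a, 'm) tvec)
       \<Rightarrow> (real ^ 'k \<Rightarrow> 'a \<Rightarrow> ('a, 'm) tvec \<Rightarrow> ('a, 'm) tvec)
       \<Rightarrow> real ^ 'k \<Rightarrow> real set \<Rightarrow> (real \<Rightarrow> 'a) \<Rightarrow> bool" where
  "is_solution A g f P \<omega> I x \<longleftrightarrow>
     continuous_on I x \<and>
     (\<forall>t\<in>I. \<forall>c\<in>charts_at A (x t).
        (cmap c \<circ> x) differentiable (at t within I) \<and>
        (\<lambda>\<tau>. vector_derivative (cmap c \<circ> x) (at \<tau> within I)) differentiable (at t within I)) \<and>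
     (\<forall>t\<in>I. cov_deriv_along A g I x (velocity A I x) t =
        (\<lambda>c. f (t *\<^sub>R \<omega>) (x t) c + P (t *\<^sub>R \<omega>) (x t) (velocity A I x t) c))"

text \<open>In the definitions below the suprema and infima range over compact sets (the closure of a
  bounded domain is compact because the manifold is complete), so they are maxima and minima.\<close>

definition hess_min ::
    "('a, 'm::finite) chart set \<Rightarrow> ('a, 'm) rmetric \<Rightarrow> ('a \<Rightarrow> real) \<Rightarrow> 'a \<Rightarrow> real" where
  "hess_min A g U p =
     Inf {g p (cov_deriv A g (gradient A g U) p \<xi>) \<xi> |\<xi>. \<xi> \<in> tangent_space A p \<and> rnorm g p \<xi> = 1}"

definition force_max ::
    "('a, 'm) rmetric \<Rightarrow> (real ^ 'k::finite \<Rightarrow> 'a \<Rightarrow> ('a, 'm) tvec) \<Rightarrow> 'a \<Rightarrow> real" where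
  "force_max g f p = (SUP \<phi>. rnorm g p (f \<phi> p))"

definition form_max ::
    "('a, 'm::finite) chart set \<Rightarrow> ('a, 'm) rmetric
       \<Rightarrow> (real ^ 'k::finite \<Rightarrow> 'a \<Rightarrow> ('a, 'm) tvec \<Rightarrow> ('a, 'm) tvec) \<Rightarrow> 'a \<Rightarrow> real" where
  "form_max A g P p =
     Sup {\<bar>g p (P \<phi> p \<xi>) \<xi>\<bar> |\<phi> \<xi>. \<xi> \<in> tangent_space A p \<and> rnorm g p \<xi> = 1}"

definition const_Cf ::
    "('a::topological_space, 'm::finite) chart set \<Rightarrow> ('a, 'm) rmetric \<Rightarrow> ('a \<Rightarrow> real) \<Rightarrow> 'a set
       \<Rightarrow> (real ^ 'k::finite \<Rightarrow> 'a \<Rightarrow> ('a, 'm) tvec) \<Rightarrow> real" where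
  "const_Cf A g U D f = (SUP p\<in>closure D. force_max g f p / hess_min A g U p)"

definition const_CU ::
    "('a::topological_space, 'm::finite) chart set \<Rightarrow> ('a, 'm) rmetric \<Rightarrow> ('a \<Rightarrow> real) \<Rightarrow> 'a set
       \<Rightarrow> real" where
  "const_CU A g U D = (SUP p\<in>closure D. rnorm g p (gradient A g U p))"

definition const_q ::
    "('a::topological_space, 'm::finite) chart set \<Rightarrow> ('a, 'm) rmetric \<Rightarrow> ('a \<Rightarrow> real) \<Rightarrow> 'a set
       \<Rightarrow> (real ^ 'k::finite \<Rightarrow> 'a \<Rightarrow> ('a, 'm) tvec) \<Rightarrow> real" where
  "const_q A g U D f =
     sqrt (SUP (\<phi>, p) \<in> UNIV \<times> closure D. - (g p (gradient A g U p) (f \<phi> p) / hess_min A g U p))"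

definition const_p ::
    "('a::topological_space, 'm::finite) chart set \<Rightarrow> ('a, 'm) rmetric \<Rightarrow> ('a \<Rightarrow> real) \<Rightarrow> 'a set
       \<Rightarrow> (real ^ 'k::finite \<Rightarrow> 'a \<Rightarrow> ('a, 'm) tvec \<Rightarrow> ('a, 'm) tvec) \<Rightarrow> real" where
  "const_p A g U D P =
     (SUP (\<phi>, p) \<in> UNIV \<times> closure D.
        rnorm g p (radjoint A g p (P \<phi> p) (gradient A g U p)) / hess_min A g U p)"

definition const_l ::
    "('a::topological_space, 'm::finite) chart set \<Rightarrow> ('a, 'm) rmetric \<Rightarrow> 'a set
       \<Rightarrow> (real ^ 'k::finite \<Rightarrow> 'a \<Rightarrow> ('a, 'm) tvec)
       \<Rightarrow> (real ^ 'k \<Rightarrow> 'a \<Rightarrow> ('a, 'm) tvec \<Rightarrow> ('a, 'm) tvec) \<Rightarrow> real" where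
  "const_l A g D f P = (SUP p\<in>closure D. form_max A g P p / force_max g f p)"

definition z_plus ::
    "('a::topological_space, 'm::finite) chart set \<Rightarrow> ('a, 'm) rmetric \<Rightarrow> ('a \<Rightarrow> real) \<Rightarrow> 'a set
       \<Rightarrow> (real ^ 'k::finite \<Rightarrow> 'a \<Rightarrow> ('a, 'm) tvec)
       \<Rightarrow> (real ^ 'k \<Rightarrow> 'a \<Rightarrow> ('a, 'm) tvec \<Rightarrow> ('a, 'm) tvec) \<Rightarrow> real" where
  "z_plus A g U D f P =
     (const_p A g U D P + sqrt (4 * (const_q A g U D f)\<^sup>2 + (const_p A g U D P)\<^sup>2)) / 2"

definition I_fun ::
    "('a::topological_space, 'm::finite) chart set \<Rightarrow> ('a, 'm) rmetric \<Rightarrow> ('a \<Rightarrow> real) \<Rightarrow> 'a set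
       \<Rightarrow> (real ^ 'k::finite \<Rightarrow> 'a \<Rightarrow> ('a, 'm) tvec)
       \<Rightarrow> (real ^ 'k \<Rightarrow> 'a \<Rightarrow> ('a, 'm) tvec \<Rightarrow> ('a, 'm) tvec) \<Rightarrow> real \<Rightarrow> real" where
  "I_fun A g U D f P z =
     integral {z_plus A g U D f P..z}
       (\<lambda>w. (w\<^sup>2 - const_p A g U D P * w - (const_q A g U D f)\<^sup>2) / (const_l A g D f P * w + 1))"

definition zeta_star :: "real \<Rightarrow> real" where
  "zeta_star m = Max {\<zeta>. \<zeta> ^ 3 - 3 * \<zeta> + 2 - 3 * m = 0}"

definition z_star ::
    "('a::topological_space, 'm::finite) chart set \<Rightarrow> ('a, 'm) rmetric \<Rightarrow> ('a \<Rightarrow> real) \<Rightarrow> 'a set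
       \<Rightarrow> (real ^ 'k::finite \<Rightarrow> 'a \<Rightarrow> ('a, 'm) tvec)
       \<Rightarrow> (real ^ 'k \<Rightarrow> 'a \<Rightarrow> ('a, 'm) tvec \<Rightarrow> ('a, 'm) tvec) \<Rightarrow> real" where
  "z_star A g U D f P =
     (if zero_tensor_field_family A P
      then const_q A g U D f *
             zeta_star (const_Cf A g U D f * const_CU A g U D / (const_q A g U D f)\<^sup>2)
      else (THE z. z \<ge> z_plus A g U D f P \<and>
                   I_fun A g U D f P z
                     = const_Cf A g U D f * const_CU A g U D * z_plus A g U D f P))"

end

theory Submission
  imports Defs
begin

text \<open>
  Along a solution \<open>x\<close> let \<open>v\<close> be its speed and \<open>h = \<langle>\<nabla>U, x'\<rangle>\<close> the derivative of \<open>U(x)\<close>. The definitions of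
  the constants give
  \<open>h' = \<langle>H x', x'\<rangle> + \<langle>\<nabla>U, f + P x'\<rangle> \<ge> \<lambda> (v\<^sup>2 - p v - q\<^sup>2)\<close>, which is positive as long as \<open>v > z\<^sub>+\<close>, and
  \<open>\<bar>v'\<bar> \<le> M\<^sub>f (1 + l v)\<close> with \<open>M\<^sub>f \<le> C\<^sub>f \<lambda>\<close>. Dividing, \<open>\<bar>I(v)'\<bar> \<le> C\<^sub>f h'\<close> while \<open>v > z\<^sub>+\<close>: a change of
  \<open>I(v)\<close>, in either direction, is paid for by growth of \<open>h\<close> (\<open>excursion_estimate\<close>).

  Suppose \<open>v(t) > z\<^sub>+\<close>. The excursion above \<open>z\<^sub>+\<close> began at a time with \<open>v = z\<^sub>+\<close>, where \<open>\<bar>h\<bar> \<le> C\<^sub>U z\<^sub>+\<close>. If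
  \<open>h(t) \<le> 0\<close>, then \<open>h\<close> has grown by at most \<open>C\<^sub>U z\<^sub>+\<close> since. If \<open>h(t) > 0\<close>, the excursion has to end, because
  otherwise \<open>h\<close> would stay at or above \<open>h(t)\<close> and \<open>U(x)\<close> would be unbounded on a compact set; it ends with \<open>v = z\<^sub>+\<close>,
  and from \<open>t\<close> to its end \<open>h\<close> grows by at most \<open>C\<^sub>U z\<^sub>+\<close>. In both cases \<open>I(v(t)) \<le> C\<^sub>f C\<^sub>U z\<^sub>+\<close>
  (\<open>primitive_speed_bound\<close>), and \<open>z\<^sub>*\<close> is the number at which \<open>I\<close> has this value; for \<open>P = 0\<close> the function
  \<open>I\<close> is a cubic polynomial and this number is the scaled root \<open>q \<zeta>\<^sub>*\<close> (\<open>le_z_star\<close>).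

  The geometric work consists in making these inequalities meaningful. The suprema in the constants
  are finite only because the closure of the bounded domain is compact, which is the part of the
  Hopf-Rinow theorem proved as \<open>compact_closure_of_bounded\<close>: in a complete length space that is locally
  totally bounded, all balls are totally bounded; no geodesics are involved. Given compactness, local
  bounds in charts suffice, uniform over the torus (\<open>metric_comparable\<close>, \<open>tensor_field_locally_bounded\<close>,
  \<open>hess_min_locally_positive\<close>).

  Tangent vectors are families of components indexed by the charts, and the metric is constrained on
  tangent vectors only. Hence the covariant derivative of the gradient, defined chart by chart, has to
  be shown to be a tangent vector. This is the transformation law of the Christoffel symbols
  (\<open>christoffel_form_transform\<close>). Computations are carried out in a chart, where the metric becomes a
  bilinear form with smooth coefficients.
\<close>

section \<open>Calculus in Euclidean spaces\<close>

lemma smooth_on_has_derivative: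
  "smooth_on S f \<Longrightarrow> y \<in> S \<Longrightarrow> (f has_derivative frechet_derivative f (at y)) (at y)"
  using smooth_on_differentiable frechet_derivative_works by blast

lemma smooth_on_frechet_derivative:
  "smooth_on S f \<Longrightarrow> smooth_on S (\<lambda>y. frechet_derivative f (at y) v)"
  unfolding smooth_on_def using Ck_on.simps(2) by blast

lemma smooth_on_imp_continuous_on: "smooth_on S f \<Longrightarrow> continuous_on S f"
  unfolding smooth_on_def using Ck_on.simps(1) by blast

text \<open>The second difference of \<open>f\<close> over a parallelogram does not distinguish its two sides, while
  two applications of the mean value theorem express it by an iterated derivative; this is what
  makes mixed derivatives commute.\<close>

lemma second_difference_mean_value:
  fixes f :: "'a::euclidean_space \<Rightarrow> real"
  assumes h: "0 < h"
    and S: "\<And>a b. 0 \<le> a \<Longrightarrow> a \<le> h \<Longrightarrow> 0 \<le> b \<Longrightarrow> b \<le> h \<Longrightarrow> y + a *\<^sub>R v + b *\<^sub>R w \<in> S"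
    and f: "smooth_on S f"
  obtains a b where "0 \<le> a" "a \<le> h" "0 \<le> b" "b \<le> h"
    "f (y + h *\<^sub>R v + h *\<^sub>R w) - f (y + h *\<^sub>R v) - f (y + h *\<^sub>R w) + f y
       = h * h * frechet_derivative (\<lambda>z. frechet_derivative f (at z) v) (at (y + a *\<^sub>R v + b *\<^sub>R w)) w"
proof -
  let ?D = "\<lambda>z. frechet_derivative f (at z) v"
  have deriv_a: "((\<lambda>a. f (y + a *\<^sub>R v + b *\<^sub>R w)) has_real_derivative ?D (y + a *\<^sub>R v + b *\<^sub>R w)) (at a)"
    if "0 \<le> a" "a \<le> h" "0 \<le> b" "b \<le> h" for a b
  proof -
    have "((\<lambda>a. y + a *\<^sub>R v + b *\<^sub>R w) has_derivative (\<lambda>t. t *\<^sub>R v)) (at a)"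
      by (auto intro!: derivative_eq_intros)
    from has_derivative_compose[OF this smooth_on_has_derivative[OF f S[OF that]]]
    have *: "((\<lambda>a. f (y + a *\<^sub>R v + b *\<^sub>R w)) has_derivative
        (\<lambda>t. frechet_derivative f (at (y + a *\<^sub>R v + b *\<^sub>R w)) (t *\<^sub>R v))) (at a)" .
    have "linear (frechet_derivative f (at (y + a *\<^sub>R v + b *\<^sub>R w)))"
      using smooth_on_has_derivative[OF f S[OF that]] has_derivative_linear by blast
    with * show ?thesis by (simp add: has_field_derivative_def linear_scale mult_commute_abs)
  qed
  have "\<exists>a. 0 < a \<and> a < h \<and> (f (y + h *\<^sub>R v + h *\<^sub>R w) - f (y + h *\<^sub>R v + 0 *\<^sub>R w))
      - (f (y + 0 *\<^sub>R v + h *\<^sub>R w) - f (y + 0 *\<^sub>R v + 0 *\<^sub>R w))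
      = (h - 0) * (?D (y + a *\<^sub>R v + h *\<^sub>R w) - ?D (y + a *\<^sub>R v + 0 *\<^sub>R w))"
    using h by (intro MVT2[where f = "\<lambda>a. f (y + a *\<^sub>R v + h *\<^sub>R w) - f (y + a *\<^sub>R v + 0 *\<^sub>R w)"]
        DERIV_diff deriv_a) auto
  then obtain a where a: "0 < a" "a < h"
    "f (y + h *\<^sub>R v + h *\<^sub>R w) - f (y + h *\<^sub>R v) - f (y + h *\<^sub>R w) + f y
      = h * (?D (y + a *\<^sub>R v + h *\<^sub>R w) - ?D (y + a *\<^sub>R v))" by auto
  have deriv_b: "((\<lambda>b. ?D (y + a *\<^sub>R v + b *\<^sub>R w)) has_real_derivative
      frechet_derivative ?D (at (y + a *\<^sub>R v + b *\<^sub>R w)) w) (at b)" if "0 \<le> b" "b \<le> h" for b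
  proof -
    have Sb: "y + a *\<^sub>R v + b *\<^sub>R w \<in> S" using S a that by simp
    have "((\<lambda>b. y + a *\<^sub>R v + b *\<^sub>R w) has_derivative (\<lambda>t. t *\<^sub>R w)) (at b)"
      by (auto intro!: derivative_eq_intros)
    from has_derivative_compose[OF this smooth_on_has_derivative[OF smooth_on_frechet_derivative[OF f] Sb]]
    have *: "((\<lambda>b. ?D (y + a *\<^sub>R v + b *\<^sub>R w)) has_derivative
        (\<lambda>t. frechet_derivative ?D (at (y + a *\<^sub>R v + b *\<^sub>R w)) (t *\<^sub>R w))) (at b)" .
    have "linear (frechet_derivative ?D (at (y + a *\<^sub>R v + b *\<^sub>R w)))"
      using smooth_on_has_derivative[OF smooth_on_frechet_derivative[OF f] Sb] has_derivative_linear
      by blast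
    with * show ?thesis by (simp add: has_field_derivative_def linear_scale mult_commute_abs)
  qed
  have "\<exists>b. 0 < b \<and> b < h \<and> ?D (y + a *\<^sub>R v + h *\<^sub>R w) - ?D (y + a *\<^sub>R v + 0 *\<^sub>R w)
      = (h - 0) * frechet_derivative ?D (at (y + a *\<^sub>R v + b *\<^sub>R w)) w"
    using h by (intro MVT2 deriv_b) auto
  then obtain b where "0 < b" "b < h"
    "?D (y + a *\<^sub>R v + h *\<^sub>R w) - ?D (y + a *\<^sub>R v)
      = h * frechet_derivative ?D (at (y + a *\<^sub>R v + b *\<^sub>R w)) w" by auto
  with a that[of a b] show thesis by simp
qed

lemma mixed_derivatives_commute:
  fixes f :: "'a::euclidean_space \<Rightarrow> real"
  assumes S: "open S" "y \<in> S" and f: "smooth_on S f"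
  shows "frechet_derivative (\<lambda>z. frechet_derivative f (at z) v) (at y) w
       = frechet_derivative (\<lambda>z. frechet_derivative f (at z) w) (at y) v"
proof (rule ccontr)
  let ?A = "\<lambda>z. frechet_derivative (\<lambda>z. frechet_derivative f (at z) v) (at z) w"
  let ?B = "\<lambda>z. frechet_derivative (\<lambda>z. frechet_derivative f (at z) w) (at z) v"
  assume "?A y \<noteq> ?B y"
  define \<epsilon> where "\<epsilon> = \<bar>?A y - ?B y\<bar> / 2"
  have \<epsilon>: "0 < \<epsilon>" using \<open>?A y \<noteq> ?B y\<close> by (simp add: \<epsilon>_def)
  have cont: "isCont ?A y" "isCont ?B y"
    using smooth_on_imp_continuous_on[OF smooth_on_frechet_derivative[OF smooth_on_frechet_derivative[OF f]]] S
    by (auto simp: continuous_on_eq_continuous_at)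
  obtain d1 where d1: "0 < d1" "\<forall>z. dist z y < d1 \<longrightarrow> dist (?A z) (?A y) < \<epsilon>"
    using continuous_at_eps_delta[THEN iffD1, OF cont(1), rule_format, OF \<epsilon>] by blast
  obtain d2 where d2: "0 < d2" "\<forall>z. dist z y < d2 \<longrightarrow> dist (?B z) (?B y) < \<epsilon>"
    using continuous_at_eps_delta[THEN iffD1, OF cont(2), rule_format, OF \<epsilon>] by blast
  note d = d1(1) d2(1) d1(2) d2(2)
  obtain d3 where d3: "0 < d3" "ball y d3 \<subseteq> S" using S open_contains_ball by blast
  \<comment> \<open>Parallelograms with sides \<open>h *\<^sub>R v\<close>, \<open>h *\<^sub>R w\<close> stay in \<open>S\<close> and within the reach of both continuity estimates.\<close>
  define r where "r = min d1 (min d2 d3)"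
  define h where "h = r / (2 * (norm v + norm w + 1))"
  have r: "0 < r" using d d3 by (simp add: r_def)
  have h: "0 < h" using r unfolding h_def by (intro divide_pos_pos mult_pos_pos add_nonneg_pos) auto
  have near: "dist (y + a *\<^sub>R v + b *\<^sub>R w) y < r" if "0 \<le> a" "a \<le> h" "0 \<le> b" "b \<le> h" for a b
  proof -
    have "norm (a *\<^sub>R v + b *\<^sub>R w) \<le> h * norm v + h * norm w"
      using that by (intro norm_triangle_le add_mono) (auto intro: mult_right_mono)
    also have "\<dots> \<le> h * (norm v + norm w + 1)" using h by (simp add: algebra_simps)
    also have "\<dots> = r / 2" using r unfolding h_def
      by (simp add: field_simps add_nonneg_eq_0_iff)
    finally show ?thesis using r by (simp add: dist_norm add.assoc)
  qed
  have in1: "y + a *\<^sub>R v + b *\<^sub>R w \<in> S" if "0 \<le> a" "a \<le> h" "0 \<le> b" "b \<le> h" for a b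
    using near[OF that] d3 by (auto simp: r_def dist_commute subset_eq)
  obtain a b where ab: "0 \<le> a" "a \<le> h" "0 \<le> b" "b \<le> h"
    "f (y + h *\<^sub>R v + h *\<^sub>R w) - f (y + h *\<^sub>R v) - f (y + h *\<^sub>R w) + f y = h * h * ?A (y + a *\<^sub>R v + b *\<^sub>R w)"
    by (rule second_difference_mean_value[OF h in1 f])
  have in2: "y + a *\<^sub>R w + b *\<^sub>R v \<in> S" if "0 \<le> a" "a \<le> h" "0 \<le> b" "b \<le> h" for a b
    using near[OF that(3,4,1,2)] d3 by (auto simp: r_def dist_commute subset_eq add.commute add.left_commute)
  obtain b' a' where ab': "0 \<le> b'" "b' \<le> h" "0 \<le> a'" "a' \<le> h"
    "f (y + h *\<^sub>R w + h *\<^sub>R v) - f (y + h *\<^sub>R w) - f (y + h *\<^sub>R v) + f y = h * h * ?B (y + b' *\<^sub>R w + a' *\<^sub>R v)"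
    by (rule second_difference_mean_value[OF h in2 f])
  have "h * h * ?A (y + a *\<^sub>R v + b *\<^sub>R w) = h * h * ?B (y + a' *\<^sub>R v + b' *\<^sub>R w)"
    using ab(5) ab'(5) by (simp add: algebra_simps)
  then have "?A (y + a *\<^sub>R v + b *\<^sub>R w) = ?B (y + a' *\<^sub>R v + b' *\<^sub>R w)" using h by simp
  moreover have "dist (?A (y + a *\<^sub>R v + b *\<^sub>R w)) (?A y) < \<epsilon>"
    using d(3) near[OF ab(1-4)] by (simp add: r_def)
  moreover have "dist (?B (y + a' *\<^sub>R v + b' *\<^sub>R w)) (?B y) < \<epsilon>"
    using d(4) near[OF ab'(3,4,1,2)] by (simp add: r_def)
  ultimately have "\<bar>?A y - ?B y\<bar> < 2 * \<epsilon>" by (simp add: dist_real_def)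
  then show False by (simp add: \<epsilon>_def)
qed

lemma frechet_derivative_vec_nth:
  assumes "f differentiable (at y)"
  shows "frechet_derivative (\<lambda>z. f z $ i) (at y) v = frechet_derivative f (at y) v $ i"
proof -
  have "((\<lambda>z. f z $ i) has_derivative (\<lambda>v. frechet_derivative f (at y) v $ i)) (at y)"
    using assms by (intro bounded_linear.has_derivative[OF bounded_linear_vec_nth])
      (simp add: frechet_derivative_works)
  from frechet_derivative_at[OF this, symmetric] show ?thesis by simp
qed

lemma frechet_derivative_cong_open:
  assumes "open S" "y \<in> S" "\<And>z. z \<in> S \<Longrightarrow> f z = h z"
  shows "frechet_derivative f (at y) = frechet_derivative h (at y)"
proof -
  have "(f has_derivative d) (at y) = (h has_derivative d) (at y)" for d
    using assms has_derivative_transform_within_open[of f d y UNIV S h]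
      has_derivative_transform_within_open[of h d y UNIV S f] by auto
  then show ?thesis unfolding frechet_derivative_def by simp
qed

lemma Ck_on_cong_open:
  assumes S: "open S"
  shows "(\<And>z. z \<in> S \<Longrightarrow> f z = h z) \<Longrightarrow> Ck_on k S f \<Longrightarrow> Ck_on k S h"
proof (induction k arbitrary: f h)
  case 0
  have "continuous_on S f \<longleftrightarrow> continuous_on S h" by (intro continuous_on_cong 0) simp
  then show ?case using 0 by simp
next
  case (Suc k)
  have f: "f differentiable (at z)" "Ck_on k S (\<lambda>z. frechet_derivative f (at z) v)" if "z \<in> S" for z v
    using Suc.prems(2) that by auto
  have "h differentiable (at z)" if z: "z \<in> S" for z
  proof -
    obtain d where "(f has_derivative d) (at z)" using f(1)[OF z] unfolding differentiable_def by blast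
    then have "(h has_derivative d) (at z)"
      by (rule has_derivative_transform_within_open[OF _ S z]) (rule Suc.prems(1))
    then show ?thesis unfolding differentiable_def by blast
  qed
  moreover have "Ck_on k S (\<lambda>z. frechet_derivative h (at z) v)" for v
  proof (rule Suc.IH)
    show "Ck_on k S (\<lambda>z. frechet_derivative f (at z) v)" using Suc.prems(2) by simp
    show "frechet_derivative f (at z) v = frechet_derivative h (at z) v" if "z \<in> S" for z
      by (rule fun_cong[OF frechet_derivative_cong_open[OF S that Suc.prems(1)]])
  qed
  ultimately show ?case by simp
qed

lemma Ck_on_vec_nth:
  fixes f :: "'a::euclidean_space \<Rightarrow> real ^ 'n"
  assumes S: "open S"
  shows "Ck_on k S f \<Longrightarrow> Ck_on k S (\<lambda>z. f z $ i)"
proof (induction k arbitrary: f)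
  case 0
  then show ?case by (auto intro: continuous_intros)
next
  case (Suc k)
  have d: "f differentiable (at z)" if "z \<in> S" for z using Suc.prems that by simp
  have "(\<lambda>z. f z $ i) differentiable (at z)" if "z \<in> S" for z
    using d[OF that] bounded_linear.has_derivative[OF bounded_linear_vec_nth]
    unfolding differentiable_def by blast
  moreover have "Ck_on k S (\<lambda>z. frechet_derivative (\<lambda>z. f z $ i) (at z) v)" for v
  proof (rule Ck_on_cong_open[OF S])
    show "Ck_on k S (\<lambda>z. frechet_derivative f (at z) v $ i)" using Suc by simp
    show "frechet_derivative f (at z) v $ i = frechet_derivative (\<lambda>z. f z $ i) (at z) v" if "z \<in> S" for z
      by (rule frechet_derivative_vec_nth[OF d[OF that], symmetric])
  qed
  ultimately show ?case by simp
qed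

lemma mixed_derivatives_commute_vec:
  fixes f :: "'a::euclidean_space \<Rightarrow> real ^ 'n"
  assumes S: "open S" "y \<in> S" and f: "smooth_on S f"
  shows "frechet_derivative (\<lambda>z. frechet_derivative f (at z) v) (at y) w
       = frechet_derivative (\<lambda>z. frechet_derivative f (at z) w) (at y) v"
proof -
  have "frechet_derivative (\<lambda>z. frechet_derivative f (at z) v) (at y) w $ i
      = frechet_derivative (\<lambda>z. frechet_derivative (\<lambda>z. f z $ i) (at z) v) (at y) w" for v w i
  proof -
    have "frechet_derivative (\<lambda>z. frechet_derivative (\<lambda>z. f z $ i) (at z) v) (at y)
        = frechet_derivative (\<lambda>z. frechet_derivative f (at z) v $ i) (at y)"
      by (rule frechet_derivative_cong_open[OF S])
        (rule frechet_derivative_vec_nth[OF smooth_on_differentiable[OF f]])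
    then show ?thesis
      using frechet_derivative_vec_nth[OF smooth_on_differentiable[OF smooth_on_frechet_derivative[OF f] S(2)]]
      by simp
  qed
  moreover have "smooth_on S (\<lambda>z. f z $ i)" for i
    using f Ck_on_vec_nth[OF S(1)] unfolding smooth_on_def by blast
  ultimately show ?thesis
    using mixed_derivatives_commute[OF S] by (simp add: vec_eq_iff)
qed

lemma differentiable_vec_lambda:
  assumes "\<And>k. f k differentiable (at y)"
  shows "(\<lambda>z. (\<chi> k. f k z) :: real ^ 'n) differentiable (at y)"
proof -
  have "(\<lambda>z. (\<chi> k. f k z) :: real ^ 'n) = (\<lambda>z. \<Sum>k\<in>UNIV. f k z *\<^sub>R axis k 1)"
    by (simp add: fun_eq_iff vec_eq_iff axis_def if_distrib cong: if_cong)
  then show ?thesis using assms by (simp add: differentiable_scaleR)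
qed

lemma det_differentiable:
  fixes M :: "'a::real_normed_vector \<Rightarrow> real ^ 'n ^ 'n"
  assumes "\<And>i j. (\<lambda>z. M z $ i $ j) differentiable (at y)"
  shows "(\<lambda>z. det (M z)) differentiable (at y)"
proof -
  have "(\<lambda>z. \<Prod>i\<in>UNIV. M z $ i $ p i) differentiable (at y)" for p
    using has_derivative_prod[of UNIV "\<lambda>i z. M z $ i $ p i", OF assms[unfolded frechet_derivative_works]]
    unfolding differentiable_def by blast
  then show ?thesis unfolding det_def by (auto intro!: differentiable_sum)
qed

text \<open>Cramer's rule writes the solution as a quotient of determinants, which are polynomials in the data.
  In this way the components of a gradient inherit differentiability from those of the metric and
  of the differential.\<close>

lemma linear_system_solution_differentiable:
  fixes M :: "'a::real_normed_vector \<Rightarrow> real ^ 'n ^ 'n"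
  assumes S: "open S" "y \<in> S"
    and M: "\<And>i j. (\<lambda>z. M z $ i $ j) differentiable (at y)" "\<And>z. z \<in> S \<Longrightarrow> det (M z) \<noteq> 0"
    and b: "\<And>i. (\<lambda>z. b z $ i) differentiable (at y)"
    and W: "\<And>z. z \<in> S \<Longrightarrow> M z *v W z = b z"
  shows "W differentiable (at y)"
proof -
  let ?W = "\<lambda>z. (\<chi> k. det (\<chi> i j. if j = k then b z $ i else M z $ i $ j) / det (M z)) :: real ^ 'n"
  have "(\<lambda>z. (\<chi> i j. if j = k then b z $ i else M z $ i $ j) $ i $ j) differentiable (at y)" for i j k
    using b M(1) by (cases "j = k") simp_all
  note det_k = det_differentiable[OF this]
  have "?W differentiable (at y)"
    by (rule differentiable_vec_lambda, rule differentiable_divide[OF det_k det_differentiable[OF M(1)] M(2)[OF S(2)]])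
  then obtain D where "(?W has_derivative D) (at y)" unfolding differentiable_def by blast
  then have "(W has_derivative D) (at y)"
    by (rule has_derivative_transform_within_open[OF _ S]) (rule cramer[OF M(2), THEN iffD1, OF _ W, symmetric])
  then show ?thesis unfolding differentiable_def by blast
qed


section \<open>Quadratic forms depending on a parameter\<close>

lemma matrix_form_bound:
  fixes M :: "real ^ 'n ^ 'm"
  shows "\<bar>v \<bullet> (M *v w)\<bar> \<le> (\<Sum>i\<in>UNIV. \<Sum>j\<in>UNIV. \<bar>M $ i $ j\<bar>) * (norm v * norm w)"
proof -
  have "v \<bullet> (M *v w) = (\<Sum>i\<in>UNIV. \<Sum>j\<in>UNIV. M $ i $ j * (v $ i * w $ j))"
    by (simp add: inner_vec_def matrix_vector_mult_def sum_distrib_left mult_ac)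
  also have "\<bar>\<dots>\<bar> \<le> (\<Sum>i\<in>UNIV. \<Sum>j\<in>UNIV. \<bar>M $ i $ j\<bar> * (norm v * norm w))"
    by (intro order_trans[OF sum_abs] sum_mono order_trans[OF sum_abs])
      (auto simp: abs_mult component_le_norm_cart intro!: mult_mono)
  finally show ?thesis by (simp add: sum_distrib_right)
qed

text \<open>The least value on the compact unit sphere is attained, hence positive; homogeneity of degree two
  extends the estimate to all vectors.\<close>

lemma posdef_coercive:
  fixes M :: "real ^ 'n ^ 'n"
  assumes "\<And>v. v \<noteq> 0 \<Longrightarrow> 0 < v \<bullet> (M *v v)"
  obtains m where "0 < m" "\<And>v. m * (norm v)\<^sup>2 \<le> v \<bullet> (M *v v)"
proof -
  have "continuous_on (sphere 0 1) (\<lambda>v. v \<bullet> (M *v v))"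
    by (intro continuous_intros)
  then have "\<exists>u\<in>sphere 0 1. \<forall>v\<in>sphere 0 1. u \<bullet> (M *v u) \<le> v \<bullet> (M *v v)"
    by (intro continuous_attains_inf compact_sphere) simp_all
  then obtain u where u: "u \<in> sphere 0 1" "\<And>v. v \<in> sphere 0 1 \<Longrightarrow> u \<bullet> (M *v u) \<le> v \<bullet> (M *v v)"
    by blast
  have "(u \<bullet> (M *v u)) * (norm v)\<^sup>2 \<le> v \<bullet> (M *v v)" for v
  proof (cases "v = 0")
    case False
    let ?e = "v /\<^sub>R norm v"
    have "u \<bullet> (M *v u) \<le> ?e \<bullet> (M *v ?e)" using False by (intro u) simp
    also have "\<dots> = (v \<bullet> (M *v v)) / (norm v)\<^sup>2"
      by (simp add: matrix_vector_mult_scaleR power2_eq_square field_simps)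
    finally show ?thesis using False by (simp add: field_simps)
  qed simp
  moreover have "0 < u \<bullet> (M *v u)" using u(1) by (intro assms) auto
  ultimately show thesis using that by blast
qed

text \<open>Once \<open>K z\<close> is close enough to its limit, half of the coercivity constant of the limit is left. The
  lemma serves twice: for the metric itself, and for the Hessian minus a multiple of the metric.\<close>

lemma eventually_coercive:
  fixes K :: "'b \<Rightarrow> real ^ 'n ^ 'n"
  assumes K: "\<And>i j. ((\<lambda>z. K z $ i $ j) \<longlongrightarrow> K0 $ i $ j) F"
    and K0: "\<And>v. v \<noteq> 0 \<Longrightarrow> 0 < v \<bullet> (K0 *v v)"
  obtains m where "0 < m" "\<forall>\<^sub>F z in F. \<forall>v. m * (norm v)\<^sup>2 \<le> v \<bullet> (K z *v v)"
proof -
  obtain m where m: "0 < m" "\<And>v. m * (norm v)\<^sup>2 \<le> v \<bullet> (K0 *v v)"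
    using posdef_coercive[OF K0] by blast
  have "((\<lambda>z. \<Sum>i\<in>UNIV. \<Sum>j\<in>UNIV. \<bar>(K0 - K z) $ i $ j\<bar>) \<longlongrightarrow> (\<Sum>i\<in>UNIV. \<Sum>j\<in>UNIV. \<bar>K0 $ i $ j - K0 $ i $ j\<bar>)) F"
    unfolding vector_minus_component by (intro tendsto_intros K)
  then have "\<forall>\<^sub>F z in F. (\<Sum>i\<in>UNIV. \<Sum>j\<in>UNIV. \<bar>(K0 - K z) $ i $ j\<bar>) < m / 2"
    by (rule order_tendstoD) (use m in simp)
  then have "\<forall>\<^sub>F z in F. \<forall>v. m / 2 * (norm v)\<^sup>2 \<le> v \<bullet> (K z *v v)"
  proof (rule eventually_mono, intro allI)
    fix z v assume *: "(\<Sum>i\<in>UNIV. \<Sum>j\<in>UNIV. \<bar>(K0 - K z) $ i $ j\<bar>) < m / 2"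
    have "v \<bullet> ((K0 - K z) *v v) \<le> (\<Sum>i\<in>UNIV. \<Sum>j\<in>UNIV. \<bar>(K0 - K z) $ i $ j\<bar>) * (norm v * norm v)"
      using matrix_form_bound[of v "K0 - K z" v] by linarith
    also have "\<dots> \<le> m / 2 * (norm v)\<^sup>2"
      unfolding power2_eq_square using * by (intro mult_right_mono) auto
    finally show "m / 2 * (norm v)\<^sup>2 \<le> v \<bullet> (K z *v v)"
      using m(2)[of v] by (simp add: matrix_vector_mult_diff_rdistrib inner_diff_right)
  qed
  with m show thesis using that[of "m / 2"] by simp
qed

lemma eventually_form_bounded:
  fixes K :: "'b \<Rightarrow> real ^ 'n ^ 'm"
  assumes K: "\<And>i j. ((\<lambda>z. K z $ i $ j) \<longlongrightarrow> K0 $ i $ j) F"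
  obtains N where "0 < N" "\<forall>\<^sub>F z in F. \<forall>v w. \<bar>v \<bullet> (K z *v w)\<bar> \<le> N * (norm v * norm w)"
proof -
  let ?s = "\<lambda>M :: real ^ 'n ^ 'm. \<Sum>i\<in>UNIV. \<Sum>j\<in>UNIV. \<bar>M $ i $ j\<bar>"
  have "((\<lambda>z. ?s (K z)) \<longlongrightarrow> ?s K0) F" by (intro tendsto_intros K)
  then have "\<forall>\<^sub>F z in F. ?s (K z) < ?s K0 + 1" by (rule order_tendstoD) simp
  then have "\<forall>\<^sub>F z in F. \<forall>v w. \<bar>v \<bullet> (K z *v w)\<bar> \<le> (?s K0 + 1) * (norm v * norm w)"
  proof (rule eventually_mono, intro allI)
    fix z and v :: "real ^ 'm" and w :: "real ^ 'n" assume "?s (K z) < ?s K0 + 1"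
    then have "?s (K z) * (norm v * norm w) \<le> (?s K0 + 1) * (norm v * norm w)"
      by (intro mult_right_mono) auto
    then show "\<bar>v \<bullet> (K z *v w)\<bar> \<le> (?s K0 + 1) * (norm v * norm w)"
      using matrix_form_bound[of v "K z" w] by linarith
  qed
  moreover have "0 < ?s K0 + 1" by (intro add_nonneg_pos sum_nonneg) auto
  ultimately show thesis using that by blast
qed


section \<open>Functions on the torus\<close>

lemma torus_periodic_reduce:
  fixes F :: "real ^ 'k::finite \<Rightarrow> 'b"
  assumes F: "torus_periodic F"
  obtains \<psi> where "\<psi> \<in> cbox 0 (\<chi> i. 2 * pi)" "F \<phi> = F \<psi>"
proof -
  have nat: "F (\<phi> + axis i (of_nat n * (2 * pi))) = F \<phi>" for \<phi> i n
  proof (induction n arbitrary: \<phi>)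
    case (Suc n)
    have "\<phi> + axis i (of_nat (Suc n) * (2 * pi)) = (\<phi> + axis i (2 * pi)) + axis i (of_nat n * (2 * pi))"
      by (simp add: vec_eq_iff axis_def algebra_simps)
    then show ?case using Suc F unfolding torus_periodic_def by metis
  next
    case 0
    have "axis i (0::real) = (0 :: real ^ 'k)" by (simp add: vec_eq_iff axis_def)
    then show ?case by (simp only: of_nat_0 mult_zero_left add_0_right)
  qed
  have int: "F (\<phi> + axis i (of_int n * (2 * pi))) = F \<phi>" for \<phi> i n
  proof (cases "n \<ge> 0")
    case True
    then show ?thesis using nat[of \<phi> i "nat n"] by simp
  next
    case False
    let ?\<theta> = "\<phi> + axis i (of_int n * (2 * pi))"
    have "?\<theta> + axis i (of_nat (nat (- n)) * (2 * pi)) = \<phi>"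
      using False by (simp add: vec_eq_iff axis_def algebra_simps)
    with nat[of ?\<theta> i "nat (- n)"] show ?thesis by metis
  qed
  \<comment> \<open>Integer multiples of the periods can be added in all coordinates, one coordinate at a time.\<close>
  have shift: "F (\<chi> j. if j \<in> J then \<phi> $ j + of_int (n j) * (2 * pi) else \<phi> $ j) = F \<phi>"
    if "finite J" for J and n :: "'k \<Rightarrow> int"
    using that
  proof induction
    case (insert i J)
    have "(\<chi> j. if j \<in> insert i J then \<phi> $ j + of_int (n j) * (2 * pi) else \<phi> $ j)
      = (\<chi> j. if j \<in> J then \<phi> $ j + of_int (n j) * (2 * pi) else \<phi> $ j) + axis i (of_int (n i) * (2 * pi))"
      using insert by (auto simp: vec_eq_iff axis_def)
    then show ?case using insert int by simp
  qed simp
  define n where "n j = \<lfloor>\<phi> $ j / (2 * pi)\<rfloor>" for j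
  let ?\<psi> = "\<chi> j. \<phi> $ j - of_int (n j) * (2 * pi)"
  have "F ?\<psi> = F \<phi>" using shift[of UNIV "\<lambda>j. - n j"] by simp
  moreover have "?\<psi> \<in> cbox 0 (\<chi> i. 2 * pi)"
  proof -
    have "of_int (n j) * (2 * pi) \<le> \<phi> $ j" for j
      unfolding n_def by (rule pos_le_divide_eq[THEN iffD1, OF _ of_int_floor_le]) simp
    moreover have "\<phi> $ j \<le> (of_int (n j) + 1) * (2 * pi)" for j
      unfolding n_def by (rule pos_divide_le_eq[THEN iffD1, OF _ real_of_int_floor_add_one_ge]) simp
    ultimately show ?thesis by (simp add: mem_box_cart algebra_simps)
  qed
  ultimately show thesis using that by metis
qed

text \<open>Compactness of the torus makes bounds uniform in the angle.\<close>

lemma torus_family_bounded: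
  fixes F :: "real ^ 'k::finite \<Rightarrow> 'c::topological_space \<Rightarrow> 'b::real_normed_vector"
  assumes F: "continuous_on (UNIV \<times> S) (\<lambda>(\<phi>, y). F \<phi> y)"
    and per: "\<And>y. y \<in> S \<Longrightarrow> torus_periodic (\<lambda>\<phi>. F \<phi> y)"
    and K: "compact K" "K \<subseteq> S"
  obtains N where "0 < N" "\<And>\<phi> y. y \<in> K \<Longrightarrow> norm (F \<phi> y) \<le> N"
proof -
  let ?C = "cbox 0 (\<chi> i. 2 * pi) :: (real ^ 'k) set"
  have "compact (?C \<times> K)" using K by (intro compact_Times compact_cbox)
  moreover have "continuous_on (?C \<times> K) (\<lambda>(\<phi>, y). F \<phi> y)"
    using F by (rule continuous_on_subset) (use K in auto)
  ultimately have "bounded ((\<lambda>(\<phi>, y). F \<phi> y) ` (?C \<times> K))"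
    using compact_continuous_image compact_imp_bounded by blast
  then obtain N where N: "0 < N" "\<And>\<phi> y. \<phi> \<in> ?C \<Longrightarrow> y \<in> K \<Longrightarrow> norm (F \<phi> y) \<le> N"
    unfolding bounded_pos by fastforce
  have "norm (F \<phi> y) \<le> N" if "y \<in> K" for \<phi> y
    using torus_periodic_reduce[OF per, of y \<phi>] N(2) that K(2) by (metis subsetD)
  with N(1) show thesis using that by blast
qed

lemma compact_locally_bounded_above:
  fixes h :: "'a::topological_space \<Rightarrow> real"
  assumes K: "compact K"
    and loc: "\<And>p. p \<in> K \<Longrightarrow> \<exists>W N. open W \<and> p \<in> W \<and> (\<forall>q\<in>W. h q \<le> N)"
  shows "\<exists>N>0. \<forall>p\<in>K. h p \<le> N"
proof -
  obtain W N where W: "\<And>p. p \<in> K \<Longrightarrow> open (W p)" "\<And>p. p \<in> K \<Longrightarrow> p \<in> W p"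
      "\<And>p q. p \<in> K \<Longrightarrow> q \<in> W p \<Longrightarrow> h q \<le> N p"
    using loc by metis
  obtain C where C: "C \<subseteq> K" "finite C" "K \<subseteq> (\<Union>c\<in>C. W c)"
    by (rule compactE_image[OF K W(1), of K]) (use W(2) in auto)
  let ?N = "Max (insert 1 (N ` C))"
  have "h p \<le> ?N" if p: "p \<in> K" for p
  proof -
    obtain c where c: "c \<in> C" "p \<in> W c" using C(3) p by blast
    then have "h p \<le> N c" using W(3) C by blast
    also have "\<dots> \<le> ?N" using c C by (intro Max_ge) auto
    finally show ?thesis .
  qed
  moreover have "1 \<le> ?N" using C by (intro Max_ge) auto
  ultimately show ?thesis by (intro exI[of _ ?N]) auto
qed


section \<open>Tangent vectors and the metric in a chart\<close>

lemma linear_eq_on_axes: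
  fixes f h :: "real ^ 'n \<Rightarrow> 'b::real_vector"
  assumes "linear f" "linear h" "\<And>i. f (axis i 1) = h (axis i 1)"
  shows "f v = h v"
proof -
  have "f = h"
    by (rule linear_eq_stdbasis[OF assms(1,2)]) (auto simp: Basis_vec_def assms(3))
  then show ?thesis by simp
qed

lemma bilinear_matrix_form:
  fixes B :: "real ^ 'n \<Rightarrow> real ^ 'm \<Rightarrow> real"
  assumes l: "\<And>w. linear (\<lambda>v. B v w)" and r: "\<And>v. linear (\<lambda>w. B v w)"
  shows "B v w = v \<bullet> ((\<chi> i j. B (axis i 1) (axis j 1)) *v w)"
proof (rule linear_eq_on_axes[where f = "\<lambda>v. B v w"])
  let ?M = "\<chi> i j. B (axis i 1) (axis j 1)"
  show "linear (\<lambda>v. B v w)" by (rule l)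
  show "linear (\<lambda>v. v \<bullet> (?M *v w))" by (rule linearI) (simp_all add: inner_add_left)
  fix i
  show "B (axis i 1) w = axis i 1 \<bullet> (?M *v w)"
  proof (rule linear_eq_on_axes[where f = "B (axis i 1)"])
    show "linear (B (axis i 1))" using r[of "axis i 1"] .
    show "linear (\<lambda>w. axis i 1 \<bullet> (?M *v w))"
      by (rule linearI) (simp_all add: matrix_vector_right_distrib inner_add_right matrix_vector_mult_scaleR)
    show "B (axis i 1) (axis j 1) = axis i 1 \<bullet> (?M *v axis j 1)" for j
      by (simp add: inner_axis' matrix_vector_mult_basis column_def)
  qed
qed

lemma bounded_bilinear_matrix_vector:
  "bounded_bilinear (\<lambda>M (v :: real ^ 'n). (M :: real ^ 'n ^ 'm) *v v)"
  unfolding bilinear_conv_bounded_bilinear[symmetric] bilinear_def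
  by (auto intro!: linearI simp: matrix_vector_mult_add_rdistrib matrix_vector_right_distrib
      matrix_vector_mult_scaleR scaleR_matrix_vector_assoc)

lemma has_derivative_matrix_form:
  fixes M :: "'b::real_normed_vector \<Rightarrow> real ^ 'n ^ 'm"
  assumes "(M has_derivative M') (at t within S)" "(a has_derivative a') (at t within S)"
    "(b has_derivative b') (at t within S)"
  shows "((\<lambda>t. a t \<bullet> (M t *v b t)) has_derivative
    (\<lambda>h. a' h \<bullet> (M t *v b t) + a t \<bullet> (M' h *v b t) + a t \<bullet> (M t *v b' h))) (at t within S)"
  using has_derivative_inner[OF assms(2) bounded_bilinear.FDERIV[OF bounded_bilinear_matrix_vector assms(1,3)]]
  by (simp add: inner_add_right algebra_simps)

lemma has_derivative_matrix:
  fixes M :: "'b::real_normed_vector \<Rightarrow> real ^ 'n ^ 'm"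
  assumes "\<And>i j. ((\<lambda>z. M z $ i $ j) has_derivative (\<lambda>h. M' h $ i $ j)) (at t within S)"
  shows "(M has_derivative M') (at t within S)"
proof -
  have rows: "((\<lambda>z. M z $ i) has_derivative (\<lambda>h. M' h $ i)) (at t within S)" for i
    unfolding has_derivative_componentwise_within[of "\<lambda>z. M z $ i"]
    using assms by (auto simp: Basis_vec_def inner_axis)
  show ?thesis
    unfolding has_derivative_componentwise_within[of M]
  proof
    fix b :: "real ^ 'n ^ 'm" assume "b \<in> Basis"
    then obtain i e where "b = axis i e" by (auto simp: Basis_vec_def)
    then show "((\<lambda>x. M x \<bullet> b) has_derivative (\<lambda>x. M' x \<bullet> b)) (at t within S)"
      using has_derivative_inner_left[OF rows[of i], of e] by (simp add: inner_axis)
  qed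
qed

locale riemannian =
  fixes A :: "('a::{t2_space,second_countable_topology}, 'm::finite) chart set"
    and g :: "('a, 'm) rmetric"
  assumes RM: "riemannian_manifold A g"
begin

lemma atlas: "smooth_atlas A"
  using RM unfolding riemannian_manifold_def by blast

lemma chart_exists: obtains c where "c \<in> charts_at A p"
  using atlas unfolding smooth_atlas_def charts_at_def by blast

lemma chart_atD:
  assumes "c \<in> charts_at A p"
  shows "c \<in> A" "p \<in> cdom c" "cmap c p \<in> crange c" "cinv c (cmap c p) = p"
  using assms chart_inverse[OF atlas assms] by (auto simp: charts_at_def)

lemma chart_domain:
  assumes "c \<in> A"
  shows "open (cdom c)" "open (crange c)" "continuous_on (cdom c) (cmap c)"
    "continuous_on (crange c) (cinv c)"
  using atlas assms unfolding smooth_atlas_def homeomorphism_def by blast+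

lemma charts_at_iff: "c \<in> charts_at A p \<longleftrightarrow> c \<in> A \<and> p \<in> cdom c"
  by (simp add: charts_at_def)

lemma cinv_chart:
  assumes "c \<in> A" "y \<in> crange c"
  shows "c \<in> charts_at A (cinv c y)" "cmap c (cinv c y) = y" "cinv c y \<in> cdom c"
  using point_chart[OF RM assms] by (auto simp: charts_at_def)

lemma eventually_nhds_chart:
  assumes c: "c \<in> charts_at A p" and P: "eventually P (nhds (cmap c p))"
  obtains W where "open W" "p \<in> W" "W \<subseteq> cdom c" "\<And>q. q \<in> W \<Longrightarrow> P (cmap c q)"
proof -
  obtain O' where O': "open O'" "cmap c p \<in> O'" "\<And>y. y \<in> O' \<Longrightarrow> P y"
    using P unfolding eventually_nhds by blast
  have "open (cdom c \<inter> cmap c -` O')"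
    using chart_domain[OF chart_atD(1)[OF c]] O'(1) continuous_on_open_vimage by (metis inf_commute)
  then show thesis using that[of "cdom c \<inter> cmap c -` O'"] O' chart_atD[OF c] by auto
qed

lemma coord_tvec_components:
  assumes "v \<in> tangent_space A p" "c \<in> charts_at A p"
  shows "coord_tvec A c p (v c) = v"
proof
  fix c'
  show "coord_tvec A c p (v c) c' = v c'"
  proof (cases "c' \<in> charts_at A p")
    case True
    then have "v c' = frechet_derivative (cmap c' \<circ> cinv c) (at (cmap c p)) (v c)"
      using assms unfolding tangent_space_def by blast
    with True show ?thesis by (simp add: coord_tvec_def)
  next
    case False
    then have "v c' = 0" using assms unfolding tangent_space_def by blast
    with False show ?thesis by (simp add: coord_tvec_def)
  qed
qed

lemma coord_tvec_in: "c \<in> charts_at A p \<Longrightarrow> coord_tvec A c p a \<in> tangent_space A p"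
  by (rule coord_tvec_tangent[OF atlas])

lemma coord_tvec_at: "c \<in> charts_at A p \<Longrightarrow> coord_tvec A c p a c = a"
  by (rule coord_tvec_self[OF atlas])

lemma transition_linear:
  assumes "c \<in> charts_at A p" "c' \<in> charts_at A p"
  shows "linear (frechet_derivative (cmap c' \<circ> cinv c) (at (cmap c p)))"
  using transition_has_derivative[OF atlas assms] has_derivative_linear by blast

lemma tcomb_tangent:
  assumes "u \<in> tangent_space A p" "v \<in> tangent_space A p"
  shows "tcomb a u b v \<in> tangent_space A p"
proof -
  obtain c where c: "c \<in> charts_at A p" by (rule chart_exists)
  have "tcomb a u b v = coord_tvec A c p (a *\<^sub>R u c + b *\<^sub>R v c)"
    unfolding coord_tvec_tcomb[OF atlas c] by (simp add: coord_tvec_components assms c)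
  then show ?thesis using coord_tvec_in[OF c] by simp
qed

lemma zero_tangent: "(\<lambda>_. 0) \<in> tangent_space A p"
proof -
  obtain c where c: "c \<in> charts_at A p" by (rule chart_exists)
  have "tcomb 0 (coord_tvec A c p 0) 0 (coord_tvec A c p 0) = (\<lambda>_. 0)" by (simp add: tcomb_def)
  then show ?thesis using tcomb_tangent coord_tvec_in[OF c] by metis
qed

lemma tangent_component_transform:
  assumes "v \<in> tangent_space A p" "c \<in> charts_at A p" "c' \<in> charts_at A p"
  shows "v c' = frechet_derivative (cmap c' \<circ> cinv c) (at (cmap c p)) (v c)"
  using assms unfolding tangent_space_def by blast

text \<open>The metric on component vectors. Whereas \<open>g p\<close> is constrained on tangent vectors only, this form is
  bilinear in arbitrary vectors of \<open>real ^ 'm\<close>, so calculus applies to it.\<close>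

definition gform :: "('a, 'm) chart \<Rightarrow> real ^ 'm \<Rightarrow> real ^ 'm \<Rightarrow> real ^ 'm \<Rightarrow> real" where
  "gform c y a b = a \<bullet> (gram A g c y *v b)"

lemma metric_components:
  assumes "u \<in> tangent_space A p" "v \<in> tangent_space A p" "c \<in> charts_at A p"
  shows "g p u v = gform c (cmap c p) (u c) (v c)"
  unfolding gform_def gram_form[OF RM chart_atD(1,3)[OF assms(3)]] chart_atD(4)[OF assms(3)]
    coord_tvec_components[OF assms(1,3)] coord_tvec_components[OF assms(2,3)] ..

lemma gform_simps:
  "gform c y (a + a') b = gform c y a b + gform c y a' b"
  "gform c y a (b + b') = gform c y a b + gform c y a b'"
  "gform c y (a - a') b = gform c y a b - gform c y a' b"
  "gform c y (r *\<^sub>R a) b = r * gform c y a b" "gform c y a (r *\<^sub>R b) = r * gform c y a b"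
  by (simp_all add: gform_def inner_add_left matrix_vector_right_distrib inner_add_right inner_diff_left
      matrix_vector_mult_scaleR)

lemma gform_commute:
  assumes "c \<in> A" "y \<in> crange c"
  shows "gform c y a b = gform c y b a"
  unfolding gform_def gram_form[OF RM assms] by (rule metric_bilinear(2)[OF RM assms])

lemma metric_commute:
  "u \<in> tangent_space A p \<Longrightarrow> v \<in> tangent_space A p \<Longrightarrow> g p u v = g p v u"
  using RM unfolding riemannian_manifold_def by blast

lemma metric_tcomb:
  assumes "u \<in> tangent_space A p" "v \<in> tangent_space A p" "w \<in> tangent_space A p"
  shows "g p (tcomb a u b v) w = a * g p u w + b * g p v w"
    "g p w (tcomb a u b v) = a * g p w u + b * g p w v"
proof -
  show *: "g p (tcomb a u b v) w = a * g p u w + b * g p v w"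
    using RM assms unfolding riemannian_manifold_def by blast
  show "g p w (tcomb a u b v) = a * g p w u + b * g p w v"
    using * by (simp add: metric_commute[of w] assms tcomb_tangent)
qed

lemma metric_pos: "u \<in> tangent_space A p \<Longrightarrow> u \<noteq> (\<lambda>_. 0) \<Longrightarrow> 0 < g p u u"
  using RM unfolding riemannian_manifold_def by blast

lemma metric_zero: "w \<in> tangent_space A p \<Longrightarrow> g p (\<lambda>_. 0) w = 0"
  using metric_tcomb(1)[of "\<lambda>_. 0" p "\<lambda>_. 0" w 0 0] zero_tangent by (simp add: tcomb_def)

lemma metric_nonneg: "u \<in> tangent_space A p \<Longrightarrow> 0 \<le> g p u u"
  using metric_pos[of u p] metric_zero zero_tangent by fastforce

lemma gform_pos:
  assumes "c \<in> A" "y \<in> crange c" "a \<noteq> 0"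
  shows "0 < gform c y a a"
proof -
  note c = cinv_chart[OF assms(1,2)]
  have "coord_tvec A c (cinv c y) a \<noteq> (\<lambda>_. 0)"
    using coord_tvec_at[OF c(1), of a] assms(3) by auto
  then show ?thesis
    unfolding gform_def gram_form[OF RM assms(1,2)] by (intro metric_pos coord_tvec_in[OF c(1)])
qed

lemma rnorm_nonneg: "v \<in> tangent_space A p \<Longrightarrow> 0 \<le> rnorm g p v"
  by (simp add: rnorm_def metric_nonneg)

lemma rnorm_power2: "v \<in> tangent_space A p \<Longrightarrow> (rnorm g p v)\<^sup>2 = g p v v"
  by (simp add: rnorm_def metric_nonneg)

lemma metric_cauchy_schwarz:
  assumes u: "u \<in> tangent_space A p" and v: "v \<in> tangent_space A p"
  shows "\<bar>g p u v\<bar> \<le> rnorm g p u * rnorm g p v"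
proof (cases "v = (\<lambda>_. 0)")
  case True
  then show ?thesis using metric_zero[OF u] metric_commute[OF u v] rnorm_nonneg u v by simp
next
  case False
  let ?w = "tcomb (g p v v) u (- g p u v) v"
  have vv: "0 < g p v v" using metric_pos[OF v False] .
  have "0 \<le> g p ?w ?w" by (intro metric_nonneg tcomb_tangent u v)
  also have "g p ?w ?w = g p v v * (g p u u * g p v v - (g p u v)\<^sup>2)"
    using metric_commute[OF v u]
    by (simp add: metric_tcomb u v tcomb_tangent power2_eq_square algebra_simps)
  finally have "(g p u v)\<^sup>2 \<le> g p u u * g p v v" using vv by (simp add: zero_le_mult_iff)
  then have "sqrt ((g p u v)\<^sup>2) \<le> sqrt (g p u u * g p v v)" by (rule real_sqrt_le_mono)
  then show ?thesis by (simp add: rnorm_def real_sqrt_mult)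
qed

lemma rnorm_zero_iff: "v \<in> tangent_space A p \<Longrightarrow> rnorm g p v = 0 \<longleftrightarrow> v = (\<lambda>_. 0)"
  using metric_pos[of v p] metric_zero[OF zero_tangent]
  by (cases "v = (\<lambda>_. 0)") (auto simp: rnorm_def)

text \<open>Riesz representation in a single tangent space: in a chart the representing vector solves a linear
  system with the Gram matrix, which is invertible. Gradients and adjoints are instances, and the
  uniqueness is what makes their definite descriptions meaningful.\<close>

lemma riesz_tangent:
  assumes lin: "\<And>a u b v. u \<in> tangent_space A p \<Longrightarrow> v \<in> tangent_space A p \<Longrightarrow>
      \<l> (tcomb a u b v) = a * \<l> u + b * \<l> v"
  shows "\<exists>!w. w \<in> tangent_space A p \<and> (\<forall>u\<in>tangent_space A p. g p w u = \<l> u)"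
proof (rule ex_ex1I)
  obtain c where c: "c \<in> charts_at A p" by (rule chart_exists)
  let ?y = "cmap c p" and ?f = "\<lambda>a. \<l> (coord_tvec A c p a)"
  have comb: "?f (r *\<^sub>R a + t *\<^sub>R b) = r * ?f a + t * ?f b" for r a t b
    unfolding coord_tvec_tcomb[OF atlas c] by (intro lin coord_tvec_in[OF c])
  have "linear ?f"
  proof (rule linearI)
    show "?f (a + b) = ?f a + ?f b" for a b using comb[of 1 a 1 b] by simp
    show "?f (r *\<^sub>R a) = r *\<^sub>R ?f a" for r a using comb[of r a 0 a] by simp
  qed
  define d where "d = adjoint ?f 1"
  have f: "?f a = d \<bullet> a" for a
    using adjoint_works[OF \<open>linear ?f\<close>, of a 1] unfolding d_def by (simp add: inner_commute)
  define W where "W = matrix_inv (gram A g c ?y) *v d"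
  have GW: "gram A g c ?y *v W = d"
    unfolding W_def by (simp add: matrix_vector_mul_assoc gram_invertible[OF RM chart_atD(1,3)[OF c]])
  have "g p (coord_tvec A c p W) u = \<l> u" if u: "u \<in> tangent_space A p" for u
  proof -
    have "g p (coord_tvec A c p W) u = gform c ?y (u c) W"
      using metric_components[OF u coord_tvec_in[OF c] c, of W] metric_commute[OF u coord_tvec_in[OF c]]
      by (simp add: coord_tvec_at[OF c])
    also have "\<dots> = ?f (u c)" unfolding gform_def GW f by (rule inner_commute)
    finally show ?thesis by (simp add: coord_tvec_components[OF u c])
  qed
  then show "\<exists>w. w \<in> tangent_space A p \<and> (\<forall>u\<in>tangent_space A p. g p w u = \<l> u)"
    using coord_tvec_in[OF c] by blast
next
  fix w w'
  assume w: "w \<in> tangent_space A p \<and> (\<forall>u\<in>tangent_space A p. g p w u = \<l> u)"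
    and w': "w' \<in> tangent_space A p \<and> (\<forall>u\<in>tangent_space A p. g p w' u = \<l> u)"
  let ?d = "tcomb 1 w (-1) w'"
  have d: "?d \<in> tangent_space A p" using w w' by (intro tcomb_tangent) auto
  have "g p ?d ?d = 1 * g p w ?d + (-1) * g p w' ?d" using w w' d by (intro metric_tcomb(1)) auto
  also have "\<dots> = 0" using w w' d by simp
  finally have "?d = (\<lambda>_. 0)" using metric_pos[OF d] by force
  then show "w = w'" by (auto simp: tcomb_def fun_eq_iff)
qed

lemma radjoint_works:
  assumes L: "tangent_endomorphism A p L" and v: "v \<in> tangent_space A p"
  shows "radjoint A g p L v \<in> tangent_space A p"
    and "u \<in> tangent_space A p \<Longrightarrow> g p (radjoint A g p L v) u = g p v (L u)"
proof -
  have "\<exists>!w. w \<in> tangent_space A p \<and> (\<forall>u\<in>tangent_space A p. g p w u = g p v (L u))"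
    using L v unfolding tangent_endomorphism_def by (intro riesz_tangent) (auto simp: metric_tcomb)
  from theI'[OF this]
  show "radjoint A g p L v \<in> tangent_space A p"
    "u \<in> tangent_space A p \<Longrightarrow> g p (radjoint A g p L v) u = g p v (L u)"
    unfolding radjoint_def by auto
qed


section \<open>The Levi-Civita connection\<close>

lemma gram_smooth:
  assumes "c \<in> A"
  shows "smooth_on (crange c) (\<lambda>y. gram A g c y $ i $ j)"
  using RM assms unfolding riemannian_manifold_def gram_def vec_lambda_beta by blast

definition dgram :: "('a, 'm) chart \<Rightarrow> real ^ 'm \<Rightarrow> real ^ 'm \<Rightarrow> real ^ 'm ^ 'm" where
  "dgram c y v = (\<chi> i j. frechet_derivative (\<lambda>y. gram A g c y $ i $ j) (at y) v)"

lemma gram_has_derivative: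
  assumes "c \<in> A" "y \<in> crange c"
  shows "(gram A g c has_derivative dgram c y) (at y)"
  by (rule has_derivative_matrix)
    (simp add: dgram_def smooth_on_has_derivative[OF gram_smooth[OF assms(1)] assms(2)])

lemma christoffel_form_commute:
  assumes "c \<in> A" "y \<in> crange c"
  shows "christoffel_form A g c y a b = christoffel_form A g c y b a"
proof -
  have "(\<Sum>i\<in>UNIV. \<Sum>j\<in>UNIV. christoffel A g c y k i j * a $ i * b $ j)
      = (\<Sum>j\<in>UNIV. \<Sum>i\<in>UNIV. christoffel A g c y k j i * b $ j * a $ i)" for k
  proof -
    have "christoffel A g c y k i j * a $ i * b $ j = christoffel A g c y k j i * b $ j * a $ i" for i j
      unfolding christoffel_torsion_free[OF RM assms, of k i j] by simp
    then have "(\<Sum>i\<in>UNIV. \<Sum>j\<in>UNIV. christoffel A g c y k i j * a $ i * b $ j)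
        = (\<Sum>i\<in>UNIV. \<Sum>j\<in>UNIV. christoffel A g c y k j i * b $ j * a $ i)"
      by (intro sum.cong refl)
    also have "\<dots> = (\<Sum>j\<in>UNIV. \<Sum>i\<in>UNIV. christoffel A g c y k j i * b $ j * a $ i)"
      by (rule sum.swap)
    finally show ?thesis .
  qed
  then show ?thesis by (simp add: christoffel_form_def vec_eq_iff)
qed

lemma christoffel_form_linear:
  "linear (\<lambda>a. christoffel_form A g c y a b)" "linear (\<lambda>b. christoffel_form A g c y a b)"
  by (rule linearI; simp add: christoffel_form_def vec_eq_iff sum_distrib_left algebra_simps sum.distrib)+

lemma christoffel_form_axis:
  "christoffel_form A g c y (axis k 1) (axis i 1) $ l = christoffel A g c y l k i"
proof -
  have "christoffel A g c y l a b * axis k 1 $ a * axis i 1 $ b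
      = (if a = k then (if b = i then christoffel A g c y l a b else 0) else 0)" for a b
    by (simp add: axis_def)
  then have "christoffel_form A g c y (axis k 1) (axis i 1) $ l
      = (\<Sum>a\<in>UNIV. \<Sum>b\<in>UNIV. if a = k then (if b = i then christoffel A g c y l a b else 0) else 0)"
    unfolding christoffel_form_def by simp
  also have "\<dots> = (\<Sum>a\<in>UNIV. if a = k then christoffel A g c y l a i else 0)"
    by (intro sum.cong refl) simp
  finally show ?thesis by simp
qed

lemma dgram_linear:
  assumes "c \<in> A" "y \<in> crange c"
  shows "linear (dgram c y)"
  using gram_has_derivative[OF assms] has_derivative_linear by blast

text \<open>Both sides are trilinear, so it suffices to compare them on coordinate axes, where the claim is the
  metric compatibility of the Christoffel symbols.\<close>

lemma christoffel_form_metric: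
  assumes c: "c \<in> A" "y \<in> crange c"
  shows "a \<bullet> (dgram c y v *v b)
    = gform c y (christoffel_form A g c y v a) b + gform c y a (christoffel_form A g c y v b)"
proof -
  let ?\<Gamma> = "christoffel_form A g c y"
  let ?R = "\<lambda>v a b. gform c y (?\<Gamma> v a) b + gform c y a (?\<Gamma> v b)"
  note lin = linear_add[OF christoffel_form_linear(1)] linear_add[OF christoffel_form_linear(2)]
    linear_scale[OF christoffel_form_linear(1)] linear_scale[OF christoffel_form_linear(2)]
    linear_add[OF dgram_linear[OF c]] linear_scale[OF dgram_linear[OF c]]
  have L: "linear (\<lambda>v. a \<bullet> (dgram c y v *v b))" "linear (\<lambda>a. a \<bullet> (dgram c y v *v b))"
    "linear (\<lambda>b. a \<bullet> (dgram c y v *v b))" for a b v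
    by (rule linearI; simp add: lin matrix_vector_mult_add_rdistrib matrix_vector_right_distrib
        inner_add_left inner_add_right matrix_vector_mult_scaleR scaleR_matrix_vector_assoc[symmetric])+
  have R: "linear (\<lambda>v. ?R v a b)" "linear (\<lambda>a. ?R v a b)" "linear (\<lambda>b. ?R v a b)" for a b v
    by (rule linearI; simp add: lin gform_simps algebra_simps)+
  have left: "gform c y u (axis j 1) = (\<Sum>l\<in>UNIV. u $ l * gram A g c y $ l $ j)" for u j
    by (simp add: gform_def matrix_vector_mult_basis column_def inner_vec_def)
  have right: "gform c y (axis i 1) u = (\<Sum>l\<in>UNIV. u $ l * gram A g c y $ i $ l)" for u i
    by (simp add: gform_def inner_axis' matrix_vector_mult_def mult.commute)
  have basis: "axis i 1 \<bullet> (dgram c y (axis k 1) *v axis j 1) = ?R (axis k 1) (axis i 1) (axis j 1)"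
    for i j k
  proof -
    have "axis i 1 \<bullet> (dgram c y (axis k 1) *v axis j 1) = gram_deriv A g c y k i j"
      by (simp add: inner_axis' matrix_vector_mult_basis column_def dgram_def gram_deriv_def)
    also have "\<dots> = ?R (axis k 1) (axis i 1) (axis j 1)"
      unfolding christoffel_metric[OF RM c] left right christoffel_form_axis by (simp add: sum.distrib)
    finally show ?thesis .
  qed
  have "axis i 1 \<bullet> (dgram c y (axis k 1) *v b) = ?R (axis k 1) (axis i 1) b" for i k
    by (rule linear_eq_on_axes[OF L(3) R(3) basis])
  then have "a \<bullet> (dgram c y (axis k 1) *v b) = ?R (axis k 1) a b" for k
    by (rule linear_eq_on_axes[OF L(2) R(2)])
  then show ?thesis by (rule linear_eq_on_axes[OF L(1) R(1)])
qed

text \<open>The Koszul formula: three instances of metric compatibility, combined so that the absence of torsion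
  cancels all but one Christoffel term. It expresses the connection by first derivatives of the metric
  without inverting the Gram matrix.\<close>

lemma christoffel_form_koszul:
  assumes "c \<in> A" "y \<in> crange c"
  shows "2 * gform c y (christoffel_form A g c y v a) w
    = a \<bullet> (dgram c y v *v w) + v \<bullet> (dgram c y a *v w) - v \<bullet> (dgram c y w *v a)"
  unfolding christoffel_form_metric[OF assms]
    christoffel_form_commute[OF assms, of a v] christoffel_form_commute[OF assms, of w v]
    christoffel_form_commute[OF assms, of w a]
    gform_commute[OF assms, of a "christoffel_form A g c y v w"]
  by simp

lemma transition_domain:
  assumes "c \<in> charts_at A p" "c' \<in> charts_at A p"
  shows "open (cmap c ` (cdom c \<inter> cdom c'))" "cmap c p \<in> cmap c ` (cdom c \<inter> cdom c')"
    "smooth_on (cmap c ` (cdom c \<inter> cdom c')) (cmap c' \<circ> cinv c)"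
proof -
  show "open (cmap c ` (cdom c \<inter> cdom c'))"
    using open_Int[OF chart_domain(1)[OF chart_atD(1)[OF assms(1)]] chart_domain(1)[OF chart_atD(1)[OF assms(2)]]]
    by (intro chart_image_open[OF atlas chart_atD(1)[OF assms(1)]]) auto
  show "cmap c p \<in> cmap c ` (cdom c \<inter> cdom c')" using chart_atD(2) assms by blast
  show "smooth_on (cmap c ` (cdom c \<inter> cdom c')) (cmap c' \<circ> cinv c)"
    using atlas chart_atD(1)[OF assms(1)] chart_atD(1)[OF assms(2)] unfolding smooth_atlas_def by blast
qed

lemma transition_point:
  assumes c: "c \<in> A" "c' \<in> A" and z: "z \<in> cmap c ` (cdom c \<inter> cdom c')"
  shows "c \<in> charts_at A (cinv c z)" "c' \<in> charts_at A (cinv c z)" "cmap c (cinv c z) = z"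
    "(cmap c' \<circ> cinv c) z = cmap c' (cinv c z)" "z \<in> crange c"
proof -
  obtain q where q: "q \<in> cdom c" "q \<in> cdom c'" "z = cmap c q" using z by blast
  then have "cinv c z = q" using chart_atD(4) c by (simp add: charts_at_iff)
  then show "c \<in> charts_at A (cinv c z)" "c' \<in> charts_at A (cinv c z)" "cmap c (cinv c z) = z"
    "(cmap c' \<circ> cinv c) z = cmap c' (cinv c z)" "z \<in> crange c"
    using q c by (auto simp: charts_at_iff)
qed

lemma transition_inverse:
  assumes "c \<in> charts_at A p" "c' \<in> charts_at A p"
  shows "frechet_derivative (cmap c' \<circ> cinv c) (at (cmap c p))
      (frechet_derivative (cmap c \<circ> cinv c') (at (cmap c' p)) a) = a"
proof -
  have "coord_tvec A c' p a c' = frechet_derivative (cmap c' \<circ> cinv c) (at (cmap c p)) (coord_tvec A c' p a c)"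
    by (rule tangent_component_transform[OF coord_tvec_in[OF assms(2)] assms])
  then show ?thesis using coord_tvec_at[OF assms(2)] assms by (simp add: coord_tvec_def)
qed

text \<open>A component vector in the chart \<open>c\<close> and its image under the Jacobian are components of the same
  tangent vector.\<close>

lemma gform_transform:
  assumes "c \<in> charts_at A p" "c' \<in> charts_at A p"
  defines "J \<equiv> frechet_derivative (cmap c' \<circ> cinv c) (at (cmap c p))"
  shows "gform c (cmap c p) a b = gform c' (cmap c' p) (J a) (J b)"
proof -
  note t = coord_tvec_in[OF assms(1)]
  have "J a = coord_tvec A c p a c'" for a using assms by (simp add: coord_tvec_def)
  then show ?thesis
    using metric_components[OF t t assms(1), of a b] metric_components[OF t t assms(2), of a b]
    by (simp add: coord_tvec_at[OF assms(1)])
qed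

text \<open>The metric compatibility in two charts shows that the failure \<open>N\<close> of the transformation law
  makes \<open>\<langle>N v a, w\<rangle>\<close> antisymmetric in \<open>a, w\<close>; it is symmetric in \<open>v, a\<close> by the absence of torsion and
  the symmetry of second derivatives. A trilinear form with these two symmetries vanishes.\<close>

lemma christoffel_form_transform:
  assumes c: "c \<in> charts_at A p" and c': "c' \<in> charts_at A p"
  defines "T \<equiv> cmap c' \<circ> cinv c"
  defines "J \<equiv> frechet_derivative T (at (cmap c p))"
  defines "H \<equiv> \<lambda>v a. frechet_derivative (\<lambda>z. frechet_derivative T (at z) a) (at (cmap c p)) v"
  shows "J (christoffel_form A g c (cmap c p) v a) = H v a + christoffel_form A g c' (cmap c' p) (J v) (J a)"
proof -
  let ?y = "cmap c p" and ?y' = "cmap c' p" and ?S = "cmap c ` (cdom c \<inter> cdom c')"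
  let ?\<Gamma> = "christoffel_form A g c ?y" and ?\<Gamma>' = "christoffel_form A g c' ?y'"
  note S = transition_domain[OF c c', folded T_def]
  note cA = chart_atD[OF c] and cA' = chart_atD[OF c']
  have Ty: "T ?y = ?y'" using cA by (simp add: T_def)
  have Hsym: "H v a = H a v" for v a
    unfolding H_def by (rule mixed_derivatives_commute_vec[OF S])
  have T': "(T has_derivative J) (at ?y)"
    unfolding J_def by (rule smooth_on_has_derivative[OF S(3,2)])
  have compat: "a \<bullet> (dgram c ?y v *v b)
      = gform c' ?y' (H v a) (J b) + J a \<bullet> (dgram c' ?y' (J v) *v J b) + gform c' ?y' (J a) (H v b)"
    for v a b
  proof -
    let ?D = "\<lambda>a z. frechet_derivative T (at z) a"
    have D: "(?D a has_derivative (\<lambda>v. H v a)) (at ?y)" for a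
      unfolding H_def by (rule smooth_on_has_derivative[OF smooth_on_frechet_derivative[OF S(3)] S(2)])
    have "((\<lambda>z. gram A g c' (T z)) has_derivative (\<lambda>v. dgram c' ?y' (J v))) (at ?y)"
      using has_derivative_compose[OF T', of "gram A g c'" "dgram c' ?y'"] gram_has_derivative[OF cA'(1,3)]
      by (simp add: Ty)
    from has_derivative_matrix_form[OF this D D]
    have 1: "((\<lambda>z. gform c' (T z) (?D a z) (?D b z)) has_derivative
      (\<lambda>v. gform c' ?y' (H v a) (J b) + J a \<bullet> (dgram c' ?y' (J v) *v J b) + gform c' ?y' (J a) (H v b))) (at ?y)"
      unfolding gform_def J_def Ty by simp
    have 2: "((\<lambda>z. gform c z a b) has_derivative
      (\<lambda>v. gform c' ?y' (H v a) (J b) + J a \<bullet> (dgram c' ?y' (J v) *v J b) + gform c' ?y' (J a) (H v b))) (at ?y)"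
    proof (rule has_derivative_transform_within_open[OF 1 S(1,2)])
      fix z assume "z \<in> ?S"
      note q = transition_point[OF cA(1) cA'(1) this]
      show "gform c' (T z) (?D a z) (?D b z) = gform c z a b"
        using gform_transform[OF q(1,2), of a b] q by (simp add: T_def)
    qed
    have 3: "((\<lambda>z. gform c z a b) has_derivative (\<lambda>v. a \<bullet> (dgram c ?y v *v b))) (at ?y)"
      using has_derivative_matrix_form[OF gram_has_derivative[OF cA(1,3)]
          has_derivative_const[of a] has_derivative_const[of b]]
      by (simp add: gform_def)
    from fun_cong[OF has_derivative_unique[OF 3 2], of v] show ?thesis .
  qed
  define N where "N = (\<lambda>v a. H v a + ?\<Gamma>' (J v) (J a) - J (?\<Gamma> v a))"
  define B where "B = (\<lambda>v a w. gform c' ?y' (N v a) (J w))"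
  note G' = gform_commute[OF cA'(1,3)]
  have Nsym: "N v a = N a v" for v a
    unfolding N_def using Hsym christoffel_form_commute[OF cA(1,3)] christoffel_form_commute[OF cA'(1,3)] by metis
  have anti: "B v a w = - B v w a" for v a w
    using compat[of a v w] unfolding christoffel_form_metric[OF cA(1,3)] christoffel_form_metric[OF cA'(1,3)]
      gform_transform[OF c c', folded T_def, folded J_def] B_def N_def
    by (simp add: gform_simps G'[of "J a"])
  have sym: "B v a w = B a v w" for v a w unfolding B_def by (simp add: Nsym[of v])
  have "B v a w = - B v a w" for v a w
    using anti[of v a w] sym[of v w a] anti[of w v a] sym[of w a v] anti[of a w v] sym[of a v w] by linarith
  then have B0: "gform c' ?y' (N v a) (J w) = 0" for v a w unfolding B_def by (simp add: eq_neg_iff_add_eq_0)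
  have "N v a = 0"
  proof (rule ccontr)
    assume "N v a \<noteq> 0"
    then have "0 < gform c' ?y' (N v a) (N v a)" by (rule gform_pos[OF cA'(1,3)])
    then show False
      using B0[of v a "frechet_derivative (cmap c \<circ> cinv c') (at ?y') (N v a)"]
        transition_inverse[OF c c', folded T_def, folded J_def] by simp
  qed
  then show ?thesis by (simp add: N_def)
qed

text \<open>Differentiating the transformation rule of the components of \<open>X\<close> produces a second derivative of the
  coordinate change; the inhomogeneous term in the transformation of the Christoffel form cancels it.
  Tangency of \<open>\<nabla>\<^sub>v X\<close> is needed because \<open>g p\<close> is the Riemannian metric on tangent vectors only.\<close>

lemma cov_deriv_tangent:
  assumes X: "\<And>q. X q \<in> tangent_space A q"
    and diff: "\<And>c. c \<in> charts_at A p \<Longrightarrow> (\<lambda>y. X (cinv c y) c) differentiable (at (cmap c p))"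
    and v: "v \<in> tangent_space A p"
  shows "cov_deriv A g X p v \<in> tangent_space A p"
proof -
  have "cov_deriv A g X p v c' = frechet_derivative (cmap c' \<circ> cinv c) (at (cmap c p)) (cov_deriv A g X p v c)"
    if c: "c \<in> charts_at A p" and c': "c' \<in> charts_at A p" for c c'
  proof -
    let ?T = "cmap c' \<circ> cinv c" and ?y = "cmap c p" and ?y' = "cmap c' p"
    let ?J = "frechet_derivative ?T (at ?y)"
    let ?S = "cmap c ` (cdom c \<inter> cdom c')"
    let ?D = "\<lambda>a z. frechet_derivative ?T (at z) a"
    let ?H = "\<lambda>v a. frechet_derivative (?D a) (at ?y) v"
    let ?X = "\<lambda>y. X (cinv c y) c" and ?X' = "\<lambda>y. X (cinv c' y) c'"
    note S = transition_domain[OF c c'] and cA = chart_atD[OF c] and cA' = chart_atD[OF c']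
    have T': "(?T has_derivative ?J) (at ?y)" by (rule smooth_on_has_derivative[OF S(3,2)])
    have Ty: "?T ?y = ?y'" using cA by simp
    have X1: "(?X has_derivative frechet_derivative ?X (at ?y)) (at ?y)"
      and X2: "(?X' has_derivative frechet_derivative ?X' (at ?y')) (at ?y')"
      using diff[OF c] diff[OF c'] by (simp_all add: frechet_derivative_works)
    have D: "(?D a has_derivative (\<lambda>v. ?H v a)) (at ?y)" for a
      by (rule smooth_on_has_derivative[OF smooth_on_frechet_derivative[OF S(3)] S(2)])
    have 1: "((\<lambda>z. ?X' (?T z)) has_derivative (\<lambda>v. frechet_derivative ?X' (at ?y') (?J v))) (at ?y)"
      using has_derivative_compose[OF T', of ?X' "frechet_derivative ?X' (at ?y')"] X2 unfolding Ty by simp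
    have 2: "((\<lambda>z. \<Sum>i\<in>UNIV. ?X z $ i *\<^sub>R ?D (axis i 1) z) has_derivative
        (\<lambda>v. \<Sum>i\<in>UNIV. ?X ?y $ i *\<^sub>R ?H v (axis i 1) + frechet_derivative ?X (at ?y) v $ i *\<^sub>R ?D (axis i 1) ?y)) (at ?y)"
      by (intro has_derivative_sum has_derivative_scaleR D bounded_linear.has_derivative[OF bounded_linear_vec_nth] X1)
    have expand: "(\<Sum>i\<in>UNIV. a $ i *\<^sub>R f (axis i 1)) = f a" if "linear f" for a and f :: "real ^ 'm \<Rightarrow> real ^ 'm"
    proof -
      have "f a = f (\<Sum>i\<in>UNIV. a $ i *\<^sub>R axis i 1)"
        using basis_expansion[of a] by (simp add: scalar_mult_eq_scaleR)
      also have "\<dots> = (\<Sum>i\<in>UNIV. a $ i *\<^sub>R f (axis i 1))"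
        by (simp add: linear_sum[OF that] linear_scale[OF that])
      finally show ?thesis ..
    qed
    have Hlin: "linear (\<lambda>a. ?H v a)" for v
    proof -
      have "?H v a = ?H a v" for a by (rule mixed_derivatives_commute_vec[OF S])
      then show ?thesis using has_derivative_linear[OF D[of v]] by presburger
    qed
    have "((\<lambda>z. ?X' (?T z)) has_derivative
        (\<lambda>v. \<Sum>i\<in>UNIV. ?X ?y $ i *\<^sub>R ?H v (axis i 1) + frechet_derivative ?X (at ?y) v $ i *\<^sub>R ?D (axis i 1) ?y)) (at ?y)"
    proof (rule has_derivative_transform_within_open[OF 2 S(1,2)])
      fix z assume "z \<in> ?S"
      note q = transition_point[OF cA(1) cA'(1) this]
      have "cinv c' (cmap c' (cinv c z)) = cinv c z" using chart_atD(4)[OF q(2)] .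
      then have "?X' (?T z) = ?D (?X z) z"
        using tangent_component_transform[OF X q(1,2)] q by simp
      also have "\<dots> = (\<Sum>i\<in>UNIV. ?X z $ i *\<^sub>R ?D (axis i 1) z)"
        using expand[OF transition_linear[OF q(1,2)], of "?X z"] q by simp
      finally show "(\<Sum>i\<in>UNIV. ?X z $ i *\<^sub>R ?D (axis i 1) z) = ?X' (?T z)" ..
    qed
    from fun_cong[OF has_derivative_unique[OF 1 this]]
    have "frechet_derivative ?X' (at ?y') (?J v)
        = (\<Sum>i\<in>UNIV. ?X ?y $ i *\<^sub>R ?H v (axis i 1) + frechet_derivative ?X (at ?y) v $ i *\<^sub>R ?D (axis i 1) ?y)" for v .
    then have DX: "frechet_derivative ?X' (at ?y') (?J v) = ?H v (?X ?y) + ?J (frechet_derivative ?X (at ?y) v)" for v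
      by (simp add: sum.distrib expand[OF Hlin] expand[OF transition_linear[OF c c']])
    have "?X ?y = X p c" by (simp add: cA)
    moreover have "X p c' = ?J (X p c)" by (rule tangent_component_transform[OF X c c'])
    moreover have "v c' = ?J (v c)" by (rule tangent_component_transform[OF v c c'])
    ultimately show ?thesis
      using c c' DX[of "v c"] christoffel_form_transform[OF c c', of "v c" "X p c"]
      by (simp add: cov_deriv_def linear_add[OF transition_linear[OF c c']])
  qed
  moreover have "cov_deriv A g X p v c = 0" if "c \<notin> charts_at A p" for c
    using that by (simp add: cov_deriv_def)
  ultimately show ?thesis unfolding tangent_space_def by blast
qed

end


section \<open>Local bounds\<close>

lemma isCont_tendsto_nhds: "isCont f y \<Longrightarrow> (f \<longlongrightarrow> f y) (nhds y)"
  by (simp add: continuous_at tendsto_at_iff_tendsto_nhds)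

lemma differentiable_tendsto_nhds: "f differentiable (at y) \<Longrightarrow> (f \<longlongrightarrow> f y) (nhds y)"
  by (rule isCont_tendsto_nhds[OF differentiable_imp_continuous_within])

lemma tendsto_nhds_of_smooth:
  assumes "smooth_on S f" "y \<in> S"
  shows "(f \<longlongrightarrow> f y) (nhds y)"
  by (rule differentiable_tendsto_nhds[OF smooth_on_differentiable[OF assms]])

lemma linear_norm_bound:
  fixes f :: "real ^ 'n \<Rightarrow> 'b::real_normed_vector"
  assumes "linear f" "\<And>i. norm (f (axis i 1)) \<le> N i"
  shows "norm (f a) \<le> (\<Sum>i\<in>UNIV. N i) * norm a"
proof -
  have "f a = f (\<Sum>i\<in>UNIV. a $ i *\<^sub>R axis i 1)"
    using basis_expansion[of a] by (simp add: scalar_mult_eq_scaleR)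
  also have "\<dots> = (\<Sum>i\<in>UNIV. a $ i *\<^sub>R f (axis i 1))"
    by (simp add: linear_sum[OF assms(1)] linear_scale[OF assms(1)])
  also have "norm \<dots> \<le> (\<Sum>i\<in>UNIV. N i * norm a)"
  proof (rule sum_norm_le)
    fix i
    have "norm (a $ i *\<^sub>R f (axis i 1)) \<le> norm a * N i"
      using assms(2)[of i] component_le_norm_cart[of a i] by (auto intro!: mult_mono)
    then show "norm (a $ i *\<^sub>R f (axis i 1)) \<le> N i * norm a" by (simp add: mult.commute)
  qed
  finally show ?thesis by (simp add: sum_distrib_right)
qed

context riemannian
begin

lemma gram_tendsto:
  assumes "c \<in> A" "y \<in> crange c"
  shows "((\<lambda>z. gram A g c z $ i $ j) \<longlongrightarrow> gram A g c y $ i $ j) (nhds y)"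
  using tendsto_nhds_of_smooth[OF gram_smooth[OF assms(1)] assms(2)] .

text \<open>All local bounds, and the comparison of lengths with Euclidean lengths in a chart, come from this
  two-sided estimate; it combines coercivity of the Gram matrix with continuity of its entries.\<close>

lemma metric_comparable:
  assumes c: "c \<in> charts_at A p"
  obtains m N where "0 < m" "0 < N"
    "\<forall>\<^sub>F z in nhds (cmap c p). z \<in> crange c \<and> (\<forall>a. m * (norm a)\<^sup>2 \<le> gform c z a a \<and> gform c z a a \<le> N * (norm a)\<^sup>2)"
proof -
  note cA = chart_atD[OF c]
  obtain m where m: "0 < m" "\<forall>\<^sub>F z in nhds (cmap c p). \<forall>a. m * (norm a)\<^sup>2 \<le> a \<bullet> (gram A g c z *v a)"
  proof (rule eventually_coercive[OF gram_tendsto[OF cA(1,3)]])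
    show "v \<noteq> 0 \<Longrightarrow> 0 < v \<bullet> (gram A g c (cmap c p) *v v)" for v
      using gform_pos[OF cA(1,3)] unfolding gform_def .
  qed
  obtain N where N: "0 < N" "\<forall>\<^sub>F z in nhds (cmap c p). \<forall>a b. \<bar>a \<bullet> (gram A g c z *v b)\<bar> \<le> N * (norm a * norm b)"
    by (rule eventually_form_bounded[OF gram_tendsto[OF cA(1,3)]])
  have "\<forall>\<^sub>F z in nhds (cmap c p). z \<in> crange c"
    using chart_domain(2)[OF cA(1)] cA(3) eventually_nhds by blast
  then have "\<forall>\<^sub>F z in nhds (cmap c p). z \<in> crange c \<and> (\<forall>a. m * (norm a)\<^sup>2 \<le> gform c z a a \<and> gform c z a a \<le> N * (norm a)\<^sup>2)"
    using m(2) N(2)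
  proof eventually_elim
    case (elim z)
    have "gform c z a a \<le> N * (norm a)\<^sup>2" for a
      using elim(3)[rule_format, of a a] unfolding gform_def power2_eq_square by linarith
    with elim show ?case by (simp add: gform_def)
  qed
  with m(1) N(1) show thesis by (rule that)
qed

lemma rnorm_components:
  assumes "v \<in> tangent_space A p" "c \<in> charts_at A p"
  shows "rnorm g p v = sqrt (gform c (cmap c p) (v c) (v c))"
  unfolding rnorm_def using metric_components[OF assms(1,1,2)] by simp

text \<open>A closed ball around the point fits into the range of the chart; joint continuity on this ball and
  the torus, both compact, bounds the components for all angles at once.\<close>

lemma chart_family_locally_bounded:
  fixes F :: "real ^ 'k::finite \<Rightarrow> 'a \<Rightarrow> ('a, 'm) tvec"
  assumes c: "c \<in> charts_at A p"
    and F: "smooth_on (UNIV \<times> crange c) (\<lambda>(\<phi>, y). F \<phi> (cinv c y) c)"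
    and per: "\<And>y. y \<in> crange c \<Longrightarrow> torus_periodic (\<lambda>\<phi>. F \<phi> (cinv c y))"
  obtains N where "0 < N" "\<forall>\<^sub>F z in nhds (cmap c p). \<forall>\<phi>. norm (F \<phi> (cinv c z) c) \<le> N"
proof -
  note cA = chart_atD[OF c]
  obtain r where r: "0 < r" "cball (cmap c p) r \<subseteq> crange c"
    using chart_domain(2)[OF cA(1)] cA(3) open_contains_cball by blast
  have per_c: "torus_periodic (\<lambda>\<phi>. F \<phi> (cinv c y) c)" if "y \<in> crange c" for y
    using per[OF that] unfolding torus_periodic_def by metis
  have "\<exists>N>0. \<forall>\<phi>. \<forall>y\<in>cball (cmap c p) r. norm (F \<phi> (cinv c y) c) \<le> N"
    by (rule torus_family_bounded[OF smooth_on_imp_continuous_on[OF F] per_c compact_cball r(2)]) blast+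
  then obtain N where N: "0 < N" "\<And>\<phi> y. y \<in> cball (cmap c p) r \<Longrightarrow> norm (F \<phi> (cinv c y) c) \<le> N"
    by blast
  have "\<forall>\<^sub>F z in nhds (cmap c p). z \<in> ball (cmap c p) r"
    using r(1) by (intro eventually_nhds_in_open) auto
  then have "\<forall>\<^sub>F z in nhds (cmap c p). \<forall>\<phi>. norm (F \<phi> (cinv c z) c) \<le> N"
    by (rule eventually_mono) (auto intro!: N(2))
  with N(1) show thesis by (rule that)
qed

lemma vector_field_locally_bounded:
  fixes f :: "real ^ 'k::finite \<Rightarrow> 'a \<Rightarrow> ('a, 'm) tvec"
  assumes f: "smooth_vector_field_family A f"
  shows "\<exists>W N. open W \<and> p \<in> W \<and> (\<forall>q\<in>W. \<forall>\<phi>. rnorm g q (f \<phi> q) \<le> N)"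
proof -
  obtain c where c: "c \<in> charts_at A p" by (rule chart_exists)
  note cA = chart_atD[OF c]
  have ft: "f \<phi> q \<in> tangent_space A q" for \<phi> q
    using f unfolding smooth_vector_field_family_def by blast
  obtain N where N: "0 < N" "\<forall>\<^sub>F z in nhds (cmap c p). \<forall>\<phi>. norm (f \<phi> (cinv c z) c) \<le> N"
  proof (rule chart_family_locally_bounded[OF c])
    show "smooth_on (UNIV \<times> crange c) (\<lambda>(\<phi>, y). f \<phi> (cinv c y) c)"
      using f cA unfolding smooth_vector_field_family_def by blast
    show "torus_periodic (\<lambda>\<phi>. f \<phi> (cinv c y))" for y
      using f unfolding smooth_vector_field_family_def torus_periodic_def by metis
  qed
  obtain m M where m: "0 < m" "0 < M"
    "\<forall>\<^sub>F z in nhds (cmap c p). z \<in> crange c \<and> (\<forall>a. m * (norm a)\<^sup>2 \<le> gform c z a a \<and> gform c z a a \<le> M * (norm a)\<^sup>2)"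
    by (rule metric_comparable[OF c])
  obtain W where W: "open W" "p \<in> W" "W \<subseteq> cdom c"
    "\<And>q. q \<in> W \<Longrightarrow> (\<forall>\<phi>. norm (f \<phi> (cinv c (cmap c q)) c) \<le> N) \<and> (cmap c q \<in> crange c \<and>
      (\<forall>a. m * (norm a)\<^sup>2 \<le> gform c (cmap c q) a a \<and> gform c (cmap c q) a a \<le> M * (norm a)\<^sup>2))"
    by (rule eventually_nhds_chart[OF c eventually_conj[OF N(2) m(3)]]) blast
  have "rnorm g q (f \<phi> q) \<le> sqrt (M * N\<^sup>2)" if q: "q \<in> W" for q \<phi>
  proof -
    have cq: "c \<in> charts_at A q" using q W(3) cA(1) by (auto simp: charts_at_iff)
    have "gform c (cmap c q) (f \<phi> q c) (f \<phi> q c) \<le> M * (norm (f \<phi> q c))\<^sup>2" using W(4)[OF q] by blast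
    also have "\<dots> \<le> M * N\<^sup>2"
      using W(4)[OF q] m(2) chart_atD(4)[OF cq] by (intro mult_left_mono power_mono) auto
    finally show ?thesis unfolding rnorm_components[OF ft cq] by (rule real_sqrt_le_mono)
  qed
  then show ?thesis using W by blast
qed

text \<open>The images of the coordinate axes are bounded near \<open>p\<close> uniformly in the angle, which bounds the
  Euclidean operator norm in the chart; comparability of the metric with the Euclidean one converts it
  into a bound for \<open>rnorm\<close>.\<close>

lemma tensor_field_locally_bounded:
  fixes P :: "real ^ 'k::finite \<Rightarrow> 'a \<Rightarrow> ('a, 'm) tvec \<Rightarrow> ('a, 'm) tvec"
  assumes P: "smooth_tensor_field_family A P"
  shows "\<exists>W N. open W \<and> p \<in> W \<and> 0 \<le> N \<and>
    (\<forall>q\<in>W. \<forall>\<phi>. \<forall>v\<in>tangent_space A q. rnorm g q (P \<phi> q v) \<le> N * rnorm g q v)"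
proof -
  obtain c where c: "c \<in> charts_at A p" by (rule chart_exists)
  note cA = chart_atD[OF c]
  have Pe: "tangent_endomorphism A q (P \<phi> q)" for \<phi> q
    using P unfolding smooth_tensor_field_family_def by blast
  have "\<forall>i. \<exists>N. 0 < N \<and> (\<forall>\<^sub>F z in nhds (cmap c p). \<forall>\<phi>.
      norm (P \<phi> (cinv c z) (coord_tvec A c (cinv c z) (axis i 1)) c) \<le> N)"
  proof
    fix i
    obtain N where "0 < N" "\<forall>\<^sub>F z in nhds (cmap c p). \<forall>\<phi>.
      norm (P \<phi> (cinv c z) (coord_tvec A c (cinv c z) (axis i 1)) c) \<le> N"
    proof (rule chart_family_locally_bounded[OF c, where F = "\<lambda>\<phi> q. P \<phi> q (coord_tvec A c q (axis i 1))"])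
      show "smooth_on (UNIV \<times> crange c) (\<lambda>(\<phi>, y). P \<phi> (cinv c y) (coord_tvec A c (cinv c y) (axis i 1)) c)"
        using P cA unfolding smooth_tensor_field_family_def by blast
      show "torus_periodic (\<lambda>\<phi>. P \<phi> (cinv c y) (coord_tvec A c (cinv c y) (axis i 1)))"
        if "y \<in> crange c" for y
        using P coord_tvec_in[OF cinv_chart(1)[OF cA(1) that]]
        unfolding smooth_tensor_field_family_def by blast
    qed
    then show "\<exists>N. 0 < N \<and> (\<forall>\<^sub>F z in nhds (cmap c p). \<forall>\<phi>.
      norm (P \<phi> (cinv c z) (coord_tvec A c (cinv c z) (axis i 1)) c) \<le> N)" by blast
  qed
  from choice[OF this] obtain N where N: "\<forall>i. 0 < N i \<and> (\<forall>\<^sub>F z in nhds (cmap c p). \<forall>\<phi>.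
      norm (P \<phi> (cinv c z) (coord_tvec A c (cinv c z) (axis i 1)) c) \<le> N i)" ..
  have N': "\<forall>\<^sub>F z in nhds (cmap c p). \<forall>i. \<forall>\<phi>.
      norm (P \<phi> (cinv c z) (coord_tvec A c (cinv c z) (axis i 1)) c) \<le> N i"
    by (rule eventually_all_finite) (use N in blast)
  define K where "K = (\<Sum>i\<in>UNIV. N i)"
  have K: "0 \<le> K" unfolding K_def using N by (intro sum_nonneg) (simp add: less_imp_le)
  obtain m M where m: "0 < m" "0 < M"
    "\<forall>\<^sub>F z in nhds (cmap c p). z \<in> crange c \<and> (\<forall>a. m * (norm a)\<^sup>2 \<le> gform c z a a \<and> gform c z a a \<le> M * (norm a)\<^sup>2)"
    by (rule metric_comparable[OF c])
  obtain W where W: "open W" "p \<in> W" "W \<subseteq> cdom c"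
    "\<And>q. q \<in> W \<Longrightarrow> (\<forall>i \<phi>. norm (P \<phi> (cinv c (cmap c q)) (coord_tvec A c (cinv c (cmap c q)) (axis i 1)) c) \<le> N i)
     \<and> (cmap c q \<in> crange c \<and>
      (\<forall>a. m * (norm a)\<^sup>2 \<le> gform c (cmap c q) a a \<and> gform c (cmap c q) a a \<le> M * (norm a)\<^sup>2))"
    by (rule eventually_nhds_chart[OF c eventually_conj[OF N' m(3)]]) blast
  have "rnorm g q (P \<phi> q v) \<le> sqrt (M * K\<^sup>2 / m) * rnorm g q v"
    if q: "q \<in> W" and v: "v \<in> tangent_space A q" for q \<phi> v
  proof -
    have cq: "c \<in> charts_at A q" using q W(3) cA(1) by (auto simp: charts_at_iff)
    have Pv: "P \<phi> q v \<in> tangent_space A q" using Pe v unfolding tangent_endomorphism_def by blast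
    let ?f = "\<lambda>a. P \<phi> q (coord_tvec A c q a) c"
    have comb: "?f (r *\<^sub>R a + t *\<^sub>R b) = r *\<^sub>R ?f a + t *\<^sub>R ?f b" for r a t b
      unfolding coord_tvec_tcomb[OF atlas cq]
      using Pe coord_tvec_in[OF cq] unfolding tangent_endomorphism_def by (simp add: tcomb_def)
    have lin: "linear ?f"
    proof (rule linearI)
      show "?f (a + b) = ?f a + ?f b" for a b using comb[of 1 a 1 b] by simp
      show "?f (r *\<^sub>R a) = r *\<^sub>R ?f a" for r a using comb[of r a 0 a] by simp
    qed
    have "norm (?f (axis i 1)) \<le> N i" for i
      using W(4)[OF q] chart_atD(4)[OF cq] by auto
    from linear_norm_bound[OF lin this, of "v c"]
    have 1: "norm (P \<phi> q v c) \<le> K * norm (v c)"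
      unfolding K_def coord_tvec_components[OF v cq] .
    have "gform c (cmap c q) (P \<phi> q v c) (P \<phi> q v c) \<le> M * (norm (P \<phi> q v c))\<^sup>2"
      using W(4)[OF q] by blast
    also have "\<dots> \<le> M * (K * norm (v c))\<^sup>2"
      using 1 m(2) by (intro mult_left_mono power_mono) auto
    also have "\<dots> = M * K\<^sup>2 / m * (m * (norm (v c))\<^sup>2)" using m(1) by (simp add: power_mult_distrib)
    also have "\<dots> \<le> M * K\<^sup>2 / m * gform c (cmap c q) (v c) (v c)"
      using W(4)[OF q] m(1,2) by (intro mult_left_mono) auto
    finally have "sqrt (gform c (cmap c q) (P \<phi> q v c) (P \<phi> q v c))
        \<le> sqrt (M * K\<^sup>2 / m * gform c (cmap c q) (v c) (v c))" by (rule real_sqrt_le_mono)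
    then show ?thesis
      unfolding rnorm_components[OF Pv cq] rnorm_components[OF v cq] by (simp only: real_sqrt_mult)
  qed
  moreover have "0 \<le> sqrt (M * K\<^sup>2 / m)" using m by simp
  ultimately show ?thesis using W by blast
qed

lemma rnorm_scale:
  assumes "v \<in> tangent_space A p"
  shows "rnorm g p (tcomb r v 0 v) = \<bar>r\<bar> * rnorm g p v"
  unfolding rnorm_def
  by (simp add: metric_tcomb assms tcomb_tangent real_sqrt_mult power2_eq_square[symmetric] flip: mult.assoc)

lemma normalize_tangent:
  assumes "v \<in> tangent_space A p" "v \<noteq> (\<lambda>_. 0)"
  shows "tcomb (1 / rnorm g p v) v 0 v \<in> tangent_space A p"
    "rnorm g p (tcomb (1 / rnorm g p v) v 0 v) = 1" "0 < rnorm g p v"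
proof -
  show "0 < rnorm g p v"
    using rnorm_zero_iff[OF assms(1)] rnorm_nonneg[OF assms(1)] assms(2) by simp
  then show "rnorm g p (tcomb (1 / rnorm g p v) v 0 v) = 1"
    by (simp add: rnorm_scale[OF assms(1)])
  show "tcomb (1 / rnorm g p v) v 0 v \<in> tangent_space A p"
    by (intro tcomb_tangent assms(1))
qed

lemma unit_tangent_exists: obtains \<xi> where "\<xi> \<in> tangent_space A p" "rnorm g p \<xi> = 1"
proof -
  obtain c where c: "c \<in> charts_at A p" by (rule chart_exists)
  \<comment> \<open>Any nonzero component vector serves here; \<open>undefined\<close> is just some index.\<close>
  have "coord_tvec A c p (axis undefined 1) c = axis undefined 1" by (rule coord_tvec_at[OF c])
  then have "coord_tvec A c p (axis undefined 1) \<noteq> (\<lambda>_. 0)" by (metis axis_eq_0_iff zero_neq_one)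
  from normalize_tangent[OF coord_tvec_in[OF c] this] show thesis using that by blast
qed

lemma force_max_works:
  fixes f :: "real ^ 'k::finite \<Rightarrow> 'a \<Rightarrow> ('a, 'm) tvec"
  assumes f: "smooth_vector_field_family A f"
  shows "rnorm g p (f \<phi> p) \<le> force_max g f p" "0 \<le> force_max g f p"
    "(\<And>\<phi>. rnorm g p (f \<phi> p) \<le> N) \<Longrightarrow> force_max g f p \<le> N"
proof -
  have "bdd_above (range (\<lambda>\<phi>. rnorm g p (f \<phi> p)))"
    using vector_field_locally_bounded[OF f, of p] by (meson bdd_aboveI2)
  then show 1: "rnorm g p (f \<phi> p) \<le> force_max g f p" for \<phi>
    unfolding force_max_def by (rule cSUP_upper[OF UNIV_I])
  have "0 \<le> rnorm g p (f 0 p)"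
    using f unfolding smooth_vector_field_family_def by (blast intro: rnorm_nonneg)
  with 1[of 0] show "0 \<le> force_max g f p" by linarith
  show "(\<And>\<phi>. rnorm g p (f \<phi> p) \<le> N) \<Longrightarrow> force_max g f p \<le> N"
    unfolding force_max_def by (rule cSUP_least) auto
qed

text \<open>A single angle at which the force does not vanish at \<open>p\<close> bounds the maximum over all angles from
  below near \<open>p\<close>.\<close>

lemma force_max_locally_positive:
  fixes f :: "real ^ 'k::finite \<Rightarrow> 'a \<Rightarrow> ('a, 'm) tvec"
  assumes f: "smooth_vector_field_family A f" and pos: "0 < force_max g f p"
  shows "\<exists>W b. open W \<and> p \<in> W \<and> 0 < b \<and> (\<forall>q\<in>W. b \<le> force_max g f q)"
proof -
  obtain c where c: "c \<in> charts_at A p" by (rule chart_exists)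
  note cA = chart_atD[OF c]
  have ft: "f \<phi> q \<in> tangent_space A q" for \<phi> q
    using f unfolding smooth_vector_field_family_def by blast
  obtain \<phi> where \<phi>: "0 < rnorm g p (f \<phi> p)"
    using force_max_works(3)[OF f, of p 0] pos by (meson not_le)
  let ?F = "\<lambda>y. f \<phi> (cinv c y) c" and ?y = "cmap c p"
  have "continuous_on (crange c) ((\<lambda>(\<phi>, y). f \<phi> (cinv c y) c) \<circ> (\<lambda>y. (\<phi>, y)))"
  proof (rule continuous_on_compose)
    show "continuous_on (crange c) (\<lambda>y. (\<phi>, y))" by (intro continuous_intros)
    have "continuous_on (UNIV \<times> crange c) (\<lambda>(\<phi>, y). f \<phi> (cinv c y) c)"
      using f cA(1) smooth_on_imp_continuous_on unfolding smooth_vector_field_family_def by blast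
    then show "continuous_on ((\<lambda>y. (\<phi>, y)) ` crange c) (\<lambda>(\<phi>, y). f \<phi> (cinv c y) c)"
      by (rule continuous_on_subset) auto
  qed
  then have "continuous_on (crange c) ?F" by (simp add: o_def)
  then have "isCont ?F ?y"
    using continuous_on_eq_continuous_at[OF chart_domain(2)[OF cA(1)]] cA(3) by blast
  then have F: "(?F \<longlongrightarrow> ?F ?y) (nhds ?y)" by (rule isCont_tendsto_nhds)
  have G: "(gram A g c \<longlongrightarrow> gram A g c ?y) (nhds ?y)"
    by (intro vec_tendstoI gram_tendsto[OF cA(1,3)])
  let ?h = "\<lambda>z. gform c z (?F z) (?F z)"
  have "(?h \<longlongrightarrow> ?h ?y) (nhds ?y)"
    unfolding gform_def
    by (intro tendsto_inner F bounded_bilinear.tendsto[OF bounded_bilinear_matrix_vector] G)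
  moreover have hy: "0 < ?h ?y" using \<phi> unfolding rnorm_components[OF ft c] cA(4) by simp
  ultimately have "\<forall>\<^sub>F z in nhds ?y. ?h ?y / 2 < ?h z" by (intro order_tendstoD) auto
  then obtain W where W: "open W" "p \<in> W" "W \<subseteq> cdom c" "\<And>q. q \<in> W \<Longrightarrow> ?h ?y / 2 < ?h (cmap c q)"
    by (rule eventually_nhds_chart[OF c]) blast
  have "sqrt (?h ?y / 2) \<le> force_max g f q" if q: "q \<in> W" for q
  proof -
    have cq: "c \<in> charts_at A q" using q W(3) cA(1) by (auto simp: charts_at_iff)
    have "sqrt (?h ?y / 2) \<le> sqrt (?h (cmap c q))" using W(4)[OF q] by (intro real_sqrt_le_mono) simp
    also have "\<dots> = rnorm g q (f \<phi> q)" unfolding rnorm_components[OF ft cq] chart_atD(4)[OF cq] ..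
    also have "\<dots> \<le> force_max g f q" by (rule force_max_works(1)[OF f])
    finally show ?thesis .
  qed
  moreover have "0 < sqrt (?h ?y / 2)" using hy by simp
  ultimately show ?thesis using W by blast
qed

text \<open>The operator bound \<open>N\<close> makes the supremum over unit vectors finite; arbitrary vectors are reduced to
  unit vectors by homogeneity.\<close>

lemma form_max_works:
  assumes P: "\<And>\<phi>. tangent_endomorphism A p (P \<phi> p)"
    and N: "\<And>\<phi> v. v \<in> tangent_space A p \<Longrightarrow> rnorm g p (P \<phi> p v) \<le> N * rnorm g p v"
  shows "form_max A g P p \<le> N" "0 \<le> form_max A g P p"
    "v \<in> tangent_space A p \<Longrightarrow> \<bar>g p (P \<phi> p v) v\<bar> \<le> form_max A g P p * g p v v"
proof -
  have Pt: "v \<in> tangent_space A p \<Longrightarrow> P \<phi> p v \<in> tangent_space A p" for v \<phi>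
    using P unfolding tangent_endomorphism_def by blast
  let ?S = "{\<bar>g p (P \<phi> p \<xi>) \<xi>\<bar> |\<phi> \<xi>. \<xi> \<in> tangent_space A p \<and> rnorm g p \<xi> = 1}"
  obtain \<xi> where \<xi>: "\<xi> \<in> tangent_space A p" "rnorm g p \<xi> = 1" by (rule unit_tangent_exists)
  have le: "s \<le> N" if s: "s \<in> ?S" for s
  proof -
    obtain \<phi> \<xi> where *: "\<xi> \<in> tangent_space A p" "rnorm g p \<xi> = 1" "s = \<bar>g p (P \<phi> p \<xi>) \<xi>\<bar>"
      using s by blast
    then show ?thesis
      using metric_cauchy_schwarz[OF Pt[OF *(1), of \<phi>] *(1)] N[OF *(1), of \<phi>] by simp
  qed
  then have bdd: "bdd_above ?S" by (meson bdd_aboveI)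
  have upper: "\<bar>g p (P \<phi> p \<xi>) \<xi>\<bar> \<le> form_max A g P p" if "\<xi> \<in> tangent_space A p" "rnorm g p \<xi> = 1" for \<phi> \<xi>
    unfolding form_max_def by (rule cSup_upper[OF _ bdd]) (use that in blast)
  show "form_max A g P p \<le> N"
    unfolding form_max_def by (rule cSup_least[OF _ le]) (use \<xi> in blast)
  show "0 \<le> form_max A g P p" using upper[OF \<xi>, of undefined] by linarith
  assume v: "v \<in> tangent_space A p"
  show "\<bar>g p (P \<phi> p v) v\<bar> \<le> form_max A g P p * g p v v"
  proof (cases "v = (\<lambda>_. 0)")
    case True
    then have "g p (P \<phi> p v) v = 0"
      using metric_zero[OF Pt[OF v]] metric_commute[OF v Pt[OF v]] by simp
    then show ?thesis using True metric_zero[OF zero_tangent] by simp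
  next
    case False
    note n = normalize_tangent[OF v False]
    let ?r = "rnorm g p v" and ?e = "tcomb (1 / rnorm g p v) v 0 v"
    have "P \<phi> p ?e = tcomb (1 / ?r) (P \<phi> p v) 0 (P \<phi> p v)"
      using P v unfolding tangent_endomorphism_def by blast
    then have "g p (P \<phi> p ?e) ?e = g p (P \<phi> p v) v / ?r\<^sup>2"
      by (simp add: metric_tcomb v Pt tcomb_tangent power2_eq_square)
    then have "\<bar>g p (P \<phi> p v) v\<bar> / ?r\<^sup>2 \<le> form_max A g P p"
      using upper[OF n(1,2), of \<phi>] by simp
    then show ?thesis using metric_pos[OF v False] by (simp add: pos_divide_le_eq rnorm_power2[OF v])
  qed
qed

text \<open>The defining relation of the adjoint, tested with the vector \<open>radjoint A g p L v\<close> itself.\<close>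

lemma radjoint_bound:
  assumes L: "tangent_endomorphism A p L" and v: "v \<in> tangent_space A p"
    and N: "\<And>u. u \<in> tangent_space A p \<Longrightarrow> rnorm g p (L u) \<le> N * rnorm g p u"
  shows "rnorm g p (radjoint A g p L v) \<le> N * rnorm g p v"
proof -
  let ?w = "radjoint A g p L v"
  note w = radjoint_works[OF L v]
  have Lw: "L ?w \<in> tangent_space A p" using L w(1) unfolding tangent_endomorphism_def by blast
  have "rnorm g p ?w * rnorm g p ?w = g p v (L ?w)"
    using w(2)[OF w(1)] rnorm_power2[OF w(1)] by (simp add: power2_eq_square)
  also have "\<dots> \<le> rnorm g p v * rnorm g p (L ?w)"
    using metric_cauchy_schwarz[OF v Lw] by linarith
  also have "\<dots> \<le> rnorm g p v * (N * rnorm g p ?w)"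
    using N[OF w(1)] rnorm_nonneg[OF v] by (rule mult_left_mono)
  finally have *: "rnorm g p ?w * rnorm g p ?w \<le> (N * rnorm g p v) * rnorm g p ?w" by (simp add: mult_ac)
  show ?thesis
  proof (cases "rnorm g p ?w = 0")
    case True
    have "0 \<le> N * rnorm g p v" using N[OF v] L v unfolding tangent_endomorphism_def
      by (meson order_trans rnorm_nonneg)
    with True show ?thesis by simp
  next
    case False
    with rnorm_nonneg[OF w(1)] have "0 < rnorm g p ?w" by simp
    with * show ?thesis by simp
  qed
qed

end


section \<open>Gradient and Hessian\<close>

locale riemannian_function = riemannian A g
  for A :: "('a::{t2_space,second_countable_topology}, 'm::finite) chart set" and g :: "('a, 'm) rmetric" +
  fixes U :: "'a \<Rightarrow> real"
  assumes U: "smooth_function A U"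
begin

lemma U_chart: "c \<in> A \<Longrightarrow> smooth_on (crange c) (U \<circ> cinv c)"
  using U unfolding smooth_function_def by blast

abbreviation dU :: "('a, 'm) chart \<Rightarrow> real ^ 'm \<Rightarrow> real ^ 'm \<Rightarrow> real" where
  "dU c y \<equiv> frechet_derivative (U \<circ> cinv c) (at y)"

lemma U_has_derivative: "c \<in> A \<Longrightarrow> y \<in> crange c \<Longrightarrow> ((U \<circ> cinv c) has_derivative dU c y) (at y)"
  by (rule smooth_on_has_derivative[OF U_chart])

text \<open>The chain rule: the differential of \<open>U\<close> does not depend on the chart.\<close>

lemma dU_transform:
  assumes u: "u \<in> tangent_space A p" and c: "c \<in> charts_at A p" and c': "c' \<in> charts_at A p"
  shows "dU c' (cmap c' p) (u c') = dU c (cmap c p) (u c)"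
proof -
  let ?T = "cmap c' \<circ> cinv c" and ?y = "cmap c p" and ?y' = "cmap c' p"
  note S = transition_domain[OF c c'] and cA = chart_atD[OF c] and cA' = chart_atD[OF c']
  have Ty: "?T ?y = ?y'" using cA by simp
  have "((\<lambda>z. (U \<circ> cinv c') (?T z)) has_derivative (\<lambda>v. dU c' ?y' (frechet_derivative ?T (at ?y) v))) (at ?y)"
    using has_derivative_compose[OF smooth_on_has_derivative[OF S(3,2)], of "U \<circ> cinv c'" "dU c' ?y'"]
      U_has_derivative[OF cA'(1,3)] unfolding Ty by blast
  then have "((U \<circ> cinv c) has_derivative (\<lambda>v. dU c' ?y' (frechet_derivative ?T (at ?y) v))) (at ?y)"
  proof (rule has_derivative_transform_within_open[OF _ S(1,2)])
    fix z assume "z \<in> cmap c ` (cdom c \<inter> cdom c')"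
    note q = transition_point[OF cA(1) cA'(1) this]
    show "(U \<circ> cinv c') (?T z) = (U \<circ> cinv c) z" using chart_atD(4)[OF q(2)] by simp
  qed
  from fun_cong[OF has_derivative_unique[OF U_has_derivative[OF cA(1,3)] this], of "u c"]
  show ?thesis using tangent_component_transform[OF u c c'] by simp
qed

lemma gradient_works:
  shows "gradient A g U p \<in> tangent_space A p"
    and "u \<in> tangent_space A p \<Longrightarrow> c \<in> charts_at A p \<Longrightarrow> g p (gradient A g U p) u = dU c (cmap c p) (u c)"
proof -
  obtain c0 where c0: "c0 \<in> charts_at A p" by (rule chart_exists)
  let ?l = "\<lambda>u. dU c0 (cmap c0 p) (u c0)"
  have lin: "linear (dU c0 (cmap c0 p))"
    using U_has_derivative[OF chart_atD(1,3)[OF c0]] has_derivative_linear by blast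
  have "\<exists>!w. w \<in> tangent_space A p \<and> (\<forall>u\<in>tangent_space A p. g p w u = ?l u)"
    by (rule riesz_tangent) (simp add: tcomb_def linear_add[OF lin] linear_scale[OF lin])
  moreover have "(\<forall>u\<in>tangent_space A p. g p w u = ?l u) \<longleftrightarrow>
      (\<forall>u\<in>tangent_space A p. \<forall>c\<in>charts_at A p. g p w u = dU c (cmap c p) (u c))" for w
    using dU_transform[OF _ c0] c0 by force
  ultimately have "\<exists>!w. w \<in> tangent_space A p \<and>
      (\<forall>u\<in>tangent_space A p. \<forall>c\<in>charts_at A p. g p w u = dU c (cmap c p) (u c))" by simp
  from theI'[OF this]
  show "gradient A g U p \<in> tangent_space A p"
    "u \<in> tangent_space A p \<Longrightarrow> c \<in> charts_at A p \<Longrightarrow> g p (gradient A g U p) u = dU c (cmap c p) (u c)"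
    unfolding gradient_def by auto
qed

lemma U_continuous: "continuous_on UNIV U"
proof -
  have "isCont U p" for p
  proof -
    obtain c where c: "c \<in> charts_at A p" by (rule chart_exists)
    note cA = chart_atD[OF c]
    have "continuous_on (cdom c) ((U \<circ> cinv c) \<circ> cmap c)"
      by (intro continuous_on_compose chart_domain(3)[OF cA(1)] smooth_on_imp_continuous_on[OF U_chart[OF cA(1)]])
    moreover have "((U \<circ> cinv c) \<circ> cmap c) q = U q" if "q \<in> cdom c" for q
      using chart_atD(4)[of c q] that cA(1) by (simp add: charts_at_iff)
    ultimately have "continuous_on (cdom c) U" using continuous_on_cong by metis
    then show ?thesis
      using chart_domain(1)[OF cA(1)] cA(2) continuous_on_eq_continuous_at by blast
  qed
  then show ?thesis by (simp add: continuous_at_imp_continuous_on)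
qed

abbreviation grad_comp :: "('a, 'm) chart \<Rightarrow> real ^ 'm \<Rightarrow> real ^ 'm" where
  "grad_comp c y \<equiv> gradient A g U (cinv c y) c"

lemma grad_comp_gform:
  assumes "c \<in> A" "y \<in> crange c"
  shows "gform c y (grad_comp c y) w = dU c y w"
proof -
  note c = cinv_chart[OF assms]
  note t = coord_tvec_in[OF c(1)]
  show ?thesis
    using metric_components[OF gradient_works(1) t c(1), of w] gradient_works(2)[OF t c(1), of w]
    by (simp add: c coord_tvec_at[OF c(1)])
qed

lemma grad_comp_differentiable:
  assumes c: "c \<in> A" "y \<in> crange c"
  shows "grad_comp c differentiable (at y)"
proof (rule linear_system_solution_differentiable[OF chart_domain(2)[OF c(1)] c(2)])
  show "(\<lambda>z. gram A g c z $ i $ j) differentiable (at y)" for i j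
    by (rule smooth_on_differentiable[OF gram_smooth[OF c(1)] c(2)])
  show "det (gram A g c z) \<noteq> 0" if "z \<in> crange c" for z
    using gram_invertible[OF RM c(1) that] invertible_det_nz invertible_right_inverse by blast
  show "(\<lambda>z. (\<chi> i. dU c z (axis i 1)) $ i) differentiable (at y)" for i
    using smooth_on_differentiable[OF smooth_on_frechet_derivative[OF U_chart[OF c(1)]] c(2)] by simp
  show "gram A g c z *v grad_comp c z = (\<chi> i. dU c z (axis i 1))" if z: "z \<in> crange c" for z
  proof -
    have "(gram A g c z *v grad_comp c z) $ i = dU c z (axis i 1)" for i
      using grad_comp_gform[OF c(1) z, of "axis i 1"] gform_commute[OF c(1) z]
      by (simp add: gform_def inner_axis')
    then show ?thesis by (simp add: vec_eq_iff)
  qed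
qed

text \<open>The Hessian in coordinates, with the Christoffel symbols eliminated in favour of first
  derivatives of the metric; in this form its continuity is visible.\<close>

definition hess_form :: "('a, 'm) chart \<Rightarrow> real ^ 'm \<Rightarrow> real ^ 'm \<Rightarrow> real ^ 'm \<Rightarrow> real" where
  "hess_form c y v w = frechet_derivative (\<lambda>z. dU c z w) (at y) v
     - (w \<bullet> (dgram c y v *v grad_comp c y) + v \<bullet> (dgram c y w *v grad_comp c y)
        - v \<bullet> (dgram c y (grad_comp c y) *v w)) / 2"

lemma gradient_cov_deriv_tangent:
  "\<xi> \<in> tangent_space A p \<Longrightarrow> cov_deriv A g (gradient A g U) p \<xi> \<in> tangent_space A p"
  by (intro cov_deriv_tangent gradient_works(1) grad_comp_differentiable chart_atD) auto

text \<open>For a constant \<open>w\<close> in a chart, differentiating \<open>gform c z (grad_comp c z) w = dU c z w\<close> replaces the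
  derivative of the gradient by second derivatives of \<open>U\<close> and first derivatives of the metric.\<close>

lemma hess_components:
  assumes \<xi>: "\<xi> \<in> tangent_space A p" and \<eta>: "\<eta> \<in> tangent_space A p" and c: "c \<in> charts_at A p"
  shows "g p (cov_deriv A g (gradient A g U) p \<xi>) \<eta> = hess_form c (cmap c p) (\<xi> c) (\<eta> c)"
proof -
  note cA = chart_atD[OF c]
  let ?y = "cmap c p" and ?W = "grad_comp c" and ?v = "\<xi> c" and ?w = "\<eta> c"
  let ?\<Gamma> = "christoffel_form A g c ?y"
  let ?DW = "frechet_derivative ?W (at ?y)"
  have DW: "(?W has_derivative ?DW) (at ?y)"
    using grad_comp_differentiable[OF cA(1,3)] by (simp add: frechet_derivative_works)
  have "((\<lambda>z. gform c z (?W z) ?w) has_derivative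
     (\<lambda>v. ?DW v \<bullet> (gram A g c ?y *v ?w) + ?W ?y \<bullet> (dgram c ?y v *v ?w))) (at ?y)"
    using has_derivative_matrix_form[OF gram_has_derivative[OF cA(1,3)] DW has_derivative_const[of ?w]]
    by (simp add: gform_def)
  then have 1: "((\<lambda>z. dU c z ?w) has_derivative
     (\<lambda>v. ?DW v \<bullet> (gram A g c ?y *v ?w) + ?W ?y \<bullet> (dgram c ?y v *v ?w))) (at ?y)"
    by (rule has_derivative_transform_within_open[OF _ chart_domain(2)[OF cA(1)] cA(3)])
      (rule grad_comp_gform[OF cA(1)])
  have 2: "((\<lambda>z. dU c z ?w) has_derivative frechet_derivative (\<lambda>z. dU c z ?w) (at ?y)) (at ?y)"
    by (rule smooth_on_has_derivative[OF smooth_on_frechet_derivative[OF U_chart[OF cA(1)]] cA(3)])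
  from fun_cong[OF has_derivative_unique[OF 2 1], of ?v]
  have D2: "frechet_derivative (\<lambda>z. dU c z ?w) (at ?y) ?v
      = gform c ?y (?DW ?v) ?w + ?W ?y \<bullet> (dgram c ?y ?v *v ?w)" by (simp add: gform_def)
  have "cov_deriv A g (gradient A g U) p \<xi> c = ?DW ?v + ?\<Gamma> ?v (?W ?y)"
    using c cA(4) by (simp add: cov_deriv_def)
  then have "g p (cov_deriv A g (gradient A g U) p \<xi>) \<eta> = gform c ?y (?DW ?v) ?w + gform c ?y (?\<Gamma> ?v (?W ?y)) ?w"
    using metric_components[OF gradient_cov_deriv_tangent[OF \<xi>] \<eta> c] by (simp add: gform_simps)
  moreover have "gform c ?y (?W ?y) (?\<Gamma> ?v ?w) = gform c ?y (?\<Gamma> ?v ?w) (?W ?y)"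
    by (rule gform_commute[OF cA(1,3)])
  ultimately show ?thesis
    using D2 christoffel_form_koszul[OF cA(1,3), of ?v ?w "?W ?y"]
      christoffel_form_metric[OF cA(1,3), of "?W ?y" ?v ?w]
    by (simp add: hess_form_def)
qed

lemma hess_form_linear:
  assumes c: "c \<in> A" "y \<in> crange c"
  shows "linear (\<lambda>v. hess_form c y v w)" "linear (\<lambda>w. hess_form c y v w)"
proof -
  note smooth = smooth_on_frechet_derivative[OF U_chart[OF c(1)]]
  have lin: "linear (frechet_derivative (\<lambda>z. dU c z w) (at y))" for w
    using smooth_on_has_derivative[OF smooth c(2)] has_derivative_linear by blast
  have sym: "frechet_derivative (\<lambda>z. dU c z w) (at y) v = frechet_derivative (\<lambda>z. dU c z v) (at y) w" for v w
    by (rule mixed_derivatives_commute[OF chart_domain(2)[OF c(1)] c(2) U_chart[OF c(1)]])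
  note l = linear_add[OF lin] linear_scale[OF lin] linear_add[OF dgram_linear[OF c]]
    linear_scale[OF dgram_linear[OF c]] matrix_vector_mult_add_rdistrib matrix_vector_right_distrib
    inner_add_left inner_add_right matrix_vector_mult_scaleR scaleR_matrix_vector_assoc[symmetric]
  show "linear (\<lambda>v. hess_form c y v w)"
    by (rule linearI) (simp_all add: hess_form_def l algebra_simps add_divide_distrib diff_divide_distrib)
  show "linear (\<lambda>w. hess_form c y v w)"
    unfolding hess_form_def sym[of _ v]
    by (rule linearI) (simp_all add: l algebra_simps add_divide_distrib diff_divide_distrib)
qed

lemma hess_form_matrix:
  assumes "c \<in> A" "y \<in> crange c"
  shows "hess_form c y v w = v \<bullet> ((\<chi> i j. hess_form c y (axis i 1) (axis j 1)) *v w)"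
  by (rule bilinear_matrix_form[OF hess_form_linear[OF assms]])

text \<open>Only the term in which the metric is differentiated in the direction of the gradient requires care:
  there the direction moves with the point, so it is expanded along the axes.\<close>

lemma hess_form_tendsto:
  assumes c: "c \<in> A" "y \<in> crange c"
  shows "((\<lambda>z. hess_form c z v w) \<longlongrightarrow> hess_form c y v w) (nhds y)"
proof -
  have d: "((\<lambda>z. dgram c z v) \<longlongrightarrow> dgram c y v) (nhds y)" for v
    unfolding dgram_def
    using tendsto_nhds_of_smooth[OF smooth_on_frechet_derivative[OF gram_smooth[OF c(1)]] c(2)]
    by (intro vec_tendstoI) simp
  have W: "(grad_comp c \<longlongrightarrow> grad_comp c y) (nhds y)"
    by (rule differentiable_tendsto_nhds[OF grad_comp_differentiable[OF c]])
  have expand: "v \<bullet> (dgram c z (grad_comp c z) *v w)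
      = (\<Sum>k\<in>UNIV. grad_comp c z $ k * (v \<bullet> (dgram c z (axis k 1) *v w)))" if "z \<in> crange c" for z
  proof -
    have lin: "linear (\<lambda>u. v \<bullet> (dgram c z u *v w))"
      by (rule linearI; simp add: linear_add[OF dgram_linear[OF c(1) that]]
          linear_scale[OF dgram_linear[OF c(1) that]] matrix_vector_mult_add_rdistrib inner_add_right
          scaleR_matrix_vector_assoc[symmetric])
    have "v \<bullet> (dgram c z (\<Sum>k\<in>UNIV. grad_comp c z $ k *\<^sub>R axis k 1) *v w)
        = (\<Sum>k\<in>UNIV. grad_comp c z $ k * (v \<bullet> (dgram c z (axis k 1) *v w)))"
      using linear_sum[OF lin, of "\<lambda>k. grad_comp c z $ k *\<^sub>R axis k 1" UNIV] linear_scale[OF lin] by simp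
    then show ?thesis using basis_expansion[of "grad_comp c z"] by (simp add: scalar_mult_eq_scaleR)
  qed
  note mv = bounded_bilinear.tendsto[OF bounded_bilinear_matrix_vector]
  have "((\<lambda>z. \<Sum>k\<in>UNIV. grad_comp c z $ k * (v \<bullet> (dgram c z (axis k 1) *v w))) \<longlongrightarrow>
      (\<Sum>k\<in>UNIV. grad_comp c y $ k * (v \<bullet> (dgram c y (axis k 1) *v w)))) (nhds y)"
    by (intro tendsto_intros tendsto_vec_nth W mv d)
  moreover have "\<forall>\<^sub>F z in nhds y. z \<in> crange c"
    using chart_domain(2)[OF c(1)] c(2) eventually_nhds_in_open by blast
  then have "\<forall>\<^sub>F z in nhds y. (\<Sum>k\<in>UNIV. grad_comp c z $ k * (v \<bullet> (dgram c z (axis k 1) *v w)))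
      = v \<bullet> (dgram c z (grad_comp c z) *v w)"
    by (rule eventually_mono) (simp add: expand)
  ultimately have T1: "((\<lambda>z. v \<bullet> (dgram c z (grad_comp c z) *v w)) \<longlongrightarrow> v \<bullet> (dgram c y (grad_comp c y) *v w)) (nhds y)"
    using tendsto_cong expand[OF c(2)] by force
  have T2: "((\<lambda>z. frechet_derivative (\<lambda>z. dU c z w) (at z) v) \<longlongrightarrow> frechet_derivative (\<lambda>z. dU c z w) (at y) v) (nhds y)"
    by (rule tendsto_nhds_of_smooth[OF smooth_on_frechet_derivative[OF smooth_on_frechet_derivative[OF U_chart[OF c(1)]]] c(2)])
  have T3: "((\<lambda>z. w \<bullet> (dgram c z v *v grad_comp c z)) \<longlongrightarrow> w \<bullet> (dgram c y v *v grad_comp c y)) (nhds y)" for v w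
    by (intro tendsto_inner tendsto_const mv d W)
  show ?thesis
    unfolding hess_form_def
    by (rule tendsto_diff[OF T2 tendsto_divide[OF tendsto_diff[OF tendsto_add[OF T3 T3] T1] tendsto_const]]) simp
qed

text \<open>The entries of the Hessian matrix and the coercivity of the metric bound the infimum from below, so
  that it is a genuine greatest lower bound; homogeneity passes from unit vectors to all vectors.\<close>

lemma hess_min_works:
  shows "\<xi> \<in> tangent_space A p \<Longrightarrow>
      hess_min A g U p * g p \<xi> \<xi> \<le> g p (cov_deriv A g (gradient A g U) p \<xi>) \<xi>"
    and "(\<And>\<xi>. \<xi> \<in> tangent_space A p \<Longrightarrow> b * g p \<xi> \<xi> \<le> g p (cov_deriv A g (gradient A g U) p \<xi>) \<xi>)
      \<Longrightarrow> b \<le> hess_min A g U p"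
proof -
  let ?H = "\<lambda>\<xi>. g p (cov_deriv A g (gradient A g U) p \<xi>) \<xi>"
  let ?S = "{?H \<xi> |\<xi>. \<xi> \<in> tangent_space A p \<and> rnorm g p \<xi> = 1}"
  obtain c where c: "c \<in> charts_at A p" by (rule chart_exists)
  note cA = chart_atD[OF c]
  obtain m where m: "0 < m" "\<And>v. m * (norm v)\<^sup>2 \<le> gform c (cmap c p) v v"
    using posdef_coercive[of "gram A g c (cmap c p)"] gform_pos[OF cA(1,3)] unfolding gform_def by metis
  let ?K = "\<chi> i j. hess_form c (cmap c p) (axis i 1) (axis j 1)"
  let ?N = "\<Sum>i\<in>UNIV. \<Sum>j\<in>UNIV. \<bar>?K $ i $ j\<bar>"
  have N: "0 \<le> ?N" by (intro sum_nonneg) auto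
  have "- ?N / m \<le> s" if s: "s \<in> ?S" for s
  proof -
    obtain \<xi> where \<xi>: "\<xi> \<in> tangent_space A p" "rnorm g p \<xi> = 1" "s = ?H \<xi>" using s by blast
    have "m * (norm (\<xi> c))\<^sup>2 \<le> 1"
      using m(2)[of "\<xi> c"] rnorm_power2[OF \<xi>(1)] metric_components[OF \<xi>(1,1) c] \<xi>(2) by simp
    then have "(norm (\<xi> c))\<^sup>2 \<le> 1 / m" using m(1) by (simp add: field_simps)
    then have "?N * (norm (\<xi> c))\<^sup>2 \<le> ?N * (1 / m)" by (rule mult_left_mono[OF _ N])
    moreover have "\<bar>s\<bar> \<le> ?N * (norm (\<xi> c) * norm (\<xi> c))"
      unfolding \<xi>(3) hess_components[OF \<xi>(1,1) c] hess_form_matrix[OF cA(1,3), of "\<xi> c" "\<xi> c"]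
      by (rule matrix_form_bound)
    ultimately show ?thesis by (simp add: power2_eq_square)
  qed
  then have bdd: "bdd_below ?S" by (meson bdd_belowI)
  have lower: "hess_min A g U p \<le> ?H \<xi>" if "\<xi> \<in> tangent_space A p" "rnorm g p \<xi> = 1" for \<xi>
    unfolding hess_min_def by (rule cInf_lower[OF _ bdd]) (use that in blast)
  have H0: "?H (\<lambda>_. 0) = 0"
  proof -
    have "linear (\<lambda>v. hess_form c (cmap c p) v 0)" by (rule hess_form_linear[OF cA(1,3)])
    from linear_0[OF this] show ?thesis unfolding hess_components[OF zero_tangent zero_tangent c] .
  qed
  show "hess_min A g U p * g p \<xi> \<xi> \<le> ?H \<xi>" if \<xi>: "\<xi> \<in> tangent_space A p"
  proof (cases "\<xi> = (\<lambda>_. 0)")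
    case True
    then show ?thesis using H0 metric_zero[OF zero_tangent] by simp
  next
    case False
    note n = normalize_tangent[OF \<xi> False]
    let ?r = "rnorm g p \<xi>" and ?e = "tcomb (1 / rnorm g p \<xi>) \<xi> 0 \<xi>"
    have "?e c = (1 / ?r) *\<^sub>R \<xi> c" by (simp add: tcomb_def)
    then have "?H ?e = ?H \<xi> / ?r\<^sup>2"
      unfolding hess_components[OF n(1,1) c] hess_components[OF \<xi> \<xi> c]
      by (simp add: linear_scale[OF hess_form_linear(1)[OF cA(1,3)]]
          linear_scale[OF hess_form_linear(2)[OF cA(1,3)]] power2_eq_square)
    with lower[OF n(1,2)] have "hess_min A g U p \<le> ?H \<xi> / ?r\<^sup>2" by simp
    then show ?thesis using metric_pos[OF \<xi> False] by (simp add: pos_le_divide_eq rnorm_power2[OF \<xi>])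
  qed
  show "b \<le> hess_min A g U p" if b: "\<And>\<xi>. \<xi> \<in> tangent_space A p \<Longrightarrow> b * g p \<xi> \<xi> \<le> ?H \<xi>"
    unfolding hess_min_def
  proof (rule cInf_greatest)
    show "?S \<noteq> {}" using unit_tangent_exists[of p] by blast
    fix s assume "s \<in> ?S"
    then obtain \<xi> where \<xi>: "\<xi> \<in> tangent_space A p" "rnorm g p \<xi> = 1" "s = ?H \<xi>" by blast
    then show "b \<le> s" using b[OF \<xi>(1)] rnorm_power2[OF \<xi>(1)] by simp
  qed
qed

text \<open>With \<open>b\<close> half of the least eigenvalue at \<open>p\<close>, the form \<open>hess - b *\<^sub>R gram\<close> is positive definite at \<open>p\<close>,
  hence nearby.\<close>

lemma hess_min_locally_positive:
  assumes pos: "0 < hess_min A g U p"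
  shows "\<exists>W b. open W \<and> p \<in> W \<and> 0 < b \<and> (\<forall>q\<in>W. b \<le> hess_min A g U q)"
proof -
  obtain c where c: "c \<in> charts_at A p" by (rule chart_exists)
  note cA = chart_atD[OF c]
  let ?b = "hess_min A g U p / 2"
  let ?H = "\<lambda>z. \<chi> i j. hess_form c z (axis i 1) (axis j 1)"
  let ?K = "\<lambda>z. ?H z - ?b *\<^sub>R gram A g c z"
  have K: "v \<bullet> (?K z *v v) = hess_form c z v v - ?b * gform c z v v" if "z \<in> crange c" for v z
    unfolding hess_form_matrix[OF cA(1) that, of v v]
    by (simp add: matrix_vector_mult_diff_rdistrib inner_diff_right gform_def scaleR_matrix_vector_assoc[symmetric])
  obtain m where m: "0 < m" "\<forall>\<^sub>F z in nhds (cmap c p). \<forall>v. m * (norm v)\<^sup>2 \<le> v \<bullet> (?K z *v v)"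
  proof (rule eventually_coercive)
    show "((\<lambda>z. ?K z $ i $ j) \<longlongrightarrow> ?K (cmap c p) $ i $ j) (nhds (cmap c p))" for i j
      using tendsto_diff[OF hess_form_tendsto[OF cA(1,3), of "axis i 1" "axis j 1"]
          tendsto_mult_left[OF gram_tendsto[OF cA(1,3), of i j], of ?b]]
      by simp
    show "0 < v \<bullet> (?K (cmap c p) *v v)" if v: "v \<noteq> 0" for v
    proof -
      note t = coord_tvec_in[OF c, of v]
      have "hess_min A g U p * gform c (cmap c p) v v \<le> hess_form c (cmap c p) v v"
        using hess_min_works(1)[OF t] unfolding hess_components[OF t t c] metric_components[OF t t c]
          coord_tvec_at[OF c] .
      moreover have "0 < ?b * gform c (cmap c p) v v" using gform_pos[OF cA(1,3) v] pos by simp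
      ultimately show ?thesis unfolding K[OF cA(3)] by (simp add: field_simps)
    qed
  qed
  have "\<forall>\<^sub>F z in nhds (cmap c p). z \<in> crange c"
    using chart_domain(2)[OF cA(1)] cA(3) eventually_nhds_in_open by blast
  from eventually_conj[OF this m(2)]
  obtain W where W: "open W" "p \<in> W" "W \<subseteq> cdom c"
    "\<And>q. q \<in> W \<Longrightarrow> cmap c q \<in> crange c \<and> (\<forall>v. m * (norm v)\<^sup>2 \<le> v \<bullet> (?K (cmap c q) *v v))"
    by (rule eventually_nhds_chart[OF c]) blast
  have "?b \<le> hess_min A g U q" if q: "q \<in> W" for q
  proof (rule hess_min_works(2))
    fix \<xi> assume \<xi>: "\<xi> \<in> tangent_space A q"
    have cq: "c \<in> charts_at A q" using q W(3) cA(1) by (auto simp: charts_at_iff)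
    have "0 \<le> m * (norm (\<xi> c))\<^sup>2" using m(1) by simp
    also have "\<dots> \<le> \<xi> c \<bullet> (?K (cmap c q) *v \<xi> c)" using W(4)[OF q] by blast
    also have "\<dots> = hess_form c (cmap c q) (\<xi> c) (\<xi> c) - ?b * gform c (cmap c q) (\<xi> c) (\<xi> c)"
      using W(4)[OF q] by (intro K) blast
    finally show "?b * g q \<xi> \<xi> \<le> g q (cov_deriv A g (gradient A g U) q \<xi>) \<xi>"
      unfolding hess_components[OF \<xi> \<xi> cq] metric_components[OF \<xi> \<xi> cq] by simp
  qed
  then show ?thesis using W pos by (intro exI[of _ W] exI[of _ ?b]) auto
qed

lemma gradient_locally_bounded:
  "\<exists>W N. open W \<and> p \<in> W \<and> (\<forall>q\<in>W. rnorm g q (gradient A g U q) \<le> N)"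
proof -
  obtain c where c: "c \<in> charts_at A p" by (rule chart_exists)
  note cA = chart_atD[OF c]
  let ?y = "cmap c p"
  let ?h = "\<lambda>z. gform c z (grad_comp c z) (grad_comp c z)"
  have W: "(grad_comp c \<longlongrightarrow> grad_comp c ?y) (nhds ?y)"
    by (rule differentiable_tendsto_nhds[OF grad_comp_differentiable[OF cA(1,3)]])
  have G: "(gram A g c \<longlongrightarrow> gram A g c ?y) (nhds ?y)"
    by (intro vec_tendstoI gram_tendsto[OF cA(1,3)])
  have "(?h \<longlongrightarrow> ?h ?y) (nhds ?y)"
    unfolding gform_def
    by (intro tendsto_inner W bounded_bilinear.tendsto[OF bounded_bilinear_matrix_vector] G)
  then have "\<forall>\<^sub>F z in nhds ?y. ?h z < ?h ?y + 1" by (rule order_tendstoD) simp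
  then obtain V where V: "open V" "p \<in> V" "V \<subseteq> cdom c" "\<And>q. q \<in> V \<Longrightarrow> ?h (cmap c q) < ?h ?y + 1"
    by (rule eventually_nhds_chart[OF c]) blast
  have "rnorm g q (gradient A g U q) \<le> sqrt (?h ?y + 1)" if q: "q \<in> V" for q
  proof -
    have cq: "c \<in> charts_at A q" using q V(3) cA(1) by (auto simp: charts_at_iff)
    show ?thesis
      unfolding rnorm_components[OF gradient_works(1) cq]
      using V(4)[OF q] chart_atD(4)[OF cq] by (intro real_sqrt_le_mono) simp
  qed
  with V show ?thesis by blast
qed

end


section \<open>Curves and their length\<close>

lemma at_within_Icc_nontrivial:
  fixes t :: real
  assumes "u < v" "t \<in> {u..v}"
  shows "at t within {u..v} \<noteq> bot"
  using assms islimpt_Icc[of u v t] trivial_limit_within by blast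

lemma has_vector_derivative_transform_eventually:
  assumes "(f has_vector_derivative f') (at t within I)" "\<forall>\<^sub>F \<tau> in at t within I. f \<tau> = h \<tau>"
    "t \<in> I" "f t = h t"
  shows "(h has_vector_derivative f') (at t within I)"
  using has_derivative_transform_eventually[OF assms(1)[unfolded has_vector_derivative_def] assms(2,4,3)]
  by (simp add: has_vector_derivative_def)

lemma vector_derivative_cong_on:
  assumes "t \<in> I" "\<And>\<tau>. \<tau> \<in> I \<Longrightarrow> f \<tau> = h \<tau>"
  shows "vector_derivative f (at t within I) = vector_derivative h (at t within I)"
proof -
  have "(f has_vector_derivative D) (at t within I) \<longleftrightarrow> (h has_vector_derivative D) (at t within I)" for D
    using has_vector_derivative_transform[OF assms(1), of f h] has_vector_derivative_transform[OF assms(1), of h f]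
      assms(2) by auto
  then show ?thesis unfolding vector_derivative_def by simp
qed

context riemannian
begin

lemma eventually_in_chart:
  assumes \<gamma>: "continuous_on I \<gamma>" "t \<in> I" and c: "c \<in> charts_at A (\<gamma> t)"
  shows "\<forall>\<^sub>F \<tau> in at t within I. \<tau> \<in> I \<and> c \<in> charts_at A (\<gamma> \<tau>)"
proof -
  have "(\<gamma> \<longlongrightarrow> \<gamma> t) (at t within I)" using \<gamma> by (simp add: continuous_on_def)
  then have "\<forall>\<^sub>F \<tau> in at t within I. \<gamma> \<tau> \<in> cdom c"
    using chart_domain(1)[OF chart_atD(1)[OF c]] chart_atD(2)[OF c] by (rule topological_tendstoD)
  moreover have "\<forall>\<^sub>F \<tau> in at t within I. \<tau> \<in> I" by (simp add: eventually_at_filter)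
  ultimately show ?thesis by eventually_elim (use chart_atD(1)[OF c] in \<open>simp add: charts_at_iff\<close>)
qed

lemma velocity_component:
  assumes "c \<in> charts_at A (\<gamma> t)" "(cmap c \<circ> \<gamma>) differentiable (at t within I)"
  shows "((cmap c \<circ> \<gamma>) has_vector_derivative velocity A I \<gamma> t c) (at t within I)"
  using assms by (simp add: velocity_def vector_derivative_works)

lemma chart_change_has_vector_derivative:
  assumes \<gamma>: "continuous_on I \<gamma>" "t \<in> I"
    and c: "c \<in> charts_at A (\<gamma> t)" and c': "c' \<in> charts_at A (\<gamma> t)"
    and d: "((cmap c \<circ> \<gamma>) has_vector_derivative w) (at t within I)"
  shows "((cmap c' \<circ> \<gamma>) has_vector_derivative
      frechet_derivative (cmap c' \<circ> cinv c) (at (cmap c (\<gamma> t))) w) (at t within I)"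
proof -
  let ?T = "cmap c' \<circ> cinv c"
  let ?J = "frechet_derivative ?T (at (cmap c (\<gamma> t)))"
  have "((\<lambda>\<tau>. ?T ((cmap c \<circ> \<gamma>) \<tau>)) has_derivative (\<lambda>h. ?J (h *\<^sub>R w))) (at t within I)"
    using has_derivative_compose[OF d[unfolded has_vector_derivative_def], of ?T ?J]
      transition_has_derivative[OF atlas c c'] by simp
  then have "((\<lambda>\<tau>. ?T ((cmap c \<circ> \<gamma>) \<tau>)) has_vector_derivative ?J w) (at t within I)"
    unfolding has_vector_derivative_def by (simp add: linear_scale[OF transition_linear[OF c c']])
  moreover have "\<forall>\<^sub>F \<tau> in at t within I. ?T ((cmap c \<circ> \<gamma>) \<tau>) = (cmap c' \<circ> \<gamma>) \<tau>"
    using eventually_in_chart[OF \<gamma> c] by (rule eventually_mono) (simp add: chart_atD(4))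
  ultimately show ?thesis
    by (rule has_vector_derivative_transform_eventually[OF _ _ \<gamma>(2)]) (simp add: chart_atD(4)[OF c])
qed

lemma velocity_tangent:
  assumes \<gamma>: "continuous_on I \<gamma>" "t \<in> I" "at t within I \<noteq> bot"
    and diff: "\<And>c. c \<in> charts_at A (\<gamma> t) \<Longrightarrow> (cmap c \<circ> \<gamma>) differentiable (at t within I)"
  shows "velocity A I \<gamma> t \<in> tangent_space A (\<gamma> t)"
proof -
  have "velocity A I \<gamma> t c' = frechet_derivative (cmap c' \<circ> cinv c) (at (cmap c (\<gamma> t))) (velocity A I \<gamma> t c)"
    if c: "c \<in> charts_at A (\<gamma> t)" "c' \<in> charts_at A (\<gamma> t)" for c c'
    by (rule vector_derivative_unique_within[OF \<gamma>(3) velocity_component[OF c(2) diff[OF c(2)]]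
          chart_change_has_vector_derivative[OF \<gamma>(1,2) c velocity_component[OF c(1) diff[OF c(1)]]]])
  moreover have "velocity A I \<gamma> t c = 0" if "c \<notin> charts_at A (\<gamma> t)" for c
    using that by (simp add: velocity_def)
  ultimately show ?thesis unfolding tangent_space_def by blast
qed

abbreviation speed :: "real set \<Rightarrow> (real \<Rightarrow> 'a) \<Rightarrow> real \<Rightarrow> real" where
  "speed I \<gamma> t \<equiv> rnorm g (\<gamma> t) (velocity A I \<gamma> t)"

lemma C1_curveD:
  assumes "C1_curve_on A I \<gamma>"
  shows "continuous_on I \<gamma>"
    and "t \<in> I \<Longrightarrow> c \<in> charts_at A (\<gamma> t) \<Longrightarrow> (cmap c \<circ> \<gamma>) differentiable (at t within I)"
    and "t \<in> I \<Longrightarrow> c \<in> charts_at A (\<gamma> t) \<Longrightarrow>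
      ((\<lambda>\<tau>. vector_derivative (cmap c \<circ> \<gamma>) (at \<tau> within I)) \<longlongrightarrow> vector_derivative (cmap c \<circ> \<gamma>) (at t within I)) (at t within I)"
  using assms unfolding C1_curve_on_def by (auto simp: continuous_within)

lemma C1_velocity_tangent:
  assumes "C1_curve_on A {u..v} \<gamma>" "u < v" "t \<in> {u..v}"
  shows "velocity A {u..v} \<gamma> t \<in> tangent_space A (\<gamma> t)"
  using velocity_tangent[OF C1_curveD(1)[OF assms(1)] assms(3) at_within_Icc_nontrivial[OF assms(2,3)]]
    C1_curveD(2)[OF assms(1,3)] by blast

text \<open>In a chart the speed is the square root of the Gram form of the continuous coordinate velocity.\<close>

lemma C1_speed_continuous:
  assumes \<gamma>: "C1_curve_on A {u..v} \<gamma>" and uv: "u < v"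
  shows "continuous_on {u..v} (speed {u..v} \<gamma>)"
  unfolding continuous_on_def
proof
  fix t assume t: "t \<in> {u..v}"
  let ?F = "at t within {u..v}"
  obtain c where c: "c \<in> charts_at A (\<gamma> t)" by (rule chart_exists)
  note cA = chart_atD[OF c]
  let ?V = "\<lambda>\<tau>. vector_derivative (cmap c \<circ> \<gamma>) (at \<tau> within {u..v})"
  let ?y = "\<lambda>\<tau>. cmap c (\<gamma> \<tau>)"
  have V: "(?V \<longlongrightarrow> ?V t) ?F" by (rule C1_curveD(3)[OF \<gamma> t c])
  have "continuous ?F (cmap c \<circ> \<gamma>)"
    by (rule differentiable_imp_continuous_within[OF C1_curveD(2)[OF \<gamma> t c]])
  then have y: "(?y \<longlongrightarrow> ?y t) ?F" by (simp add: continuous_within o_def)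
  have "(gram A g c \<longlongrightarrow> gram A g c (?y t)) (nhds (?y t))"
    by (intro vec_tendstoI gram_tendsto[OF cA(1,3)])
  then have G: "((\<lambda>\<tau>. gram A g c (?y \<tau>)) \<longlongrightarrow> gram A g c (?y t)) ?F"
    by (rule filterlim_compose[OF _ y])
  have lim: "((\<lambda>\<tau>. sqrt (gform c (?y \<tau>) (?V \<tau>) (?V \<tau>))) \<longlongrightarrow> sqrt (gform c (?y t) (?V t) (?V t))) ?F"
    unfolding gform_def
    by (intro tendsto_real_sqrt tendsto_inner V bounded_bilinear.tendsto[OF bounded_bilinear_matrix_vector] G)
  have eq: "sqrt (gform c (?y \<tau>) (?V \<tau>) (?V \<tau>)) = speed {u..v} \<gamma> \<tau>"
    if \<tau>: "\<tau> \<in> {u..v}" "c \<in> charts_at A (\<gamma> \<tau>)" for \<tau>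
    unfolding rnorm_components[OF C1_velocity_tangent[OF \<gamma> uv \<tau>(1)] \<tau>(2)]
    using \<tau>(2) by (simp add: velocity_def)
  have "\<forall>\<^sub>F \<tau> in ?F. sqrt (gform c (?y \<tau>) (?V \<tau>) (?V \<tau>)) = speed {u..v} \<gamma> \<tau>"
    using eventually_in_chart[OF C1_curveD(1)[OF \<gamma>] t c] by (rule eventually_mono) (use eq in blast)
  from tendsto_cong[OF this] lim show "(speed {u..v} \<gamma> \<longlongrightarrow> speed {u..v} \<gamma> t) ?F"
    unfolding eq[OF t c] by blast
qed

lemma C1_curve_cong:
  assumes \<gamma>: "C1_curve_on A I \<gamma>" and eq: "\<And>t. t \<in> I \<Longrightarrow> \<gamma> t = \<gamma>' t"
  shows "C1_curve_on A I \<gamma>'"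
    and "t \<in> I \<Longrightarrow> speed I \<gamma>' t = speed I \<gamma> t"
proof -
  have vd: "vector_derivative (cmap c \<circ> \<gamma>') (at t within I) = vector_derivative (cmap c \<circ> \<gamma>) (at t within I)"
    if "t \<in> I" for c :: "('a, 'm) chart" and t
    by (rule vector_derivative_cong_on[OF that]) (simp add: eq)
  show "t \<in> I \<Longrightarrow> speed I \<gamma>' t = speed I \<gamma> t" using eq[of t] vd by (simp only: velocity_def)
  show "C1_curve_on A I \<gamma>'"
    unfolding C1_curve_on_def
  proof (intro conjI ballI)
    show "continuous_on I \<gamma>'" using C1_curveD(1)[OF \<gamma>] eq by (metis continuous_on_cong)
    fix t and c :: "('a, 'm) chart" assume t: "t \<in> I" and c: "c \<in> charts_at A (\<gamma>' t)"
    have c': "c \<in> charts_at A (\<gamma> t)" using c eq[OF t] by simp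
    obtain D where "((cmap c \<circ> \<gamma>) has_derivative D) (at t within I)"
      using C1_curveD(2)[OF \<gamma> t c'] unfolding differentiable_def by blast
    then have "((cmap c \<circ> \<gamma>') has_derivative D) (at t within I)"
      by (rule has_derivative_transform[OF t, rotated]) (simp add: eq)
    then show "(cmap c \<circ> \<gamma>') differentiable (at t within I)" unfolding differentiable_def by blast
    have "\<forall>\<^sub>F \<tau> in at t within I. vector_derivative (cmap c \<circ> \<gamma>) (at \<tau> within I) = vector_derivative (cmap c \<circ> \<gamma>') (at \<tau> within I)"
      using vd by (simp add: eventually_at_filter)
    from tendsto_cong[OF this] C1_curveD(3)[OF \<gamma> t c']
    show "continuous (at t within I) (\<lambda>\<tau>. vector_derivative (cmap c \<circ> \<gamma>') (at \<tau> within I))"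
      unfolding continuous_within vd[OF t] by blast
  qed
qed

text \<open>With \<open>m = 1\<close>, \<open>k = 0\<close> this covers restriction to a smaller interval.\<close>

lemma C1_curve_affine:
  assumes \<gamma>: "C1_curve_on A {a..b} \<gamma>" and ab: "a < b" and uv: "u < v"
    and sub: "(\<lambda>t. m * t + k) ` {u..v} \<subseteq> {a..b}"
  shows "C1_curve_on A {u..v} (\<lambda>t. \<gamma> (m * t + k))"
    and "t \<in> {u..v} \<Longrightarrow> speed {u..v} (\<lambda>t. \<gamma> (m * t + k)) t = \<bar>m\<bar> * speed {a..b} \<gamma> (m * t + k)"
proof -
  let ?\<phi> = "\<lambda>t. m * t + k" and ?I = "{a..b}" and ?J = "{u..v}"
  let ?V = "\<lambda>c \<tau>. vector_derivative (cmap c \<circ> \<gamma>) (at \<tau> within ?I)"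
  have \<phi>: "?\<phi> t \<in> ?I" if "t \<in> ?J" for t using sub that by blast
  have vd: "((cmap c \<circ> (\<lambda>t. \<gamma> (?\<phi> t))) has_vector_derivative m *\<^sub>R ?V c (?\<phi> t)) (at t within ?J)"
    if t: "t \<in> ?J" and c: "c \<in> charts_at A (\<gamma> (?\<phi> t))" for t c
  proof -
    have "((cmap c \<circ> \<gamma>) has_vector_derivative ?V c (?\<phi> t)) (at (?\<phi> t) within ?I)"
      using C1_curveD(2)[OF \<gamma> \<phi>[OF t] c] by (simp add: vector_derivative_works)
    then have 1: "((cmap c \<circ> \<gamma>) has_vector_derivative ?V c (?\<phi> t)) (at (?\<phi> t) within ?\<phi> ` ?J)"
      by (rule has_vector_derivative_within_subset[OF _ sub])
    have "(?\<phi> has_vector_derivative m) (at t within ?J)"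
      by (auto intro!: derivative_eq_intros)
    from vector_diff_chain_within[OF this 1] show ?thesis by (simp add: o_def)
  qed
  have vd_eq: "vector_derivative (cmap c \<circ> (\<lambda>t. \<gamma> (?\<phi> t))) (at t within ?J) = m *\<^sub>R ?V c (?\<phi> t)"
    if "t \<in> ?J" "c \<in> charts_at A (\<gamma> (?\<phi> t))" for t c
    by (rule vector_derivative_within_closed_interval[OF uv that(1) vd[OF that]])
  have cont: "continuous_on ?J ?\<phi>" by (intro continuous_intros)
  have \<gamma>c: "continuous_on ?J (\<lambda>t. \<gamma> (?\<phi> t))"
    by (rule continuous_on_compose2[OF C1_curveD(1)[OF \<gamma>] cont sub])
  show "C1_curve_on A ?J (\<lambda>t. \<gamma> (?\<phi> t))"
    unfolding C1_curve_on_def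
  proof (intro conjI ballI)
    show "continuous_on ?J (\<lambda>t. \<gamma> (?\<phi> t))" by (rule \<gamma>c)
    fix t c assume t: "t \<in> ?J" and c: "c \<in> charts_at A (\<gamma> (?\<phi> t))"
    show "(cmap c \<circ> (\<lambda>t. \<gamma> (?\<phi> t))) differentiable (at t within ?J)"
      using vd[OF t c] by (rule differentiableI_vector)
    have "continuous (at (?\<phi> t) within ?I) (?V c)"
      using C1_curveD(3)[OF \<gamma> \<phi>[OF t] c] by (simp add: continuous_within)
    then have "continuous (at (?\<phi> t) within ?\<phi> ` ?J) (?V c)" by (rule continuous_within_subset[OF _ sub])
    moreover have "continuous (at t within ?J) ?\<phi>" using cont t continuous_on_eq_continuous_within by blast
    ultimately have "continuous (at t within ?J) (?V c \<circ> ?\<phi>)" by (intro continuous_within_compose)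
    then have "((\<lambda>\<tau>. m *\<^sub>R ?V c (?\<phi> \<tau>)) \<longlongrightarrow> m *\<^sub>R ?V c (?\<phi> t)) (at t within ?J)"
      by (intro tendsto_intros) (simp add: continuous_within o_def)
    moreover have "\<forall>\<^sub>F \<tau> in at t within ?J. m *\<^sub>R ?V c (?\<phi> \<tau>) = vector_derivative (cmap c \<circ> (\<lambda>t. \<gamma> (?\<phi> t))) (at \<tau> within ?J)"
      using eventually_in_chart[OF \<gamma>c t c] by (rule eventually_mono) (simp add: vd_eq)
    ultimately show "continuous (at t within ?J) (\<lambda>\<tau>. vector_derivative (cmap c \<circ> (\<lambda>t. \<gamma> (?\<phi> t))) (at \<tau> within ?J))"
      unfolding continuous_within vd_eq[OF t c] using tendsto_cong by force
  qed
  show "speed ?J (\<lambda>t. \<gamma> (?\<phi> t)) t = \<bar>m\<bar> * speed ?I \<gamma> (?\<phi> t)" if t: "t \<in> ?J"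
  proof -
    let ?v = "velocity A ?I \<gamma> (?\<phi> t)"
    have "velocity A ?J (\<lambda>t. \<gamma> (?\<phi> t)) t = tcomb m ?v 0 ?v"
    proof
      fix c
      show "velocity A ?J (\<lambda>t. \<gamma> (?\<phi> t)) t c = tcomb m ?v 0 ?v c"
      proof (cases "c \<in> charts_at A (\<gamma> (?\<phi> t))")
        case True
        then show ?thesis using vd_eq[OF t True] by (simp add: velocity_def tcomb_def)
      qed (simp add: velocity_def tcomb_def)
    qed
    then show ?thesis using rnorm_scale[OF C1_velocity_tangent[OF \<gamma> ab \<phi>[OF t]]] by simp
  qed
qed

text \<open>\<open>arc a b \<gamma> L\<close>: on \<open>{a..b}\<close> the curve \<open>\<gamma>\<close> is piecewise \<open>C\<^sup>1\<close> of length \<open>L\<close>. The inductive form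
  reduces each property of piecewise curves to a single \<open>C\<^sup>1\<close> piece.\<close>

inductive arc :: "real \<Rightarrow> real \<Rightarrow> (real \<Rightarrow> 'a) \<Rightarrow> real \<Rightarrow> bool" where
  piece: "a < b \<Longrightarrow> C1_curve_on A {a..b} \<gamma> \<Longrightarrow> arc a b \<gamma> (integral {a..b} (speed {a..b} \<gamma>))"
| join: "arc a b \<gamma> L \<Longrightarrow> arc b c \<gamma> M \<Longrightarrow> arc a c \<gamma> (L + M)"

lemma arc_less: "arc a b \<gamma> L \<Longrightarrow> a < b"
  by (induction rule: arc.induct) auto

lemma arc_continuous: "arc a b \<gamma> L \<Longrightarrow> continuous_on {a..b} \<gamma>"
proof (induction rule: arc.induct)
  case (join a b \<gamma> L c M)
  then have "{a..c} = {a..b} \<union> {b..c}" using arc_less by fastforce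
  with join show ?case by (simp add: continuous_on_closed_Un)
qed (rule C1_curveD(1))

lemma C1_speed_has_integral:
  assumes "C1_curve_on A {a..b} \<gamma>" "a < b"
  shows "(speed {a..b} \<gamma> has_integral integral {a..b} (speed {a..b} \<gamma>)) {a..b}"
  by (intro integrable_integral integrable_continuous_real C1_speed_continuous assms)

text \<open>On the interior of a piece the one-sided and two-sided velocities agree, and breakpoints are
  negligible. Hence the length is the integral of one function that does not refer to the partition.\<close>

lemma arc_has_integral: "arc a b \<gamma> L \<Longrightarrow> (speed UNIV \<gamma> has_integral L) {a..b}"
proof (induction rule: arc.induct)
  case (piece a b \<gamma>)
  have "speed UNIV \<gamma> t = speed {a..b} \<gamma> t" if "t \<in> box a b" for t
  proof -
    have "at t within {a..b} = at t" using that by (intro at_within_Icc_at) (auto simp: box_real)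
    then show ?thesis by (simp only: velocity_def)
  qed
  from has_integral_spike_interior[where g = "speed UNIV \<gamma>", OF _ this] C1_speed_has_integral[OF piece(2,1)]
  show ?case by (simp add: cbox_interval)
next
  case (join a b \<gamma> L c M)
  then show ?case
    using has_integral_combine[of a b c "speed UNIV \<gamma>" L M] arc_less by (meson less_imp_le)
qed

lemma arc_unique: "arc a b \<gamma> L \<Longrightarrow> arc a b \<gamma> M \<Longrightarrow> L = M"
  using arc_has_integral has_integral_unique by blast

lemma arc_length_nonneg: "arc a b \<gamma> L \<Longrightarrow> 0 \<le> L"
proof (induction rule: arc.induct)
  case (piece a b \<gamma>)
  then show ?case
    by (intro has_integral_nonneg[OF C1_speed_has_integral] rnorm_nonneg C1_velocity_tangent)
qed simp

lemma arc_cong: "arc a b \<gamma> L \<Longrightarrow> (\<And>t. t \<in> {a..b} \<Longrightarrow> \<gamma> t = \<gamma>' t) \<Longrightarrow> arc a b \<gamma>' L"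
proof (induction rule: arc.induct)
  case (piece a b \<gamma>)
  note C = C1_curve_cong[OF piece(2,3)]
  have "integral {a..b} (speed {a..b} \<gamma>') = integral {a..b} (speed {a..b} \<gamma>)"
    by (intro integral_cong C(2))
  then show ?case using arc.piece[OF piece(1) C(1)] by simp
next
  case (join a b \<gamma> L c M)
  have "a < b" "b < c" using join arc_less by blast+
  then show ?case using join by (intro arc.join[of a b _ L c M]) auto
qed

lemma arc_affine:
  assumes "arc a b \<gamma> L" "m \<noteq> 0"
  shows "arc (min ((a - k) / m) ((b - k) / m)) (max ((a - k) / m) ((b - k) / m)) (\<lambda>t. \<gamma> (m * t + k)) L"
  using assms(1)
proof (induction rule: arc.induct)
  case (piece a b \<gamma>)
  let ?u = "min ((a - k) / m) ((b - k) / m)" and ?v = "max ((a - k) / m) ((b - k) / m)"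
  have uv: "?u < ?v" using piece(1) assms(2) by (auto simp: min_def max_def divide_simps)
  have "(\<lambda>x. (1 / m) *\<^sub>R x + - ((1 / m) *\<^sub>R k)) ` {a..b} = {?u..?v}"
  proof (cases "0 < m")
    case True
    then have le: "(a - k) / m \<le> (b - k) / m" using piece(1) by (simp add: divide_right_mono)
    show ?thesis
      unfolding min_absorb1[OF le] max_absorb2[OF le]
      using image_affinity_atLeastAtMost[of "1 / m" "- (k / m)" a b] True piece(1)
      by (simp add: diff_divide_distrib)
  next
    case False
    then have le: "(b - k) / m \<le> (a - k) / m" using piece(1) by (simp add: divide_right_mono_neg)
    show ?thesis
      unfolding min_absorb2[OF le] max_absorb1[OF le]
      using image_affinity_atLeastAtMost[of "1 / m" "- (k / m)" a b] False piece(1) assms(2)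
      by (simp add: diff_divide_distrib)
  qed
  then have int: "((\<lambda>t. speed {a..b} \<gamma> (m * t + k)) has_integral (1 / \<bar>m\<bar>) * integral {a..b} (speed {a..b} \<gamma>)) {?u..?v}"
    using has_integral_affinity[of "speed {a..b} \<gamma>" _ a b m k] C1_speed_has_integral[OF piece(2,1)] assms(2)
    by (simp add: cbox_interval)
  have sub: "(\<lambda>t. m * t + k) ` {?u..?v} \<subseteq> {a..b}"
    using piece(1) assms(2) by (auto simp: min_def max_def divide_simps mult.commute split: if_splits)
  note C = C1_curve_affine[OF piece(2,1) uv sub]
  have "((\<lambda>t. \<bar>m\<bar> * speed {a..b} \<gamma> (m * t + k)) has_integral \<bar>m\<bar> * ((1 / \<bar>m\<bar>) * integral {a..b} (speed {a..b} \<gamma>))) {?u..?v}"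
    by (intro has_integral_mult_right int)
  then have "(speed {?u..?v} (\<lambda>t. \<gamma> (m * t + k)) has_integral integral {a..b} (speed {a..b} \<gamma>)) {?u..?v}"
    using has_integral_cong[of "{?u..?v}" "\<lambda>t. \<bar>m\<bar> * speed {a..b} \<gamma> (m * t + k)" "speed {?u..?v} (\<lambda>t. \<gamma> (m * t + k))"]
      C(2) assms(2) by simp
  then show ?case using arc.piece[OF uv C(1)] by (simp add: integral_unique)
next
  case (join a b \<gamma> L c M)
  have lt: "a < b" "b < c" using join arc_less by blast+
  show ?case
  proof (cases "0 < m")
    case True
    then have "(a - k) / m < (b - k) / m" "(b - k) / m < (c - k) / m" using lt by (simp_all add: divide_strict_right_mono)
    then show ?thesis using join arc.join[of "(a - k) / m" "(b - k) / m" _ L "(c - k) / m" M] by simp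
  next
    case False
    then have "(b - k) / m < (a - k) / m" "(c - k) / m < (b - k) / m"
      using lt assms(2) by (simp_all add: divide_strict_right_mono_neg)
    then show ?thesis
      using join arc.join[of "(c - k) / m" "(b - k) / m" _ M "(a - k) / m" L] by (simp add: add.commute)
  qed
qed

text \<open>A point inside a piece cuts it into two \<open>C\<^sup>1\<close> pieces; by uniqueness of the length no length is lost.\<close>

lemma arc_restrict:
  "arc a b \<gamma> L \<Longrightarrow> a < t \<Longrightarrow> t < b \<Longrightarrow> \<exists>L1 L2. arc a t \<gamma> L1 \<and> arc t b \<gamma> L2 \<and> L1 + L2 = L"
proof (induction arbitrary: t rule: arc.induct)
  case (piece a b \<gamma>)
  have "C1_curve_on A {u..v} \<gamma>" if "a \<le> u" "u < v" "v \<le> b" for u v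
    using C1_curve_affine(1)[OF piece(2,1), of u v 1 0] that by simp
  then have "arc a t \<gamma> (integral {a..t} (speed {a..t} \<gamma>))" "arc t b \<gamma> (integral {t..b} (speed {t..b} \<gamma>))"
    using piece by (auto intro!: arc.piece)
  moreover from arc.join[OF this] arc.piece[OF piece(1,2)]
  have "integral {a..t} (speed {a..t} \<gamma>) + integral {t..b} (speed {t..b} \<gamma>) = integral {a..b} (speed {a..b} \<gamma>)"
    by (rule arc_unique)
  ultimately show ?case by blast
next
  case (join a b \<gamma> L c M)
  consider "t < b" | "t = b" | "b < t" by linarith
  then show ?case
  proof cases
    case 1
    obtain L1 L2 where *: "arc a t \<gamma> L1" "arc t b \<gamma> L2" "L1 + L2 = L" using join.IH(1)[of t] join.prems 1 by auto
    show ?thesis using * arc.join[OF *(2) join.hyps(2)] by (intro exI[of _ L1] exI[of _ "L2 + M"]) auto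
  next
    case 2
    then show ?thesis using join.hyps by blast
  next
    case 3
    obtain L1 L2 where *: "arc b t \<gamma> L1" "arc t c \<gamma> L2" "L1 + L2 = M" using join.IH(2)[of t] join.prems 3 by auto
    show ?thesis using * arc.join[OF join.hyps(1) *(1)] by (intro exI[of _ "L + L1"] exI[of _ L2]) auto
  qed
qed

lemma arc_breakpoints:
  "arc a b \<gamma> L \<Longrightarrow> \<exists>S. finite S \<and> {a, b} \<subseteq> S \<and> S \<subseteq> {a..b} \<and>
        (\<forall>u\<in>S. \<forall>v\<in>S. u < v \<and> {u<..<v} \<inter> S = {} \<longrightarrow> C1_curve_on A {u..v} \<gamma>)"
proof (induction rule: arc.induct)
  case (piece a b \<gamma>)
  then show ?case by (intro exI[of _ "{a, b}"]) auto
next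
  case (join a b \<gamma> L c M)
  obtain S where S: "finite S" "{a, b} \<subseteq> S" "S \<subseteq> {a..b}"
    "\<And>u v. u \<in> S \<Longrightarrow> v \<in> S \<Longrightarrow> u < v \<Longrightarrow> {u<..<v} \<inter> S = {} \<Longrightarrow> C1_curve_on A {u..v} \<gamma>"
    using join.IH(1) by (elim exE conjE) simp
  obtain T where T: "finite T" "{b, c} \<subseteq> T" "T \<subseteq> {b..c}"
    "\<And>u v. u \<in> T \<Longrightarrow> v \<in> T \<Longrightarrow> u < v \<Longrightarrow> {u<..<v} \<inter> T = {} \<Longrightarrow> C1_curve_on A {u..v} \<gamma>"
    using join.IH(2) by (elim exE conjE) simp
  have lt: "a < b" "b < c" using arc_less[OF join.hyps(1)] arc_less[OF join.hyps(2)] .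
  have "C1_curve_on A {u..v} \<gamma>"
    if uv: "u \<in> S \<union> T" "v \<in> S \<union> T" "u < v" "{u<..<v} \<inter> (S \<union> T) = {}" for u v
  proof -
    have "b \<notin> {u<..<v}" using uv(4) S(2) by blast
    then consider "v \<le> b" | "b \<le> u" using uv(3) by fastforce
    then show ?thesis
    proof cases
      case 1
      then have "u \<in> S" "v \<in> S" using uv S(2) T(3) by (auto dest!: subsetD[OF T(3)])
      then show ?thesis using S(4) uv by blast
    next
      case 2
      then have "u \<in> T" "v \<in> T" using uv T(2) by (auto dest!: subsetD[OF S(3)])
      then show ?thesis using T(4) uv by blast
    qed
  qed
  moreover have "finite (S \<union> T)" "{a, c} \<subseteq> S \<union> T" "S \<union> T \<subseteq> {a..c}"
    using S(1-3) T(1-3) lt by fastforce+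
  ultimately show ?case by (intro exI[of _ "S \<union> T"]) blast
qed

text \<open>Induction on the number of breakpoints: an interior breakpoint splits the partition into two smaller
  ones.\<close>

lemma breakpoints_arc:
  assumes "finite S" "a \<in> S" "b \<in> S" "S \<subseteq> {a..b}" "a < b"
    and "\<And>u v. u \<in> S \<Longrightarrow> v \<in> S \<Longrightarrow> u < v \<Longrightarrow> {u<..<v} \<inter> S = {} \<Longrightarrow> C1_curve_on A {u..v} \<gamma>"
  shows "\<exists>L. arc a b \<gamma> L"
  using assms
proof (induction "card S" arbitrary: S a b rule: less_induct)
  case less
  show ?case
  proof (cases "{a<..<b} \<inter> S = {}")
    case True
    then have "C1_curve_on A {a..b} \<gamma>" using less.prems(2,3,5) by (intro less.prems(6))
    from arc.piece[OF less.prems(5) this] show ?thesis ..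
  next
    case False
    then obtain m where m: "m \<in> S" "a < m" "m < b" by auto
    let ?S1 = "S \<inter> {a..m}" and ?S2 = "S \<inter> {m..b}"
    have "b \<notin> ?S1" "a \<notin> ?S2" using m by auto
    then have sub: "?S1 \<subset> S" "?S2 \<subset> S" using less.prems(2,3) by blast+
    have "\<exists>L. arc a m \<gamma> L"
    proof (rule less.hyps[of ?S1])
      show "card ?S1 < card S" using sub(1) less.prems(1) by (rule psubset_card_mono[rotated])
      show "C1_curve_on A {u..v} \<gamma>" if "u \<in> ?S1" "v \<in> ?S1" "u < v" "{u<..<v} \<inter> ?S1 = {}" for u v
      proof (rule less.prems(6))
        show "{u<..<v} \<inter> S = {}" using that by fastforce
      qed (use that in auto)
    qed (use less.prems(1-5) m in auto)
    moreover have "\<exists>L. arc m b \<gamma> L"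
    proof (rule less.hyps[of ?S2])
      show "card ?S2 < card S" using sub(2) less.prems(1) by (rule psubset_card_mono[rotated])
      show "C1_curve_on A {u..v} \<gamma>" if "u \<in> ?S2" "v \<in> ?S2" "u < v" "{u<..<v} \<inter> ?S2 = {}" for u v
      proof (rule less.prems(6))
        show "{u<..<v} \<inter> S = {}" using that by fastforce
      qed (use that in auto)
    qed (use less.prems(1-5) m in auto)
    ultimately show ?thesis using arc.join by blast
  qed
qed

definition joined :: "'a \<Rightarrow> 'a \<Rightarrow> real \<Rightarrow> bool" where
  "joined p q L \<longleftrightarrow> (\<exists>a b \<gamma>. arc a b \<gamma> L \<and> \<gamma> a = p \<and> \<gamma> b = q)"

lemma joinedI: "arc a b \<gamma> L \<Longrightarrow> joined (\<gamma> a) (\<gamma> b) L"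
  unfolding joined_def by blast

lemma joined_unit_interval:
  assumes "joined p q L"
  obtains \<gamma> where "arc 0 1 \<gamma> L" "\<gamma> 0 = p" "\<gamma> 1 = q"
proof -
  obtain a b \<gamma> where *: "arc a b \<gamma> L" "\<gamma> a = p" "\<gamma> b = q" using assms unfolding joined_def by blast
  have "0 < b - a" using arc_less[OF *(1)] by simp
  then show thesis
    using arc_affine[OF *(1), of "b - a" a] * that[of "\<lambda>t. \<gamma> ((b - a) * t + a)"] by simp
qed

lemma riem_dist_joined: "riem_dist A g p q = Inf {L. joined p q L}"
proof -
  have "curve_length A g \<gamma> = L" if "arc 0 1 \<gamma> L" for \<gamma> L
  proof -
    have "speed {0..1} \<gamma> t = speed UNIV \<gamma> t" if "t \<in> box 0 1" for t
    proof -
      have "at t within {0..1} = at t" using that by (intro at_within_Icc_at) (auto simp: box_real)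
      then show ?thesis by (simp only: velocity_def)
    qed
    from has_integral_spike_interior[where g = "speed {0..1} \<gamma>", OF _ this] arc_has_integral[OF that]
    have "(speed {0..1} \<gamma> has_integral L) {0..1}" by (simp add: cbox_interval)
    then show ?thesis unfolding curve_length_def by (rule integral_unique)
  qed
  moreover have "piecewise_C1_curve A \<gamma> \<longleftrightarrow> (\<exists>L. arc 0 1 \<gamma> L)" for \<gamma>
  proof
    assume "piecewise_C1_curve A \<gamma>"
    then obtain S where "finite S" "{0, 1} \<subseteq> S" "S \<subseteq> {0..1}"
      "\<forall>u\<in>S. \<forall>v\<in>S. u < v \<and> {u<..<v} \<inter> S = {} \<longrightarrow> C1_curve_on A {u..v} \<gamma>"
      unfolding piecewise_C1_curve_def by blast
    then show "\<exists>L. arc 0 1 \<gamma> L" by (intro breakpoints_arc[of S]) auto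
  next
    assume "\<exists>L. arc 0 1 \<gamma> L"
    then show "piecewise_C1_curve A \<gamma>" unfolding piecewise_C1_curve_def using arc_breakpoints by blast
  qed
  ultimately have "{curve_length A g \<gamma> |\<gamma>. piecewise_C1_curve A \<gamma> \<and> \<gamma> 0 = p \<and> \<gamma> 1 = q} = {L. joined p q L}"
    using joined_unit_interval joinedI by (auto; metis)
  then show ?thesis unfolding riem_dist_def by simp
qed

lemma joined_nonneg: "joined p q L \<Longrightarrow> 0 \<le> L"
  unfolding joined_def using arc_length_nonneg by blast

lemma joined_sym: "joined p q L \<Longrightarrow> joined q p L"
proof -
  assume "joined p q L"
  then obtain a b \<gamma> where *: "arc a b \<gamma> L" "\<gamma> a = p" "\<gamma> b = q" unfolding joined_def by blast
  have "arc (- b) (- a) (\<lambda>t. \<gamma> (- t)) L"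
    using arc_affine[OF *(1), of "-1" 0] arc_less[OF *(1)] by simp
  from joinedI[OF this] show "joined q p L" using * by simp
qed

lemma joined_trans:
  assumes "joined p q L" "joined q r M"
  shows "joined p r (L + M)"
proof -
  obtain \<gamma> where 1: "arc 0 1 \<gamma> L" "\<gamma> 0 = p" "\<gamma> 1 = q" by (rule joined_unit_interval[OF assms(1)])
  obtain \<delta> where 2: "arc 0 1 \<delta> M" "\<delta> 0 = q" "\<delta> 1 = r" by (rule joined_unit_interval[OF assms(2)])
  let ?\<gamma> = "\<lambda>t. if t \<le> 1 then \<gamma> t else \<delta> (t - 1)"
  have "arc 0 1 ?\<gamma> L" by (rule arc_cong[OF 1(1)]) simp
  moreover have "arc 1 2 (\<lambda>t. \<delta> (t - 1)) M" using arc_affine[OF 2(1), of 1 "-1"] by simp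
  then have "arc 1 2 ?\<gamma> M" by (rule arc_cong) (use 1 2 in auto)
  ultimately have "arc 0 2 ?\<gamma> (L + M)" by (rule arc.join)
  from joinedI[OF this] show ?thesis using 1 2 by simp
qed

text \<open>The length travelled is a continuous function of the parameter and attains the value \<open>r\<close>. This is
  the property that makes the Riemannian distance a length metric.\<close>

lemma joined_split:
  assumes "joined p q L" "0 < r" "r < L"
  obtains z where "joined p z r" "joined z q (L - r)"
proof -
  obtain \<gamma> where \<gamma>: "arc 0 1 \<gamma> L" "\<gamma> 0 = p" "\<gamma> 1 = q" by (rule joined_unit_interval[OF assms(1)])
  let ?len = "\<lambda>t. integral {0..t} (speed UNIV \<gamma>)"
  have "continuous_on {0..1} ?len"
    by (rule indefinite_integral_continuous_1) (use arc_has_integral[OF \<gamma>(1)] in blast)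
  moreover have "?len 0 \<le> r" "r \<le> ?len 1" using assms arc_has_integral[OF \<gamma>(1)] by (auto simp: integral_unique)
  ultimately obtain t where t: "0 \<le> t" "t \<le> 1" "?len t = r" using IVT'[of ?len 0 r 1] by auto
  have "t \<noteq> 0" using t(3) assms(2) by auto
  moreover have "t \<noteq> 1" using t(3) assms(3) arc_has_integral[OF \<gamma>(1)] by (auto simp: integral_unique)
  ultimately have "0 < t" "t < 1" using t by auto
  then obtain L1 L2 where *: "arc 0 t \<gamma> L1" "arc t 1 \<gamma> L2" "L1 + L2 = L"
    using arc_restrict[OF \<gamma>(1)] by blast
  have "L1 = r" using arc_has_integral[OF *(1)] t(3) by (simp add: integral_unique)
  then show thesis using joinedI[OF *(1)] joinedI[OF *(2)] *(3) \<gamma> that[of "\<gamma> t"] by auto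
qed

end


section \<open>Bounded sets in a complete length space\<close>

text \<open>The Hopf-Rinow argument of Cohn-Vossen. If balls around \<open>x\<close> are totally bounded up to a finite
  supremal radius \<open>R\<close>, the ball of radius \<open>R\<close> is still totally bounded, since its points are
  arbitrarily close to smaller balls. Its closure is then compact by completeness, so it is covered by
  finitely many totally bounded balls, and these also cover a slightly larger ball.\<close>

lemma (in Metric_space) length_space_balls_totally_bounded:
  assumes complete: mcomplete
    and between: "\<And>x y r s. x \<in> M \<Longrightarrow> y \<in> M \<Longrightarrow> 0 < r \<Longrightarrow> 0 < s \<Longrightarrow> d x y < r + s \<Longrightarrow>
        \<exists>z\<in>M. d x z < r \<and> d z y < s"
    and local: "\<And>x. x \<in> M \<Longrightarrow> \<exists>e>0. mtotally_bounded (mball x e)"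
    and x: "x \<in> M"
  shows "mtotally_bounded (mball x B)"
proof (rule ccontr)
  assume notB: "\<not> mtotally_bounded (mball x B)"
  define T where "T = {r. 0 < r \<and> mtotally_bounded (mball x r)}"
  have bound: "r \<le> B" if "r \<in> T" for r
  proof (rule ccontr)
    assume "\<not> r \<le> B"
    then have "mball x B \<subseteq> mball x r" by (intro mball_subset_concentric) simp
    then show False using that notB mtotally_bounded_subset unfolding T_def by blast
  qed
  then have bdd: "bdd_above T" by (meson bdd_aboveI)
  obtain e where e: "0 < e" "mtotally_bounded (mball x e)" using local[OF x] by blast
  then have eT: "e \<in> T" by (simp add: T_def)
  define R where "R = Sup T"
  have R: "0 < R" using cSup_upper[OF eT bdd] e(1) by (simp add: R_def)
  have tbR: "mtotally_bounded (mball x R)"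
    unfolding mtotally_bounded_def
  proof (intro allI impI)
    fix \<epsilon> :: real assume \<epsilon>: "0 < \<epsilon>"
    obtain r where r: "r \<in> T" "R - \<epsilon> / 2 < r"
      using less_cSupD[of T "R - \<epsilon> / 2"] eT \<epsilon> unfolding R_def by auto
    have rR: "r \<le> R" unfolding R_def by (rule cSup_upper[OF r(1) bdd])
    have r0: "0 < r" "mtotally_bounded (mball x r)" using r(1) by (auto simp: T_def)
    have e2: "0 < \<epsilon> / 2" using \<epsilon> by simp
    from r0(2)[unfolded mtotally_bounded_def, rule_format, OF e2]
    obtain K where K: "finite K" "K \<subseteq> mball x r" "mball x r \<subseteq> (\<Union>k\<in>K. mball k (\<epsilon> / 2))" by blast
    have "y \<in> (\<Union>k\<in>K. mball k \<epsilon>)" if y: "y \<in> mball x R" for y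
    proof -
      have yM: "y \<in> M" "d x y < r + \<epsilon> / 2" using y r(2) by auto
      obtain z where z: "z \<in> M" "d x z < r" "d z y < \<epsilon> / 2" using between[OF x yM(1) r0(1) e2 yM(2)] by blast
      then have "z \<in> mball x r" using x by simp
      then obtain k where k: "k \<in> K" "z \<in> mball k (\<epsilon> / 2)" using K(3) by blast
      then have "d k y < \<epsilon>" using triangle[of k z y] z yM by auto
      then show ?thesis using k yM by auto
    qed
    moreover have "K \<subseteq> mball x R" using K(2) mball_subset_concentric[OF rR] by blast
    ultimately show "\<exists>K. finite K \<and> K \<subseteq> mball x R \<and> mball x R \<subseteq> (\<Union>k\<in>K. mball k \<epsilon>)"
      using K(1) by blast
  qed
  define C where "C = mtopology closure_of (mball x R)"
  have C: "compactin mtopology C"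
    using tbR mtotally_bounded_eq_compact_closure_of[OF complete] unfolding C_def by blast
  have CM: "C \<subseteq> M" using compactin_subset_topspace[OF C] by simp
  have ballC: "mball x R \<subseteq> C" unfolding C_def by (rule closure_of_subset) (auto simp: mball_subset_mspace)
  from local obtain \<rho> where \<rho>: "\<And>c. c \<in> M \<Longrightarrow> 0 < \<rho> c" "\<And>c. c \<in> M \<Longrightarrow> mtotally_bounded (mball c (\<rho> c))"
    by metis
  have "C \<subseteq> \<Union> ((\<lambda>c. mball c (\<rho> c / 2)) ` C)" using CM \<rho>(1) by fastforce
  then obtain \<F> where \<F>: "finite \<F>" "\<F> \<subseteq> (\<lambda>c. mball c (\<rho> c / 2)) ` C" "C \<subseteq> \<Union> \<F>"
    using C unfolding compactin_def by (metis (no_types, lifting) imageE openin_mball)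
  then obtain F where F: "finite F" "F \<subseteq> C" "C \<subseteq> (\<Union>c\<in>F. mball c (\<rho> c / 2))"
    using finite_subset_image[OF \<F>(1,2)] by blast
  define \<delta> where "\<delta> = Min (insert 1 ((\<lambda>c. \<rho> c / 2) ` F))"
  have "0 < \<delta>" unfolding \<delta>_def using F CM \<rho>(1) by (auto simp: subset_iff)
  moreover have "\<delta> \<le> \<rho> c / 2" if "c \<in> F" for c
    unfolding \<delta>_def using F(1) that by (intro Min_le) auto
  ultimately have \<delta>: "0 < \<delta>" "\<And>c. c \<in> F \<Longrightarrow> \<delta> \<le> \<rho> c / 2" by auto
  have "mball x (R + \<delta>) \<subseteq> (\<Union>c\<in>F. mball c (\<rho> c))"
  proof
    fix y assume "y \<in> mball x (R + \<delta>)"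
    then have y: "y \<in> M" "d x y < R + \<delta>" by auto
    obtain z where z: "z \<in> M" "d x z < R" "d z y < \<delta>" using between[OF x y(1) R \<delta>(1) y(2)] by blast
    then have "z \<in> C" using ballC x by auto
    then obtain c where c: "c \<in> F" "z \<in> mball c (\<rho> c / 2)" using F(3) by blast
    then have "d c y < \<rho> c" using triangle[of c z y] z y \<delta>(2)[OF c(1)] by auto
    then show "y \<in> (\<Union>c\<in>F. mball c (\<rho> c))" using c y by auto
  qed
  moreover have "mtotally_bounded (\<Union>c\<in>F. mball c (\<rho> c))"
    using F CM \<rho>(2) by (intro mtotally_bounded_Union) auto
  ultimately have "R + \<delta> \<in> T"
    using mtotally_bounded_subset R \<delta>(1) unfolding T_def by auto
  then have "R + \<delta> \<le> R" using cSup_upper[OF _ bdd] unfolding R_def by blast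
  then show False using \<delta>(1) by simp
qed


section \<open>The Riemannian distance\<close>

context riemannian
begin

text \<open>The constants are kept explicit because they convert between coordinate and Riemannian distances:
  \<open>m\<close> bounds the length of curves that leave the ball from below, \<open>N\<close> the length of coordinate segments
  from above.\<close>

definition comparison_ball :: "('a, 'm) chart \<Rightarrow> 'a \<Rightarrow> real \<Rightarrow> real \<Rightarrow> real \<Rightarrow> bool" where
  "comparison_ball c p r m N \<longleftrightarrow> c \<in> charts_at A p \<and> 0 < r \<and> ball (cmap c p) r \<subseteq> crange c \<and> 0 < m \<and> 0 < N \<and>
     (\<forall>z\<in>ball (cmap c p) r. \<forall>a. m * norm a \<le> sqrt (gform c z a a) \<and> sqrt (gform c z a a) \<le> N * norm a)"

lemma comparison_ball_exists: obtains c r m N where "comparison_ball c p r m N"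
proof -
  obtain c where c: "c \<in> charts_at A p" by (rule chart_exists)
  obtain m N where m: "0 < m" "0 < N" "\<forall>\<^sub>F z in nhds (cmap c p). z \<in> crange c \<and>
      (\<forall>a. m * (norm a)\<^sup>2 \<le> gform c z a a \<and> gform c z a a \<le> N * (norm a)\<^sup>2)"
    by (rule metric_comparable[OF c])
  then obtain r where r: "0 < r" "\<And>z. dist z (cmap c p) < r \<Longrightarrow> z \<in> crange c \<and>
      (\<forall>a. m * (norm a)\<^sup>2 \<le> gform c z a a \<and> gform c z a a \<le> N * (norm a)\<^sup>2)"
    unfolding eventually_nhds_metric by auto
  have "sqrt m * norm a \<le> sqrt (gform c z a a) \<and> sqrt (gform c z a a) \<le> sqrt N * norm a"
    if "z \<in> ball (cmap c p) r" for z a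
  proof -
    have "sqrt (m * (norm a)\<^sup>2) \<le> sqrt (gform c z a a)" "sqrt (gform c z a a) \<le> sqrt (N * (norm a)\<^sup>2)"
      using r(2)[of z] that by (simp_all add: dist_commute)
    then show ?thesis by (simp add: real_sqrt_mult)
  qed
  moreover have "ball (cmap c p) r \<subseteq> crange c" using r(2) by (auto simp: dist_commute)
  ultimately have "comparison_ball c p r (sqrt m) (sqrt N)"
    unfolding comparison_ball_def using c m r(1) by simp
  then show thesis by (rule that)
qed

lemma comparison_ball_mono:
  "comparison_ball c p r m N \<Longrightarrow> 0 < r' \<Longrightarrow> r' \<le> r \<Longrightarrow> comparison_ball c p r' m N"
  unfolding comparison_ball_def using subset_ball[of r' r "cmap c p"] by blast

lemma chart_ball:
  assumes "comparison_ball c p r m N"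
  shows "open (cinv c ` ball (cmap c p) r)" "p \<in> cinv c ` ball (cmap c p) r"
    "cinv c ` ball (cmap c p) r \<subseteq> cdom c"
    "q \<in> cinv c ` ball (cmap c p) r \<longleftrightarrow> q \<in> cdom c \<and> cmap c q \<in> ball (cmap c p) r"
proof -
  have c: "c \<in> charts_at A p" "0 < r" "ball (cmap c p) r \<subseteq> crange c"
    using assms by (auto simp: comparison_ball_def)
  note cA = chart_atD[OF c(1)]
  have iff: "q \<in> cinv c ` ball (cmap c p) r \<longleftrightarrow> q \<in> cdom c \<and> cmap c q \<in> ball (cmap c p) r" for q
  proof
    assume "q \<in> cinv c ` ball (cmap c p) r"
    then obtain y where y: "y \<in> ball (cmap c p) r" "q = cinv c y" by blast
    then show "q \<in> cdom c \<and> cmap c q \<in> ball (cmap c p) r"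
      using cinv_chart[OF cA(1), of y] c(3) by (auto simp: subset_iff)
  next
    assume q: "q \<in> cdom c \<and> cmap c q \<in> ball (cmap c p) r"
    then have "cinv c (cmap c q) = q" using chart_atD(4)[of c q] cA(1) by (simp add: charts_at_iff)
    with q show "q \<in> cinv c ` ball (cmap c p) r" by (metis imageI)
  qed
  then show "q \<in> cinv c ` ball (cmap c p) r \<longleftrightarrow> q \<in> cdom c \<and> cmap c q \<in> ball (cmap c p) r" .
  show "p \<in> cinv c ` ball (cmap c p) r" unfolding iff using cA c(2) by simp
  show "cinv c ` ball (cmap c p) r \<subseteq> cdom c" using iff by blast
  have "cinv c ` ball (cmap c p) r = cmap c -` ball (cmap c p) r \<inter> cdom c" using iff by blast
  then show "open (cinv c ` ball (cmap c p) r)"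
    using iffD1[OF continuous_on_open_vimage[OF chart_domain(1)[OF cA(1)]] chart_domain(3)[OF cA(1)]]
    by (simp only: open_ball)
qed

text \<open>A curve that stays in a chart is at least as long as its coordinate displacement.\<close>

lemma arc_chart_displacement:
  assumes "arc a b \<gamma> L" and c: "c \<in> A" and m: "0 < m"
    and "\<And>t. t \<in> {a..b} \<Longrightarrow> \<gamma> t \<in> cdom c \<and> (\<forall>v. m * norm v \<le> sqrt (gform c (cmap c (\<gamma> t)) v v))"
  shows "m * norm (cmap c (\<gamma> b) - cmap c (\<gamma> a)) \<le> L"
  using assms(1,4)
proof (induction rule: arc.induct)
  case (piece a b \<gamma>)
  let ?V = "\<lambda>t. velocity A {a..b} \<gamma> t c"
  have at: "c \<in> charts_at A (\<gamma> t)" if "t \<in> {a..b}" for t using piece(3)[OF that] c by (simp add: charts_at_iff)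
  have "((cmap c \<circ> \<gamma>) has_vector_derivative ?V t) (at t within {a..b})" if "t \<in> {a..b}" for t
    by (rule velocity_component[OF at[OF that] C1_curveD(2)[OF piece(2) that at[OF that]]])
  from fundamental_theorem_of_calculus[OF less_imp_le[OF piece(1)] this]
  have V: "(?V has_integral ((cmap c \<circ> \<gamma>) b - (cmap c \<circ> \<gamma>) a)) {a..b}" .
  then have mV: "((\<lambda>t. m *\<^sub>R ?V t) has_integral m *\<^sub>R ((cmap c \<circ> \<gamma>) b - (cmap c \<circ> \<gamma>) a)) {a..b}"
    by (rule has_integral_cmul)
  have "norm (integral {a..b} (\<lambda>t. m *\<^sub>R ?V t)) \<le> integral {a..b} (speed {a..b} \<gamma>)"
  proof (rule Henstock_Kurzweil_Integration.integral_norm_bound_integral)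
    show "(\<lambda>t. m *\<^sub>R ?V t) integrable_on {a..b}" using mV by blast
    show "speed {a..b} \<gamma> integrable_on {a..b}" using C1_speed_has_integral[OF piece(2,1)] by blast
    fix t assume t: "t \<in> {a..b}"
    show "norm (m *\<^sub>R ?V t) \<le> speed {a..b} \<gamma> t"
      unfolding rnorm_components[OF C1_velocity_tangent[OF piece(2,1) t] at[OF t]]
      using piece(3)[OF t] m by simp
  qed
  then show ?case using m unfolding integral_unique[OF mV] by simp
next
  case (join a b \<gamma> L d M)
  have lt: "a < b" "b < d" using arc_less[OF join.hyps(1)] arc_less[OF join.hyps(2)] .
  have "m * norm (cmap c (\<gamma> b) - cmap c (\<gamma> a)) \<le> L" "m * norm (cmap c (\<gamma> d) - cmap c (\<gamma> b)) \<le> M"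
    using lt by (auto intro!: join.IH join.prems)
  moreover have "m * norm (cmap c (\<gamma> d) - cmap c (\<gamma> a))
      \<le> m * (norm (cmap c (\<gamma> d) - cmap c (\<gamma> b)) + norm (cmap c (\<gamma> b) - cmap c (\<gamma> a)))"
    using m norm_triangle_ineq[of "cmap c (\<gamma> d) - cmap c (\<gamma> b)" "cmap c (\<gamma> b) - cmap c (\<gamma> a)"]
    by (intro mult_left_mono) auto
  ultimately show ?case by (simp add: distrib_left)
qed

text \<open>If the curve were shorter than \<open>m * r\<close>, then up to its first exit from the open ball it would stay, by
  the displacement estimate, in a smaller closed ball; being compact, this contains the exit point too.\<close>

lemma joined_leaves_ball:
  assumes C: "comparison_ball c p r m N" and J: "joined p q L"
    and q: "q \<notin> cinv c ` ball (cmap c p) r"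
  shows "m * r \<le> L"
proof (rule ccontr)
  assume "\<not> m * r \<le> L"
  then have L: "L < m * r" by simp
  have c: "c \<in> charts_at A p" "0 < r" "ball (cmap c p) r \<subseteq> crange c" "0 < m"
    "\<And>z a. z \<in> ball (cmap c p) r \<Longrightarrow> m * norm a \<le> sqrt (gform c z a a)"
    using C by (auto simp: comparison_ball_def)
  note cA = chart_atD[OF c(1)]
  let ?W = "cinv c ` ball (cmap c p) r"
  obtain \<gamma> where \<gamma>: "arc 0 1 \<gamma> L" "\<gamma> 0 = p" "\<gamma> 1 = q" by (rule joined_unit_interval[OF J])
  note cont = arc_continuous[OF \<gamma>(1)]
  define \<rho> where "\<rho> = L / m"
  have \<rho>: "\<rho> < r" using L c(4) by (simp add: \<rho>_def field_simps)
  then have sub: "cball (cmap c p) \<rho> \<subseteq> ball (cmap c p) r" by auto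
  let ?K = "cinv c ` cball (cmap c p) \<rho>"
  have "compact ?K"
    using sub c(3) by (intro compact_continuous_image continuous_on_subset[OF chart_domain(4)[OF cA(1)]]) auto
  then have K: "closed ?K" "?K \<subseteq> ?W" using compact_imp_closed sub by auto
  let ?Z = "{0..1} \<inter> \<gamma> -` (- ?W)"
  have "closed (- ?W)" using chart_ball(1)[OF C] by (simp add: closed_Compl)
  then have Z: "closed ?Z" by (intro continuous_closed_preimage cont closed_atLeastAtMost)
  have "1 \<in> ?Z" using \<gamma>(3) q by simp
  then have ne: "?Z \<noteq> {}" by blast
  have bdd: "bdd_below ?Z" by (rule bdd_belowI[of _ 0]) simp
  define s where "s = Inf ?Z"
  have s: "s \<in> ?Z" unfolding s_def by (rule closed_contains_Inf[OF ne bdd Z])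
  have before: "\<gamma> t \<in> ?W" if "0 \<le> t" "t < s" for t
  proof (rule ccontr)
    assume "\<gamma> t \<notin> ?W"
    then have "t \<in> ?Z" using that s by auto
    then have "s \<le> t" unfolding s_def by (rule cInf_lower[OF _ bdd])
    then show False using that by simp
  qed
  have "s \<noteq> 0" using s \<gamma>(2) chart_ball(2)[OF C] by auto
  then have s01: "0 < s" "s \<le> 1" using s by auto
  have inK: "\<gamma> t \<in> ?K" if t: "0 < t" "t < s" for t
  proof -
    obtain L1 L2 where *: "arc 0 t \<gamma> L1" "arc t 1 \<gamma> L2" "L1 + L2 = L"
      using arc_restrict[OF \<gamma>(1), of t] t s01 by auto
    have "m * norm (cmap c (\<gamma> t) - cmap c (\<gamma> 0)) \<le> L1"
    proof (rule arc_chart_displacement[OF *(1) cA(1) c(4)])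
      fix u assume "u \<in> {0..t}"
      then have "\<gamma> u \<in> ?W" using before t by auto
      then have "\<gamma> u \<in> cdom c \<and> cmap c (\<gamma> u) \<in> ball (cmap c p) r" unfolding chart_ball(4)[OF C] .
      with c(5) show "\<gamma> u \<in> cdom c \<and> (\<forall>v. m * norm v \<le> sqrt (gform c (cmap c (\<gamma> u)) v v))" by blast
    qed
    also have "L1 \<le> L" using arc_length_nonneg[OF *(2)] *(3) by simp
    finally have "norm (cmap c (\<gamma> t) - cmap c p) \<le> \<rho>"
      using c(4) \<gamma>(2) by (simp add: \<rho>_def pos_le_divide_eq mult.commute)
    moreover have "\<gamma> t \<in> cdom c" using before[of t] t chart_ball(3)[OF C] by auto
    then have "cinv c (cmap c (\<gamma> t)) = \<gamma> t" using chart_atD(4)[of c "\<gamma> t"] cA(1) by (simp add: charts_at_iff)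
    ultimately show ?thesis by (intro image_eqI[of _ _ "cmap c (\<gamma> t)"]) (auto simp: dist_norm norm_minus_commute)
  qed
  have "closed ({0..1} \<inter> \<gamma> -` ?K)" by (intro continuous_closed_preimage cont K closed_atLeastAtMost)
  moreover have "{0<..<s} \<subseteq> {0..1} \<inter> \<gamma> -` ?K" using inK s01 by auto
  ultimately have "closure {0<..<s} \<subseteq> {0..1} \<inter> \<gamma> -` ?K" by (rule closure_minimal[rotated])
  then have "\<gamma> s \<in> ?K" using s01 by (auto simp: subset_iff)
  then show False using s K(2) by auto
qed

text \<open>The coordinate segment is the witness; the open ball is convex, so the segment stays inside.\<close>

lemma joined_segment:
  assumes C: "comparison_ball c p r m N" and y: "y1 \<in> ball (cmap c p) r" "y2 \<in> ball (cmap c p) r"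
  shows "\<exists>L\<le>N * norm (y2 - y1). joined (cinv c y1) (cinv c y2) L"
proof -
  have c: "c \<in> charts_at A p" "ball (cmap c p) r \<subseteq> crange c"
    "\<And>z a. z \<in> ball (cmap c p) r \<Longrightarrow> sqrt (gform c z a a) \<le> N * norm a"
    using C by (auto simp: comparison_ball_def)
  note cA = chart_atD[OF c(1)]
  let ?w = "y2 - y1"
  let ?l = "\<lambda>t. y1 + t *\<^sub>R ?w" and ?I = "{0..1::real}"
  let ?\<gamma> = "\<lambda>t. cinv c (?l t)"
  have l: "?l t \<in> ball (cmap c p) r" if "t \<in> ?I" for t
    using convexD_alt[OF convex_ball y, of t] that by (simp add: algebra_simps)
  have at: "c \<in> charts_at A (?\<gamma> t)" "cmap c (?\<gamma> t) = ?l t" if "t \<in> ?I" for t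
    using cinv_chart(1,2)[OF cA(1) subsetD[OF c(2) l[OF that]]] .
  have cont: "continuous_on ?I ?\<gamma>"
    using l c(2) by (intro continuous_on_compose2[OF chart_domain(4)[OF cA(1)]] continuous_intros) auto
  have line: "((cmap c \<circ> ?\<gamma>) has_vector_derivative ?w) (at t within ?I)" if t: "t \<in> ?I" for t
  proof -
    have "(?l has_vector_derivative ?w) (at t within ?I)" by (auto intro!: derivative_eq_intros)
    then show ?thesis by (rule has_vector_derivative_transform[OF t, rotated]) (simp add: at)
  qed
  let ?D = "\<lambda>c' z. frechet_derivative (cmap c' \<circ> cinv c) (at z) ?w"
  have vd: "((cmap c' \<circ> ?\<gamma>) has_vector_derivative ?D c' (?l t)) (at t within ?I)"
    if t: "t \<in> ?I" and c': "c' \<in> charts_at A (?\<gamma> t)" for t c'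
    using chart_change_has_vector_derivative[OF cont t at(1)[OF t] c' line[OF t]] unfolding at(2)[OF t] .
  have vd_eq: "vector_derivative (cmap c' \<circ> ?\<gamma>) (at t within ?I) = ?D c' (?l t)"
    if "t \<in> ?I" "c' \<in> charts_at A (?\<gamma> t)" for t c'
    by (rule vector_derivative_within_closed_interval[OF zero_less_one that(1) vd[OF that]])
  have C1: "C1_curve_on A ?I ?\<gamma>"
    unfolding C1_curve_on_def
  proof (intro conjI ballI)
    show "continuous_on ?I ?\<gamma>" by (rule cont)
    fix t c' assume t: "t \<in> ?I" and c': "c' \<in> charts_at A (?\<gamma> t)"
    show "(cmap c' \<circ> ?\<gamma>) differentiable (at t within ?I)" using vd[OF t c'] by (rule differentiableI_vector)
    note S = transition_domain[OF at(1)[OF t] c', unfolded at(2)[OF t]]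
    have "(?D c' \<longlongrightarrow> ?D c' (?l t)) (nhds (?l t))"
      by (rule tendsto_nhds_of_smooth[OF smooth_on_frechet_derivative[OF S(3)] S(2)])
    moreover have "(?l \<longlongrightarrow> ?l t) (at t within ?I)" by (intro tendsto_intros)
    ultimately have "((\<lambda>\<tau>. ?D c' (?l \<tau>)) \<longlongrightarrow> ?D c' (?l t)) (at t within ?I)" by (rule filterlim_compose)
    moreover have "\<forall>\<^sub>F \<tau> in at t within ?I. ?D c' (?l \<tau>) = vector_derivative (cmap c' \<circ> ?\<gamma>) (at \<tau> within ?I)"
      using eventually_in_chart[OF cont t c'] by (rule eventually_mono) (simp add: vd_eq)
    ultimately show "continuous (at t within ?I) (\<lambda>\<tau>. vector_derivative (cmap c' \<circ> ?\<gamma>) (at \<tau> within ?I))"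
      unfolding continuous_within vd_eq[OF t c'] using tendsto_cong by force
  qed
  have le: "speed ?I ?\<gamma> t \<le> N * norm ?w" if t: "t \<in> ?I" for t
  proof -
    have "velocity A ?I ?\<gamma> t c = ?w"
      using vector_derivative_within_closed_interval[OF zero_less_one t line[OF t]] at(1)[OF t]
      by (simp add: velocity_def)
    then show ?thesis
      unfolding rnorm_components[OF C1_velocity_tangent[OF C1 zero_less_one t] at(1)[OF t]] at(2)[OF t]
      using c(3)[OF l[OF t]] by simp
  qed
  have "((\<lambda>_. N * norm ?w) has_integral (1 - 0) *\<^sub>R (N * norm ?w)) ?I"
    using has_integral_const_real[of "N * norm ?w" 0 1] by simp
  from has_integral_le[OF C1_speed_has_integral[OF C1 zero_less_one] this le]
  have "integral ?I (speed ?I ?\<gamma>) \<le> N * norm ?w" by simp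
  moreover have "joined (cinv c y1) (cinv c y2) (integral ?I (speed ?I ?\<gamma>))"
    using joinedI[OF arc.piece[OF zero_less_one C1]] by simp
  ultimately show ?thesis by blast
qed

lemma joined_near:
  assumes C: "comparison_ball c p r m N"
    and q: "q1 \<in> cinv c ` ball (cmap c p) r" "q2 \<in> cinv c ` ball (cmap c p) r"
  shows "\<exists>L\<le>N * norm (cmap c q2 - cmap c q1). joined q1 q2 L"
proof -
  have "cinv c (cmap c q) = q" if "q \<in> cinv c ` ball (cmap c p) r" for q
    using that C chart_atD(4)[of c q] chart_atD(1)[of c p] chart_ball(4)[OF C, of q]
    unfolding comparison_ball_def by (simp add: charts_at_iff)
  then show ?thesis using joined_segment[OF C, of "cmap c q1" "cmap c q2"] q chart_ball(4)[OF C] by metis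
qed

lemma joined_refl: "joined p p 0"
proof -
  obtain c r m N where C: "comparison_ball c p r m N" by (rule comparison_ball_exists)
  obtain L where "L \<le> 0" "joined p p L" using joined_near[OF C chart_ball(2)[OF C] chart_ball(2)[OF C]] by auto
  then show ?thesis using joined_nonneg by (metis order_antisym)
qed

end

locale connected_riemannian = riemannian A g
  for A :: "('a::{t2_space,second_countable_topology}, 'm::finite) chart set" and g :: "('a, 'm) rmetric" +
  assumes connected: "connected (UNIV :: 'a set)"
begin

text \<open>The points that can be reached from \<open>p\<close> form an open set with open complement, since nearby points are
  joined by coordinate segments.\<close>

lemma joined_exists: obtains L where "joined p q L"
proof -
  let ?R = "{q. \<exists>L. joined p q L}"
  have near: "\<exists>W. open W \<and> q \<in> W \<and> (\<forall>q'\<in>W. \<exists>L. joined q q' L)" for q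
  proof -
    obtain c r m N where C: "comparison_ball c q r m N" by (rule comparison_ball_exists)
    have "\<exists>L. joined q q' L" if "q' \<in> cinv c ` ball (cmap c q) r" for q'
      using joined_near[OF C chart_ball(2)[OF C] that] by blast
    then show ?thesis using chart_ball(1,2)[OF C] by (intro exI[of _ "cinv c ` ball (cmap c q) r"]) blast
  qed
  have op: "open ?R"
    unfolding open_subopen[of ?R]
  proof
    fix q assume "q \<in> ?R"
    then obtain L where L: "joined p q L" by blast
    obtain W where W: "open W" "q \<in> W" "\<forall>q'\<in>W. \<exists>L. joined q q' L" using near[of q] by blast
    have "q' \<in> ?R" if q': "q' \<in> W" for q'
    proof -
      obtain M where "joined q q' M" using W(3) q' by blast
      from joined_trans[OF L this] show ?thesis by blast
    qed
    with W show "\<exists>T. open T \<and> q \<in> T \<and> T \<subseteq> ?R" by blast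
  qed
  have "open (- ?R)"
    unfolding open_subopen[of "- ?R"]
  proof
    fix q assume q: "q \<in> - ?R"
    obtain W where W: "open W" "q \<in> W" "\<forall>q'\<in>W. \<exists>L. joined q q' L" using near[of q] by blast
    have "q' \<in> - ?R" if q': "q' \<in> W" for q'
    proof
      assume "q' \<in> ?R"
      then obtain L where L: "joined p q' L" by blast
      obtain M where "joined q q' M" using W(3) q' by blast
      from joined_trans[OF L joined_sym[OF this]] show False using q by blast
    qed
    with W show "\<exists>T. open T \<and> q \<in> T \<and> T \<subseteq> - ?R" by blast
  qed
  then have "closed ?R" by (simp add: closed_def)
  with op have "?R = {} \<or> ?R = UNIV" by (intro connected[unfolded connected_clopen, rule_format] conjI) auto
  moreover have "p \<in> ?R" using joined_refl[of p] by blast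
  ultimately have "q \<in> ?R" by blast
  then obtain L where "joined p q L" by blast
  then show thesis by (rule that)
qed

abbreviation dist_R :: "'a \<Rightarrow> 'a \<Rightarrow> real" where "dist_R \<equiv> riem_dist A g"

lemma dist_le: "joined p q L \<Longrightarrow> dist_R p q \<le> L"
  unfolding riem_dist_joined by (rule cInf_lower) (auto intro!: bdd_belowI[of _ 0] joined_nonneg)

lemma dist_greatest: "(\<And>L. joined p q L \<Longrightarrow> b \<le> L) \<Longrightarrow> b \<le> dist_R p q"
  unfolding riem_dist_joined by (rule cInf_greatest) (use joined_exists[of p q] in auto)

lemma dist_approx:
  assumes "dist_R p q < b" obtains L where "joined p q L" "L < b"
proof -
  have "\<exists>L\<in>{L. joined p q L}. L < b"
    using assms unfolding riem_dist_joined by (intro cInf_lessD) (use joined_exists[of p q] in auto)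
  then show thesis using that by blast
qed

lemma dist_leaves_ball:
  "comparison_ball c p r m N \<Longrightarrow> dist_R p q < m * r \<Longrightarrow> q \<in> cinv c ` ball (cmap c p) r"
  using dist_greatest[of p q "m * r"] joined_leaves_ball by fastforce

text \<open>Leaving a ball in a chart has a positive cost in length. Consequently the metric topology of the
  Riemannian distance is at least as fine as the manifold topology, and its compact sets are compact
  in the manifold; the distance also separates points.\<close>

lemma open_contains_metric_ball:
  assumes "open W" "p \<in> W"
  obtains e where "0 < e" "\<And>q. dist_R p q < e \<Longrightarrow> q \<in> W"
proof -
  obtain c r m N where C: "comparison_ball c p r m N" by (rule comparison_ball_exists)
  then have c: "c \<in> charts_at A p" "0 < r" "ball (cmap c p) r \<subseteq> crange c" "0 < m"
    by (auto simp: comparison_ball_def)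
  note cA = chart_atD[OF c(1)]
  have "open (cinv c -` W \<inter> crange c)"
    using continuous_on_open_vimage[OF chart_domain(2)[OF cA(1)]] chart_domain(4)[OF cA(1)] assms(1) by blast
  moreover have "cmap c p \<in> cinv c -` W \<inter> crange c" using cA assms(2) by simp
  ultimately obtain r0 where r0: "0 < r0" "ball (cmap c p) r0 \<subseteq> cinv c -` W \<inter> crange c"
    using open_contains_ball by blast
  define r1 where "r1 = min r r0"
  have C1: "comparison_ball c p r1 m N" by (rule comparison_ball_mono[OF C]) (use c r0 in \<open>auto simp: r1_def\<close>)
  have "q \<in> W" if "dist_R p q < m * r1" for q
    using dist_leaves_ball[OF C1 that] r0(2) by (auto simp: r1_def subset_iff)
  moreover have "0 < m * r1" using c r0 by (simp add: r1_def)
  ultimately show thesis using that by blast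
qed

lemma dist_metric: "Metric_space UNIV dist_R"
proof
  show nonneg: "0 \<le> dist_R p q" for p q by (rule dist_greatest) (rule joined_nonneg)
  show "dist_R p q = dist_R q p" for p q
    unfolding riem_dist_joined by (rule arg_cong[where f = Inf]) (auto intro: joined_sym)
  show "dist_R p q = 0 \<longleftrightarrow> p = q" for p q
  proof
    assume 0: "dist_R p q = 0"
    show "p = q"
    proof (rule ccontr)
      assume "p \<noteq> q"
      obtain e where "0 < e" "\<And>q'. dist_R p q' < e \<Longrightarrow> q' \<in> - {q}"
        using open_contains_metric_ball[of "- {q}" p] \<open>p \<noteq> q\<close> by auto
      then show False using 0 by force
    qed
  next
    assume "p = q"
    then show "dist_R p q = 0" using dist_le[OF joined_refl[of p]] nonneg[of p q] by simp
  qed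
  show "dist_R p r \<le> dist_R p q + dist_R q r" for p q r
  proof (rule field_le_epsilon)
    fix e :: real assume e: "0 < e"
    obtain L where L: "joined p q L" "L < dist_R p q + e / 2" using dist_approx[of p q "dist_R p q + e / 2"] e by auto
    obtain M where M: "joined q r M" "M < dist_R q r + e / 2" using dist_approx[of q r "dist_R q r + e / 2"] e by auto
    show "dist_R p r \<le> dist_R p q + dist_R q r + e" using dist_le[OF joined_trans[OF L(1) M(1)]] L(2) M(2) by simp
  qed
qed

lemma dist_between:
  assumes "0 < r" "0 < s" "dist_R p q < r + s"
  shows "\<exists>z. dist_R p z < r \<and> dist_R z q < s"
proof -
  obtain L where L: "joined p q L" "L < r + s" by (rule dist_approx[OF assms(3)])
  consider "L < s" | "L < r" | "s \<le> L" "r \<le> L" by linarith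
  then show ?thesis
  proof cases
    case 1
    then show ?thesis using dist_le[OF joined_refl[of p]] dist_le[OF L(1)] assms by (intro exI[of _ p]) auto
  next
    case 2
    then show ?thesis using dist_le[OF joined_refl[of q]] dist_le[OF L(1)] assms by (intro exI[of _ q]) auto
  next
    case 3
    \<comment> \<open>The midpoint of the interval of admissible lengths, which lies between \<open>L - s\<close> and \<open>r\<close>.\<close>
    define t where "t = (L - s + r) / 2"
    have t: "0 < t" "t < L" "t < r" "L - t < s" using 3 assms L(2) by (auto simp: t_def field_simps)
    obtain z where "joined p z t" "joined z q (L - t)" by (rule joined_split[OF L(1) t(1,2)])
    then show ?thesis using dist_le t by (intro exI[of _ z]) fastforce
  qed
qed

interpretation R: Metric_space UNIV dist_R by (rule dist_metric)

text \<open>A closed coordinate ball is compact, and finite nets of it in the Euclidean metric are nets for the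
  Riemannian distance after rescaling by \<open>N\<close>.\<close>

lemma dist_locally_totally_bounded: "\<exists>e>0. R.mtotally_bounded (R.mball p e)"
proof -
  obtain c r m N where C: "comparison_ball c p r m N" by (rule comparison_ball_exists)
  then have c: "c \<in> charts_at A p" "0 < r" "ball (cmap c p) r \<subseteq> crange c" "0 < m" "0 < N"
    by (auto simp: comparison_ball_def)
  note cA = chart_atD[OF c(1)]
  let ?y = "cmap c p"
  let ?K = "cinv c ` cball ?y (r / 2)"
  have sub: "cball ?y (r / 2) \<subseteq> ball ?y r" using c(2) by auto
  have C2: "comparison_ball c p (r / 2) m N" by (rule comparison_ball_mono[OF C]) (use c in auto)
  have "R.mball p (m * (r / 2)) \<subseteq> ?K"
    using dist_leaves_ball[OF C2] by (force simp: R.mball_def)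
  moreover have "R.mtotally_bounded ?K"
    unfolding R.mtotally_bounded_def
  proof (intro allI impI)
    fix \<epsilon> :: real assume \<epsilon>: "0 < \<epsilon>"
    have "0 < \<epsilon> / N" using \<epsilon> c by simp
    then have cover: "cball ?y (r / 2) \<subseteq> (\<Union>z\<in>cball ?y (r / 2). ball z (\<epsilon> / N))" by force
    obtain F where F: "F \<subseteq> cball ?y (r / 2)" "finite F" "cball ?y (r / 2) \<subseteq> (\<Union>z\<in>F. ball z (\<epsilon> / N))"
      by (rule compactE_image[OF compact_cball _ cover]) auto
    have "?K \<subseteq> (\<Union>k\<in>cinv c ` F. R.mball k \<epsilon>)"
    proof
      fix q assume "q \<in> ?K"
      then obtain z where z: "z \<in> cball ?y (r / 2)" "q = cinv c z" by blast
      then obtain k where k: "k \<in> F" "z \<in> ball k (\<epsilon> / N)" using F(3) by blast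
      obtain L where L: "L \<le> N * norm (z - k)" "joined (cinv c k) (cinv c z) L"
        using joined_segment[OF C, of k z] sub F(1) k(1) z(1) by blast
      have "N * norm (z - k) < N * (\<epsilon> / N)"
        using k(2) c(5) by (intro mult_strict_left_mono) (auto simp: dist_norm norm_minus_commute)
      then have "dist_R (cinv c k) q < \<epsilon>" using dist_le[OF L(2)] L(1) z(2) c(5) by simp
      then show "q \<in> (\<Union>k\<in>cinv c ` F. R.mball k \<epsilon>)" using k(1) by auto
    qed
    then show "\<exists>K. finite K \<and> K \<subseteq> ?K \<and> ?K \<subseteq> (\<Union>k\<in>K. R.mball k \<epsilon>)"
      using F by (intro exI[of _ "cinv c ` F"]) auto
  qed
  ultimately have "R.mtotally_bounded (R.mball p (m * (r / 2)))" using R.mtotally_bounded_subset by blast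
  then show ?thesis using c by (intro exI[of _ "m * (r / 2)"]) simp
qed

text \<open>The part of the Hopf-Rinow theorem that makes the maxima over \<open>closure D\<close> finite: total boundedness
  and completeness give compactness for the distance, which descends to the coarser topology.\<close>

lemma compact_closure_of_bounded:
  assumes complete: "Metric_space.mcomplete UNIV dist_R" and D: "Metric_space.mbounded UNIV dist_R D"
  shows "compact (closure D)"
proof -
  obtain p B where B: "D \<subseteq> R.mcball p B" using D unfolding R.mbounded_def by blast
  have "R.mtotally_bounded (R.mball p (B + 1))"
  proof (rule R.length_space_balls_totally_bounded[OF complete])
    show "\<exists>z\<in>UNIV. dist_R x z < r \<and> dist_R z y < s" if "0 < r" "0 < s" "dist_R x y < r + s" for x y r s
      using dist_between[OF that] by blast
  qed (use dist_locally_totally_bounded in auto)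
  then have C: "compactin R.mtopology (R.mtopology closure_of R.mball p (B + 1))" (is "compactin _ ?C")
    using R.mtotally_bounded_eq_compact_closure_of[OF complete] by blast
  have "compact ?C"
    unfolding compact_eq_Heine_Borel
  proof (intro allI impI)
    fix \<C> :: "'a set set" assume \<C>: "Ball \<C> open \<and> ?C \<subseteq> \<Union> \<C>"
    have op: "openin R.mtopology W" if W: "W \<in> \<C>" for W
      unfolding R.openin_mtopology
    proof (intro conjI allI impI subset_UNIV)
      fix q assume "q \<in> W"
      obtain e where "0 < e" "\<And>q'. dist_R q q' < e \<Longrightarrow> q' \<in> W"
        by (rule open_contains_metric_ball[OF _ \<open>q \<in> W\<close>]) (use \<C> W in blast)+
      then show "\<exists>r>0. R.mball q r \<subseteq> W" by (intro exI[of _ e]) auto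
    qed
    obtain \<D> where "finite \<D>" "\<D> \<subseteq> \<C>" "?C \<subseteq> \<Union> \<D>"
      using compactinD[OF C, of \<C>] op \<C> by blast
    then show "\<exists>\<D>\<subseteq>\<C>. finite \<D> \<and> ?C \<subseteq> \<Union> \<D>" by blast
  qed
  moreover have "D \<subseteq> ?C"
  proof -
    have "D \<subseteq> R.mball p (B + 1)" using B by (auto simp: subset_iff)
    also have "\<dots> \<subseteq> ?C" by (rule closure_of_subset) simp
    finally show ?thesis .
  qed
  then have "closure D \<subseteq> ?C" using compact_imp_closed[OF \<open>compact ?C\<close>] closure_minimal by blast
  ultimately show ?thesis
    using compact_Int_closed[of ?C "closure D"] by (simp add: Int_absorb1)
qed

end


section \<open>The scalar comparison argument\<close>

locale speed_comparison =
  fixes p q l :: real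
  assumes p: "0 \<le> p" and q: "0 < q" and l: "0 \<le> l"
begin

text \<open>The positive root of \<open>\<lambda>w. w\<^sup>2 - p * w - q\<^sup>2\<close>, the speed beyond which the potential is convex along a
  solution.\<close>

definition z0 :: real where "z0 = (p + sqrt (4 * q\<^sup>2 + p\<^sup>2)) / 2"

definition rate :: "real \<Rightarrow> real" where "rate w = (w\<^sup>2 - p * w - q\<^sup>2) / (l * w + 1)"

definition primitive :: "real \<Rightarrow> real" where "primitive z = integral {z0..z} rate"

lemma z0_pos: "0 < z0" "p \<le> z0"
proof -
  have "sqrt (p\<^sup>2) < sqrt (4 * q\<^sup>2 + p\<^sup>2)" using q by (intro real_sqrt_less_mono) simp
  then have "p < sqrt (4 * q\<^sup>2 + p\<^sup>2)" using p by simp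
  then show "0 < z0" "p \<le> z0" using p by (simp_all add: z0_def)
qed

lemma quadratic_factor: "w\<^sup>2 - p * w - q\<^sup>2 = (w - z0) * (w + z0 - p)"
proof -
  have "2 * z0 - p = sqrt (4 * q\<^sup>2 + p\<^sup>2)" by (simp add: z0_def field_simps)
  then have "(2 * z0 - p)\<^sup>2 = 4 * q\<^sup>2 + p\<^sup>2" by simp
  then have "z0 * z0 - p * z0 = q\<^sup>2" by (simp add: power2_eq_square algebra_simps)
  then show ?thesis by (simp add: power2_eq_square algebra_simps)
qed

lemma quadratic_pos: "z0 < w \<Longrightarrow> 0 < w\<^sup>2 - p * w - q\<^sup>2"
  unfolding quadratic_factor using z0_pos by (intro mult_pos_pos) auto

lemma denominator_pos: "z0 \<le> w \<Longrightarrow> 0 < l * w + 1"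
  using l z0_pos by (intro add_nonneg_pos mult_nonneg_nonneg) auto

lemma rate_pos: "z0 < w \<Longrightarrow> 0 < rate w"
  unfolding rate_def using quadratic_pos denominator_pos by (intro divide_pos_pos) auto

lemma rate_continuous: "continuous_on {z0..b} rate"
  unfolding rate_def using denominator_pos by (intro continuous_intros) force

lemma primitive_continuous: "continuous_on {z0..b} primitive"
  unfolding primitive_def by (intro indefinite_integral_continuous_1 integrable_continuous_real rate_continuous)

lemma primitive_z0: "primitive z0 = 0"
  by (simp add: primitive_def)

lemma primitive_has_derivative:
  assumes "z0 < w"
  shows "(primitive has_real_derivative rate w) (at w)"
proof -
  have "(primitive has_real_derivative rate w) (at w within {z0..w + 1})"
    unfolding primitive_def using assms by (intro integral_has_real_derivative rate_continuous) auto
  moreover have "at w within {z0..w + 1} = at w" using assms by (intro at_within_Icc_at) auto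
  ultimately show ?thesis by simp
qed

lemma primitive_strict_mono:
  assumes "z0 \<le> a" "a < b"
  shows "primitive a < primitive b"
proof (rule DERIV_pos_imp_increasing_open[OF assms(2)])
  show "\<exists>y. (primitive has_real_derivative y) (at x) \<and> 0 < y" if "a < x" "x < b" for x
    using primitive_has_derivative[of x] rate_pos[of x] assms that by force
  show "continuous_on {a..b} primitive"
    by (rule continuous_on_subset[OF primitive_continuous[of b]]) (use assms in auto)
qed

lemma primitive_nonneg: "z0 \<le> w \<Longrightarrow> 0 \<le> primitive w"
  using primitive_strict_mono[of z0 w] primitive_z0 by (cases "w = z0") auto

text \<open>Beyond \<open>z0 + 1\<close> the integrand stays above a positive constant, so the primitive is unbounded.\<close>

lemma primitive_linear_growth:
  assumes "z0 + 1 \<le> x"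
  shows "z0 / (l * z0 + 1) * (x - (z0 + 1)) \<le> primitive x"
proof -
  define k where "k = z0 / (l * z0 + 1)"
  have "primitive (z0 + 1) - k * (z0 + 1) \<le> primitive x - k * x"
  proof (rule DERIV_nonneg_imp_nondecreasing[OF assms])
    fix w assume w: "z0 + 1 \<le> w" "w \<le> x"
    have "k \<le> w / (l * w + 1)"
      unfolding k_def using denominator_pos[of z0] denominator_pos[of w] w by (simp add: divide_simps algebra_simps)
    also have "w \<le> w\<^sup>2 - p * w - q\<^sup>2"
      unfolding quadratic_factor using w z0_pos mult_mono[of 1 "w - z0" w "w + z0 - p"] by simp
    then have "w / (l * w + 1) \<le> rate w"
      unfolding rate_def using denominator_pos[of w] w by (intro divide_right_mono) auto
    finally have "k \<le> rate w" .
    moreover have "((\<lambda>x. primitive x - k * x) has_real_derivative rate w - k) (at w)"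
      by (intro DERIV_diff primitive_has_derivative DERIV_cmult_Id) (use w in auto)
    ultimately show "\<exists>y. ((\<lambda>x. primitive x - k * x) has_real_derivative y) (at w) \<and> 0 \<le> y"
      by (intro exI[of _ "rate w - k"]) simp
  qed
  moreover have "0 \<le> primitive (z0 + 1)" by (rule primitive_nonneg) simp
  ultimately show ?thesis unfolding k_def[symmetric] by (simp add: algebra_simps)
qed

lemma primitive_root:
  assumes C: "0 \<le> C"
  shows "\<exists>!z. z0 \<le> z \<and> primitive z = C"
proof (rule ex_ex1I)
  define k where "k = z0 / (l * z0 + 1)"
  have k: "0 < k" unfolding k_def using z0_pos denominator_pos[of z0] by simp
  define x where "x = z0 + 1 + C / k"
  have "0 \<le> C / k" using C k by (rule divide_nonneg_pos)
  then have x: "z0 + 1 \<le> x" unfolding x_def by linarith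
  have "k * (C / k) = C" using k by simp
  then have "C \<le> primitive x" using primitive_linear_growth[OF x, folded k_def] by (simp only: x_def add_diff_cancel_left')
  then show "\<exists>z. z0 \<le> z \<and> primitive z = C"
    using IVT'[of primitive z0 C x] primitive_z0 C x primitive_continuous[of x] by auto
next
  fix y z assume "z0 \<le> y \<and> primitive y = C" "z0 \<le> z \<and> primitive z = C"
  then show "y = z" using primitive_strict_mono[of y z] primitive_strict_mono[of z y] by (cases y z rule: linorder_cases) auto
qed

lemma primitive_le_root:
  assumes "z0 \<le> z" "primitive z = C" and "z0 < w \<Longrightarrow> primitive w \<le> C"
  shows "w \<le> z"
proof (rule ccontr)
  assume "\<not> w \<le> z"
  then show False using assms primitive_strict_mono[of z w] by simp
qed

end

text \<open>\<open>E\<close> is the square of the speed, \<open>u\<close> the value of the potential along the solution, \<open>h\<close> its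
  derivative; \<open>\<mu>\<close> and \<open>\<kappa>\<close> stand for the maximal force and the least Hessian eigenvalue.\<close>

locale speed_excursion = speed_comparison +
  fixes s Cf CU B :: real and E E' u h h' \<mu> \<kappa> :: "real \<Rightarrow> real"
  assumes E: "\<And>t. s \<le> t \<Longrightarrow> (E has_real_derivative E' t) (at t within {s..})" "\<And>t. s \<le> t \<Longrightarrow> 0 \<le> E t"
    and E': "\<And>t. s \<le> t \<Longrightarrow> \<bar>E' t\<bar> \<le> 2 * \<mu> t * (sqrt (E t) + l * (sqrt (E t))\<^sup>2)"
    and u: "\<And>t. s \<le> t \<Longrightarrow> (u has_real_derivative h t) (at t within {s..})" "\<And>t. s \<le> t \<Longrightarrow> \<bar>u t\<bar> \<le> B"
    and h: "\<And>t. s \<le> t \<Longrightarrow> (h has_real_derivative h' t) (at t within {s..})"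
      "\<And>t. s \<le> t \<Longrightarrow> \<bar>h t\<bar> \<le> CU * sqrt (E t)"
    and h': "\<And>t. s \<le> t \<Longrightarrow> \<kappa> t * ((sqrt (E t))\<^sup>2 - p * sqrt (E t) - q\<^sup>2) \<le> h' t"
    and \<kappa>: "\<And>t. s \<le> t \<Longrightarrow> 0 < \<kappa> t" and \<mu>: "\<And>t. s \<le> t \<Longrightarrow> \<mu> t \<le> Cf * \<kappa> t"
    and Cf: "0 \<le> Cf"
    and start: "sqrt (E s) \<le> z0"
begin

abbreviation v :: "real \<Rightarrow> real" where "v t \<equiv> sqrt (E t)"

lemma interior_derivative:
  assumes "(f has_real_derivative D) (at t within {s..})" "s < t"
  shows "(f has_real_derivative D) (at t)"
  using assms at_within_interior[of t "{s..}"] by simp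

lemma v_continuous: "continuous_on {s..} v"
proof -
  have "continuous_on {s..} E"
    using E(1) by (intro DERIV_continuous_on) auto
  then show ?thesis by (intro continuous_intros)
qed

lemma h_continuous: "continuous_on {s..} h"
  using h(1) by (intro DERIV_continuous_on) auto

text \<open>While the speed exceeds \<open>z0\<close>, its rate of change is controlled by the convexity of \<open>u\<close>, whatever
  the sign of that rate.\<close>

lemma excursion_estimate:
  assumes ab: "s \<le> a" "a \<le> b" and above: "\<And>t. a \<le> t \<Longrightarrow> t \<le> b \<Longrightarrow> z0 \<le> v t"
    and strict: "\<And>t. a < t \<Longrightarrow> t < b \<Longrightarrow> z0 < v t"
  shows "\<bar>primitive (v b) - primitive (v a)\<bar> \<le> Cf * (h b - h a)"
proof -
  have deriv: "\<exists>D. ((\<lambda>t. primitive (v t)) has_real_derivative D) (at t) \<and> \<bar>D\<bar> \<le> Cf * h' t"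
    if t: "a < t" "t < b" for t
  proof -
    have st: "s \<le> t" "s < t" using t ab by auto
    have vt: "z0 < v t" "0 < v t" using strict[OF t] z0_pos(1) by linarith+
    then have Et: "0 < E t" by simp
    let ?Q = "(v t)\<^sup>2 - p * v t - q\<^sup>2"
    have Q: "0 < ?Q" by (rule quadratic_pos[OF vt(1)])
    have "(v has_real_derivative E' t / (2 * v t)) (at t)"
      using interior_derivative[OF E(1)[OF st(1)] st(2)] Et
      by (auto intro!: derivative_eq_intros simp: field_simps)
    from DERIV_chain2[OF primitive_has_derivative[OF vt(1)] this]
    have D: "((\<lambda>t. primitive (v t)) has_real_derivative rate (v t) * (E' t / (2 * v t))) (at t)" .
    have den: "0 < l * v t + 1" using denominator_pos[of "v t"] vt(1) by simp
    have v2: "0 < 2 * v t" using vt(2) by linarith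
    have "\<bar>E' t / (2 * v t)\<bar> = \<bar>E' t\<bar> / (2 * v t)" by (simp only: abs_divide abs_of_pos[OF v2])
    also have "\<dots> \<le> 2 * \<mu> t * (v t + l * (v t)\<^sup>2) / (2 * v t)"
      by (rule divide_right_mono[OF E'[OF st(1)] less_imp_le[OF v2]])
    also have "\<dots> = \<mu> t * (l * v t + 1)" using vt(2) by (simp add: field_simps power2_eq_square)
    finally have "\<bar>rate (v t) * (E' t / (2 * v t))\<bar> \<le> rate (v t) * (\<mu> t * (l * v t + 1))"
      unfolding abs_mult using rate_pos[OF vt(1)] by (intro mult_mono) auto
    also have "\<dots> = ?Q * \<mu> t" using den by (simp add: rate_def)
    also have "\<dots> \<le> ?Q * (Cf * \<kappa> t)" using Q \<mu>[OF st(1)] by (intro mult_left_mono) auto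
    also have "\<dots> \<le> Cf * h' t" using h'[OF st(1)] Cf mult_left_mono[of "\<kappa> t * ?Q" "h' t" Cf] by (simp add: mult_ac)
    finally show ?thesis using D by blast
  qed
  have vcont: "continuous_on {a..b} v" by (rule continuous_on_subset[OF v_continuous]) (use ab in auto)
  have "bounded (v ` {a..b})"
    by (intro compact_imp_bounded compact_continuous_image vcont compact_Icc)
  then obtain N where "\<forall>x\<in>v ` {a..b}. norm x \<le> N" unfolding bounded_iff by blast
  then have N: "\<bar>v t\<bar> \<le> N" if "t \<in> {a..b}" for t using that by simp
  have pcont: "continuous_on {a..b} (\<lambda>t. primitive (v t))"
  proof (rule continuous_on_compose2[OF primitive_continuous[of N] vcont])
    show "v ` {a..b} \<subseteq> {z0..N}" using above N by fastforce
  qed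
  have hcont: "continuous_on {a..b} h" by (rule continuous_on_subset[OF h_continuous]) (use ab in auto)
  have hd: "((\<lambda>t. Cf * h t) has_real_derivative Cf * h' t) (at t)" if "a < t" "t < b" for t
    using h(1)[of t] interior_derivative[of h "h' t" t] that ab by (intro DERIV_cmult) auto
  have "Cf * h a + primitive (v a) \<le> Cf * h b + primitive (v b)"
  proof (rule DERIV_nonneg_imp_increasing_open[OF ab(2)])
    fix t assume t: "a < t" "t < b"
    obtain D where "((\<lambda>t. primitive (v t)) has_real_derivative D) (at t)" "\<bar>D\<bar> \<le> Cf * h' t" using deriv[OF t] by blast
    then show "\<exists>y. ((\<lambda>t. Cf * h t + primitive (v t)) has_real_derivative y) (at t) \<and> 0 \<le> y"
      using DERIV_add[OF hd[OF t]] by (intro exI[of _ "Cf * h' t + D"]) auto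
  qed (intro continuous_intros pcont hcont)
  moreover have "Cf * h a - primitive (v a) \<le> Cf * h b - primitive (v b)"
  proof (rule DERIV_nonneg_imp_increasing_open[OF ab(2)])
    fix t assume t: "a < t" "t < b"
    obtain D where "((\<lambda>t. primitive (v t)) has_real_derivative D) (at t)" "\<bar>D\<bar> \<le> Cf * h' t" using deriv[OF t] by blast
    then show "\<exists>y. ((\<lambda>t. Cf * h t - primitive (v t)) has_real_derivative y) (at t) \<and> 0 \<le> y"
      using DERIV_diff[OF hd[OF t]] by (intro exI[of _ "Cf * h' t - D"]) auto
  qed (intro continuous_intros pcont hcont)
  ultimately show ?thesis by (simp add: abs_le_iff algebra_simps)
qed

text \<open>The speed was \<open>z0\<close> before the excursion. If \<open>h\<close> is nonpositive now, the excursion up to now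
  consumed at most \<open>- h\<close> at its beginning. If \<open>h\<close> is positive now, the excursion has to end, as
  otherwise \<open>h\<close> would stay above a positive constant and \<open>u\<close> would be unbounded; the rest of the
  excursion then consumes at most \<open>h\<close> at its end. In both cases the speed at the relevant end point
  is \<open>z0\<close>; estimating \<open>h\<close> at the present instant would give a weaker bound.\<close>

lemma primitive_speed_bound:
  assumes t: "s \<le> t" and above: "z0 < v t"
  shows "primitive (v t) \<le> Cf * CU * z0"
proof -
  have hz: "Cf * \<bar>h r\<bar> \<le> Cf * CU * z0" if "s \<le> r" "v r = z0" for r
    using h(2)[OF that(1)] that(2) Cf mult_left_mono[of "\<bar>h r\<bar>" "CU * z0" Cf] by (simp add: mult.assoc)
  show ?thesis
  proof (cases "h t \<le> 0")
    case True
    let ?Z = "{s..t} \<inter> v -` {..z0}"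
    have "closed ?Z"
      by (intro continuous_closed_preimage continuous_on_subset[OF v_continuous]) (auto intro: closed_atMost)
    moreover have "s \<in> ?Z" using start t by simp
    then have ne: "?Z \<noteq> {}" by blast
    moreover have bdd: "bdd_above ?Z" by (rule bdd_aboveI[of _ t]) simp
    ultimately have a: "Sup ?Z \<in> ?Z" by (intro closed_contains_Sup)
    define a where "a = Sup ?Z"
    have a: "s \<le> a" "a \<le> t" "v a \<le> z0" using a by (auto simp: a_def)
    have after: "z0 < v r" if "a < r" "r \<le> t" for r
    proof (rule ccontr)
      assume "\<not> z0 < v r"
      then have "r \<in> ?Z" using that a by auto
      then have "r \<le> a" unfolding a_def by (rule cSup_upper[OF _ bdd])
      then show False using that by simp
    qed
    have "v a = z0"
    proof -
      obtain r where r: "a \<le> r" "r \<le> t" "v r = z0"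
        using IVT'[of v a z0 t] a above continuous_on_subset[OF v_continuous, of "{a..t}"] by auto
      then show ?thesis using after[of r] by (cases "a = r") auto
    qed
    then have "\<bar>primitive (v t) - primitive (v a)\<bar> \<le> Cf * (h t - h a)"
      using after a by (intro excursion_estimate) (auto simp: le_less)
    then have "primitive (v t) \<le> Cf * (h t - h a)" using \<open>v a = z0\<close> primitive_z0 by simp
    also have "\<dots> \<le> Cf * \<bar>h a\<bar>" using True Cf by (intro mult_left_mono) auto
    also have "\<dots> \<le> Cf * CU * z0" using hz a(1) \<open>v a = z0\<close> .
    finally show ?thesis .
  next
    case False
    then have ht: "0 < h t" by simp
    have "\<exists>r\<ge>t. v r \<le> z0"
    proof (rule ccontr)
      assume "\<not> (\<exists>r\<ge>t. v r \<le> z0)"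
      then have stay: "z0 < v r" if "t \<le> r" for r using that by auto
      have hge: "h t \<le> h r" if "t \<le> r" for r
      proof (rule DERIV_nonneg_imp_increasing_open[OF that])
        fix w assume w: "t < w" "w < r"
        have "0 \<le> \<kappa> w * ((v w)\<^sup>2 - p * v w - q\<^sup>2)"
          using \<kappa>[of w] quadratic_pos[OF stay, of w] w t by (intro mult_nonneg_nonneg) auto
        also have "\<dots> \<le> h' w" using h'[of w] w t by simp
        finally show "\<exists>y. (h has_real_derivative y) (at w) \<and> 0 \<le> y"
          using interior_derivative[OF h(1)[of w]] w t by auto
      qed (rule continuous_on_subset[OF h_continuous], use t in auto)
      \<comment> \<open>Until time \<open>r\<close> the potential would grow by more than its range \<open>2 * B\<close> allows.\<close>
      define r where "r = t + (2 * B + 1) / h t"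
      have B: "0 \<le> B" using u(2)[OF t] by linarith
      have r: "t \<le> r" using ht B by (simp add: r_def)
      have "u t - h t * t \<le> u r - h t * r"
      proof (rule DERIV_nonneg_imp_increasing_open[OF r])
        fix w assume w: "t < w" "w < r"
        have "(u has_real_derivative h w) (at w)" using interior_derivative[OF u(1)[of w]] w t by simp
        then show "\<exists>y. ((\<lambda>w. u w - h t * w) has_real_derivative y) (at w) \<and> 0 \<le> y"
          using hge[of w] w by (intro exI[of _ "h w - h t"]) (auto intro!: derivative_eq_intros)
      next
        have "continuous_on {s..} u" using u(1) by (intro DERIV_continuous_on) auto
        then have "continuous_on {t..r} u" by (rule continuous_on_subset) (use t in auto)
        then show "continuous_on {t..r} (\<lambda>w. u w - h t * w)" by (intro continuous_intros)
      qed
      then have "h t * (r - t) \<le> u r - u t" by (simp add: algebra_simps)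
      moreover have "h t * (r - t) = 2 * B + 1" using ht by (simp add: r_def)
      ultimately show False using u(2)[OF t] u(2)[of r] r t by (simp add: abs_le_iff)
    qed
    then obtain d where d: "t \<le> d" "v d \<le> z0" by blast
    let ?Z = "{t..d} \<inter> v -` {..z0}"
    have "closed ?Z"
      by (intro continuous_closed_preimage continuous_on_subset[OF v_continuous]) (use t in \<open>auto intro: closed_atMost\<close>)
    moreover have "d \<in> ?Z" using d by simp
    then have ne: "?Z \<noteq> {}" by blast
    moreover have bdd: "bdd_below ?Z" by (rule bdd_belowI[of _ t]) simp
    ultimately have b: "Inf ?Z \<in> ?Z" by (intro closed_contains_Inf)
    define b where "b = Inf ?Z"
    have b: "t \<le> b" "b \<le> d" "v b \<le> z0" using b by (auto simp: b_def)
    have before: "z0 < v r" if "t \<le> r" "r < b" for r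
    proof (rule ccontr)
      assume "\<not> z0 < v r"
      then have "r \<in> ?Z" using that b by auto
      then have "b \<le> r" unfolding b_def by (rule cInf_lower[OF _ bdd])
      then show False using that by simp
    qed
    have "v b = z0"
    proof -
      obtain r where r: "t \<le> r" "r \<le> b" "v r = z0"
        using IVT2'[of v b z0 t] b above continuous_on_subset[OF v_continuous, of "{t..b}"] t by auto
      then show ?thesis using before[of r] by (cases "r = b") auto
    qed
    then have "\<bar>primitive (v b) - primitive (v t)\<bar> \<le> Cf * (h b - h t)"
      using before b t by (intro excursion_estimate) (auto simp: le_less)
    then have "primitive (v t) \<le> Cf * (h b - h t)" using \<open>v b = z0\<close> primitive_z0 primitive_nonneg[of "v t"] above by simp
    also have "\<dots> \<le> Cf * \<bar>h b\<bar>" using ht Cf by (intro mult_left_mono) auto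
    also have "\<dots> \<le> Cf * CU * z0" using hz b t \<open>v b = z0\<close> by simp
    finally show ?thesis .
  qed
qed

end

text \<open>The cubic tends to infinity, so to the right of a point where it is nonpositive it has a root; the
  finite set of its roots has \<open>zeta_star m\<close> as its maximum.\<close>

lemma zeta_star_ge:
  assumes m: "0 \<le> m" and \<zeta>: "\<zeta> ^ 3 - 3 * \<zeta> + 2 - 3 * m \<le> 0"
  shows "\<zeta> \<le> zeta_star m"
proof -
  let ?g = "\<lambda>x::real. x ^ 3 - 3 * x + 2 - 3 * m"
  let ?S = "{x. ?g x = 0}"
  have "?S = {x. poly [:2 - 3 * m, - 3, 0, 1:] x = 0}"
    by (auto simp: algebra_simps power3_eq_cube)
  then have fin: "finite ?S" using poly_roots_finite[of "[:2 - 3 * m, - 3, 0, 1:]"] by simp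
  \<comment> \<open>A point beyond \<open>\<zeta>\<close> at which the cubic is already nonnegative.\<close>
  define b where "b = max \<zeta> (2 + 3 * m)"
  have b: "\<zeta> \<le> b" "2 \<le> b" "3 * m \<le> b" using m by (auto simp: b_def)
  have "b * 1 \<le> b * (b * b - 3)"
    using b(2) mult_mono[of 2 b 2 b] by (intro mult_left_mono) auto
  moreover have "b * (b * b - 3) = b ^ 3 - 3 * b" by (simp add: power3_eq_cube algebra_simps)
  ultimately have "0 \<le> ?g b" using b by linarith
  moreover have "continuous_on {\<zeta>..b} ?g" by (intro continuous_intros)
  ultimately obtain x where x: "\<zeta> \<le> x" "?g x = 0" using IVT'[of ?g \<zeta> 0 b] \<zeta> b(1) by auto
  have "x \<le> zeta_star m" unfolding zeta_star_def using fin x(2) by (intro Max_ge) auto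
  with x(1) show ?thesis by simp
qed

lemma (in speed_comparison) primitive_cubic:
  assumes "p = 0" "l = 0" "q \<le> w"
  shows "z0 = q" "primitive w = w ^ 3 / 3 - q\<^sup>2 * w + 2 * q ^ 3 / 3"
proof -
  show z: "z0 = q" unfolding z0_def using q assms(1) by (simp add: real_sqrt_mult)
  have "((\<lambda>x. x\<^sup>2 - q\<^sup>2) has_integral (w ^ 3 / 3 - q\<^sup>2 * w) - (q ^ 3 / 3 - q\<^sup>2 * q)) {q..w}"
    by (intro fundamental_theorem_of_calculus[OF assms(3)])
      (auto intro!: derivative_eq_intros simp: has_real_derivative_iff_has_vector_derivative[symmetric])
  moreover have rate: "rate = (\<lambda>x. x\<^sup>2 - q\<^sup>2)"
    unfolding rate_def fun_eq_iff using assms(1,2) by simp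
  ultimately have "integral {q..w} (\<lambda>x. x\<^sup>2 - q\<^sup>2) = w ^ 3 / 3 - q\<^sup>2 * w - (q ^ 3 / 3 - q\<^sup>2 * q)" by (intro integral_unique)
  then show "primitive w = w ^ 3 / 3 - q\<^sup>2 * w + 2 * q ^ 3 / 3"
    unfolding primitive_def z rate by (simp add: power2_eq_square power3_eq_cube)
qed


section \<open>Derivatives along a solution\<close>

context riemannian
begin

text \<open>The product rule for the metric along a curve, in a chart: metric compatibility turns the
  derivative of the metric into Christoffel terms.\<close>

lemma metric_along_has_derivative:
  assumes x: "continuous_on I x" "t \<in> I" and c: "c \<in> charts_at A (x t)"
    and dx: "((cmap c \<circ> x) has_vector_derivative w) (at t within I)"
    and X: "\<And>\<tau>. \<tau> \<in> I \<Longrightarrow> X \<tau> \<in> tangent_space A (x \<tau>)" "((\<lambda>\<tau>. X \<tau> c) has_vector_derivative X') (at t within I)"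
    and Y: "\<And>\<tau>. \<tau> \<in> I \<Longrightarrow> Y \<tau> \<in> tangent_space A (x \<tau>)" "((\<lambda>\<tau>. Y \<tau> c) has_vector_derivative Y') (at t within I)"
  shows "((\<lambda>\<tau>. g (x \<tau>) (X \<tau>) (Y \<tau>)) has_real_derivative
      gform c (cmap c (x t)) (X' + christoffel_form A g c (cmap c (x t)) w (X t c)) (Y t c)
      + gform c (cmap c (x t)) (X t c) (Y' + christoffel_form A g c (cmap c (x t)) w (Y t c))) (at t within I)"
proof -
  let ?y = "cmap c (x t)"
  note cA = chart_atD[OF c]
  have "((\<lambda>\<tau>. gram A g c ((cmap c \<circ> x) \<tau>)) has_derivative (\<lambda>h. dgram c ?y (h *\<^sub>R w))) (at t within I)"
    using has_derivative_compose[OF dx[unfolded has_vector_derivative_def], of "gram A g c" "dgram c ?y"]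
      gram_has_derivative[OF cA(1,3)] by simp
  from has_derivative_matrix_form[OF this X(2)[unfolded has_vector_derivative_def] Y(2)[unfolded has_vector_derivative_def]]
  have "((\<lambda>\<tau>. gform c (cmap c (x \<tau>)) (X \<tau> c) (Y \<tau> c)) has_derivative
      (\<lambda>h. h * (gform c ?y X' (Y t c) + X t c \<bullet> (dgram c ?y w *v Y t c) + gform c ?y (X t c) Y'))) (at t within I)"
    by (simp add: gform_def linear_scale[OF dgram_linear[OF cA(1,3)]] scaleR_matrix_vector_assoc[symmetric]
        matrix_vector_mult_scaleR algebra_simps)
  moreover have "\<forall>\<^sub>F \<tau> in at t within I. gform c (cmap c (x \<tau>)) (X \<tau> c) (Y \<tau> c) = g (x \<tau>) (X \<tau>) (Y \<tau>)"
    using eventually_in_chart[OF x c] by (rule eventually_mono) (metis X(1) Y(1) metric_components)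
  moreover have "gform c ?y (X t c) (Y t c) = g (x t) (X t) (Y t)"
    using metric_components[OF X(1)[OF x(2)] Y(1)[OF x(2)] c] by simp
  ultimately have "((\<lambda>\<tau>. g (x \<tau>) (X \<tau>) (Y \<tau>)) has_derivative
      (\<lambda>h. h * (gform c ?y X' (Y t c) + X t c \<bullet> (dgram c ?y w *v Y t c) + gform c ?y (X t c) Y'))) (at t within I)"
    using x(2) by (rule has_derivative_transform_eventually)
  then have "((\<lambda>\<tau>. g (x \<tau>) (X \<tau>) (Y \<tau>)) has_real_derivative
      gform c ?y X' (Y t c) + X t c \<bullet> (dgram c ?y w *v Y t c) + gform c ?y (X t c) Y') (at t within I)"
    unfolding has_field_derivative_def by (simp only: mult_commute_abs)
  moreover have "gform c ?y X' (Y t c) + X t c \<bullet> (dgram c ?y w *v Y t c) + gform c ?y (X t c) Y'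
      = gform c ?y (X' + christoffel_form A g c ?y w (X t c)) (Y t c)
      + gform c ?y (X t c) (Y' + christoffel_form A g c ?y w (Y t c))"
    unfolding christoffel_form_metric[OF cA(1,3)] by (simp add: gform_simps)
  ultimately show ?thesis by simp
qed

end

locale forced_system = connected_riemannian A g + riemannian_function A g U
  for A :: "('a::{t2_space,second_countable_topology}, 'm::finite) chart set"
    and g :: "('a, 'm) rmetric" and U :: "'a \<Rightarrow> real" +
  fixes f :: "real ^ 'k::finite \<Rightarrow> 'a \<Rightarrow> ('a, 'm) tvec"
    and P :: "real ^ 'k \<Rightarrow> 'a \<Rightarrow> ('a, 'm) tvec \<Rightarrow> ('a, 'm) tvec"
    and D :: "'a set"
  assumes f: "smooth_vector_field_family A f" and P: "smooth_tensor_field_family A P"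
    and compact_D: "compact (closure D)" and D_nonempty: "D \<noteq> {}"
    and hess_pos: "\<And>p. p \<in> closure D \<Longrightarrow> 0 < hess_min A g U p"
    and inf_neg: "(INF (\<phi>, p) \<in> UNIV \<times> closure D. g p (gradient A g U p) (f \<phi> p)) < 0"
    and force_pos: "\<And>p. \<not> zero_tensor_field_family A P \<Longrightarrow> p \<in> closure D \<Longrightarrow> 0 < force_max g f p"
begin

lemma f_tangent: "f \<phi> p \<in> tangent_space A p"
  using f unfolding smooth_vector_field_family_def by blast

lemma P_endo: "tangent_endomorphism A p (P \<phi> p)"
  using P unfolding smooth_tensor_field_family_def by blast

lemma P_tangent: "v \<in> tangent_space A p \<Longrightarrow> P \<phi> p v \<in> tangent_space A p"
  using P_endo unfolding tangent_endomorphism_def by blast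

abbreviation grad :: "'a \<Rightarrow> ('a, 'm) tvec" where "grad \<equiv> gradient A g U"

section \<open>Finiteness of the constants\<close>

lemma closure_nonempty: obtains p where "p \<in> closure D"
  using D_nonempty closure_subset[of D] by blast

lemma hess_lower: obtains b where "0 < b" "\<And>p. p \<in> closure D \<Longrightarrow> b \<le> hess_min A g U p"
proof -
  have loc: "\<exists>W N. open W \<and> p \<in> W \<and> (\<forall>q\<in>W. inverse (hess_min A g U q) \<le> N)" if p: "p \<in> closure D" for p
  proof -
    obtain W b where "open W" "p \<in> W" "0 < b" "\<forall>q\<in>W. b \<le> hess_min A g U q"
      using hess_min_locally_positive[OF hess_pos[OF p]] by blast
    then show ?thesis by (intro exI[of _ W] exI[of _ "inverse b"]) (auto intro!: le_imp_inverse_le)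
  qed
  obtain N where N: "0 < N" "\<And>p. p \<in> closure D \<Longrightarrow> inverse (hess_min A g U p) \<le> N"
    using compact_locally_bounded_above[OF compact_D loc] by blast
  have "inverse N \<le> hess_min A g U p" if "p \<in> closure D" for p
    using le_imp_inverse_le[OF N(2)[OF that]] hess_pos[OF that] by simp
  with N(1) show thesis using that[of "inverse N"] by simp
qed

lemma force_upper: obtains N where "0 < N" "\<And>p \<phi>. p \<in> closure D \<Longrightarrow> rnorm g p (f \<phi> p) \<le> N"
proof -
  have loc: "\<exists>W N. open W \<and> p \<in> W \<and> (\<forall>q\<in>W. force_max g f q \<le> N)" if "p \<in> closure D" for p
  proof -
    obtain W N where "open W" "p \<in> W" "\<forall>q\<in>W. \<forall>\<phi>. rnorm g q (f \<phi> q) \<le> N"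
      using vector_field_locally_bounded[OF f, of p] by blast
    then show ?thesis using force_max_works(3)[OF f] by (intro exI[of _ W] exI[of _ N]) blast
  qed
  obtain N where N: "0 < N" "\<And>p. p \<in> closure D \<Longrightarrow> force_max g f p \<le> N"
    using compact_locally_bounded_above[OF compact_D loc] by blast
  show thesis using that[OF N(1)] N(2) force_max_works(1)[OF f] order_trans by blast
qed

lemma grad_upper: obtains N where "0 < N" "\<And>p. p \<in> closure D \<Longrightarrow> rnorm g p (grad p) \<le> N"
proof -
  have loc: "\<exists>W N. open W \<and> p \<in> W \<and> (\<forall>q\<in>W. rnorm g q (grad q) \<le> N)" if "p \<in> closure D" for p
    by (rule gradient_locally_bounded)
  obtain N where N: "0 < N" "\<And>p. p \<in> closure D \<Longrightarrow> rnorm g p (grad p) \<le> N"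
    using compact_locally_bounded_above[OF compact_D loc] by blast
  show thesis by (rule that[OF N])
qed

lemma P_upper:
  obtains N where "0 < N"
    "\<And>p \<phi> v. p \<in> closure D \<Longrightarrow> v \<in> tangent_space A p \<Longrightarrow> rnorm g p (P \<phi> p v) \<le> N * rnorm g p v"
proof -
  obtain W N where W: "\<And>p. open (W p)" "\<And>p. p \<in> W p" "\<And>p. 0 \<le> N p"
    "\<And>p q \<phi> v. q \<in> W p \<Longrightarrow> v \<in> tangent_space A q \<Longrightarrow> rnorm g q (P \<phi> q v) \<le> N p * rnorm g q v"
    using tensor_field_locally_bounded[OF P] by (metis (no_types, lifting))
  obtain C where C: "C \<subseteq> closure D" "finite C" "closure D \<subseteq> (\<Union>c\<in>C. W c)"
    by (rule compactE_image[OF compact_D, of "closure D" W]) (use W(1,2) in auto)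
  let ?N = "Max (insert 1 (N ` C))"
  have "rnorm g p (P \<phi> p v) \<le> ?N * rnorm g p v" if p: "p \<in> closure D" and v: "v \<in> tangent_space A p" for p \<phi> v
  proof -
    obtain c where c: "c \<in> C" "p \<in> W c" using C(3) p by blast
    have "rnorm g p (P \<phi> p v) \<le> N c * rnorm g p v" by (rule W(4)[OF c(2) v])
    also have "\<dots> \<le> ?N * rnorm g p v"
      using c(1) C(2) rnorm_nonneg[OF v] by (intro mult_right_mono Max_ge) auto
    finally show ?thesis .
  qed
  moreover have "1 \<le> ?N" using C(2) by (intro Max_ge) auto
  ultimately show thesis using that[of ?N] by auto
qed

lemma form_max_bounds:
  obtains N where "0 < N" "\<And>p. p \<in> closure D \<Longrightarrow> form_max A g P p \<le> N"
    "\<And>p. p \<in> closure D \<Longrightarrow> 0 \<le> form_max A g P p"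
    "\<And>p \<phi> v. p \<in> closure D \<Longrightarrow> v \<in> tangent_space A p \<Longrightarrow> \<bar>g p (P \<phi> p v) v\<bar> \<le> form_max A g P p * g p v v"
proof -
  obtain N where N: "0 < N" "\<And>p \<phi> v. p \<in> closure D \<Longrightarrow> v \<in> tangent_space A p \<Longrightarrow>
      rnorm g p (P \<phi> p v) \<le> N * rnorm g p v" by (rule P_upper) blast
  note * = form_max_works[where P = P and N = N, OF P_endo]
  show thesis
  proof (rule that[OF N(1)])
    fix p assume p: "p \<in> closure D"
    show "form_max A g P p \<le> N" by (rule *(1)) (rule N(2)[OF p])
    show "0 \<le> form_max A g P p" by (rule *(2)) (rule N(2)[OF p])
    show "\<bar>g p (P \<phi> p v) v\<bar> \<le> form_max A g P p * g p v v" if "v \<in> tangent_space A p" for \<phi> v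
      by (rule *(3)[OF _ that]) (rule N(2)[OF p])
  qed
qed

abbreviation "cf \<equiv> const_Cf A g U D f"
abbreviation "cU \<equiv> const_CU A g U D"
abbreviation "cq \<equiv> const_q A g U D f"
abbreviation "cp \<equiv> const_p A g U D P"
abbreviation "cl \<equiv> const_l A g D f P"

lemma ratio_bound:
  assumes "p \<in> closure D" "F \<le> N" "0 < N" "0 < b" "b \<le> hess_min A g U p"
  shows "F / hess_min A g U p \<le> N / b"
proof -
  have "F / hess_min A g U p \<le> N / hess_min A g U p"
    using assms hess_pos[OF assms(1)] by (intro divide_right_mono) auto
  also have "\<dots> \<le> N / b" using assms by (intro divide_left_mono mult_pos_pos) auto
  finally show ?thesis .
qed

lemma force_le_Cf:
  assumes p: "p \<in> closure D"
  shows "force_max g f p \<le> cf * hess_min A g U p" "0 \<le> cf"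
proof -
  obtain b where b: "0 < b" "\<And>p. p \<in> closure D \<Longrightarrow> b \<le> hess_min A g U p" by (rule hess_lower) blast
  obtain N where N: "0 < N" "\<And>p \<phi>. p \<in> closure D \<Longrightarrow> rnorm g p (f \<phi> p) \<le> N" by (rule force_upper) blast
  have "force_max g f p / hess_min A g U p \<le> N / b" if "p \<in> closure D" for p
    using ratio_bound[OF that force_max_works(3)[OF f N(2)[OF that]] N(1) b(1) b(2)[OF that]] .
  then have "bdd_above ((\<lambda>p. force_max g f p / hess_min A g U p) ` closure D)" by (rule bdd_aboveI2)
  from cSUP_upper[OF p this] have *: "force_max g f p / hess_min A g U p \<le> cf" unfolding const_Cf_def .
  then show "force_max g f p \<le> cf * hess_min A g U p" using hess_pos[OF p] by (simp add: pos_divide_le_eq)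
  have "0 \<le> force_max g f p / hess_min A g U p"
    using force_max_works(2)[OF f, of p] hess_pos[OF p] by simp
  with * show "0 \<le> cf" by linarith
qed

lemma grad_le_CU:
  assumes p: "p \<in> closure D"
  shows "rnorm g p (grad p) \<le> cU" "0 \<le> cU"
proof -
  obtain N where N: "0 < N" "\<And>p. p \<in> closure D \<Longrightarrow> rnorm g p (grad p) \<le> N" by (rule grad_upper) blast
  then have "bdd_above ((\<lambda>p. rnorm g p (grad p)) ` closure D)" by (meson bdd_aboveI2)
  from cSUP_upper[OF p this] show *: "rnorm g p (grad p) \<le> cU" unfolding const_CU_def .
  then show "0 \<le> cU" using rnorm_nonneg[OF gradient_works(1), of p] by linarith
qed

text \<open>The negative infimum provides an angle and a point at which the maximised quotient is positive.
  Therefore the supremum under the square root in \<open>const_q\<close> is positive and equals the square of \<open>const_q\<close>.\<close>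

lemma q_bound:
  shows "p \<in> closure D \<Longrightarrow> - (cq\<^sup>2 * hess_min A g U p) \<le> g p (grad p) (f \<phi> p)" and "0 < cq"
proof -
  obtain b where b: "0 < b" "\<And>p. p \<in> closure D \<Longrightarrow> b \<le> hess_min A g U p" by (rule hess_lower) blast
  obtain N where N: "0 < N" "\<And>p \<phi>. p \<in> closure D \<Longrightarrow> rnorm g p (f \<phi> p) \<le> N" by (rule force_upper) blast
  obtain M where M: "0 < M" "\<And>p. p \<in> closure D \<Longrightarrow> rnorm g p (grad p) \<le> M" by (rule grad_upper) blast
  let ?F = "\<lambda>(\<phi>, p). - (g p (grad p) (f \<phi> p) / hess_min A g U p)"
  let ?S = "SUP x \<in> UNIV \<times> closure D. ?F x"
  have "?F (\<phi>, p) \<le> (M * N) / b" if p: "p \<in> closure D" for \<phi> p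
  proof -
    have "- g p (grad p) (f \<phi> p) \<le> rnorm g p (grad p) * rnorm g p (f \<phi> p)"
      using metric_cauchy_schwarz[OF gradient_works(1) f_tangent, of p \<phi>] by linarith
    also have "\<dots> \<le> M * N"
      using M N p rnorm_nonneg f_tangent by (intro mult_mono) (auto simp: less_imp_le)
    finally show ?thesis using ratio_bound[OF p _ _ b(1) b(2)[OF p], of "- g p (grad p) (f \<phi> p)" "M * N"] M(1) N(1) by simp
  qed
  then have "bdd_above (?F ` (UNIV \<times> closure D))" by (intro bdd_aboveI2[of _ _ "(M * N) / b"]) auto
  then have upper: "- (g p (grad p) (f \<phi> p) / hess_min A g U p) \<le> ?S" if "p \<in> closure D" for \<phi> p
    using cSUP_upper[of "(\<phi>, p)" "UNIV \<times> closure D" ?F] that by simp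
  have "\<exists>\<phi> p. p \<in> closure D \<and> g p (grad p) (f \<phi> p) < 0"
  proof (rule ccontr)
    assume no: "\<not> ?thesis"
    have "0 \<le> (INF (\<phi>, p) \<in> UNIV \<times> closure D. g p (grad p) (f \<phi> p))"
    proof (rule cINF_greatest)
      show "UNIV \<times> closure D \<noteq> {}" using D_nonempty by simp
    qed (use no in \<open>auto simp: not_less\<close>)
    then show False using inf_neg by simp
  qed
  then obtain \<phi>0 p0 where neg: "p0 \<in> closure D" "g p0 (grad p0) (f \<phi>0 p0) < 0" by blast
  have "0 < - (g p0 (grad p0) (f \<phi>0 p0) / hess_min A g U p0)"
    using divide_neg_pos[OF neg(2) hess_pos[OF neg(1)]] by simp
  then have S: "0 < ?S" using upper[OF neg(1), of \<phi>0] by linarith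
  then show "0 < cq" unfolding const_q_def by simp
  have q2: "cq\<^sup>2 = ?S" using S unfolding const_q_def by simp
  show "- (cq\<^sup>2 * hess_min A g U p) \<le> g p (grad p) (f \<phi> p)" if p: "p \<in> closure D"
  proof -
    have "- cq\<^sup>2 \<le> g p (grad p) (f \<phi> p) / hess_min A g U p" unfolding q2 using upper[OF p, of \<phi>] by simp
    then show ?thesis unfolding pos_le_divide_eq[OF hess_pos[OF p]] by simp
  qed
qed

lemma p_bound:
  assumes p: "p \<in> closure D"
  shows "rnorm g p (radjoint A g p (P \<phi> p) (grad p)) \<le> cp * hess_min A g U p" "0 \<le> cp"
proof -
  obtain b where b: "0 < b" "\<And>p. p \<in> closure D \<Longrightarrow> b \<le> hess_min A g U p" by (rule hess_lower) blast
  obtain N where N: "0 < N" "\<And>p \<phi> v. p \<in> closure D \<Longrightarrow> v \<in> tangent_space A p \<Longrightarrow>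
      rnorm g p (P \<phi> p v) \<le> N * rnorm g p v" by (rule P_upper) blast
  obtain M where M: "0 < M" "\<And>p. p \<in> closure D \<Longrightarrow> rnorm g p (grad p) \<le> M" by (rule grad_upper) blast
  let ?F = "\<lambda>(\<phi>, p). rnorm g p (radjoint A g p (P \<phi> p) (grad p)) / hess_min A g U p"
  have "?F (\<phi>, p) \<le> (N * M) / b" if p: "p \<in> closure D" for \<phi> p
  proof -
    have "rnorm g p (radjoint A g p (P \<phi> p) (grad p)) \<le> N * rnorm g p (grad p)"
      by (rule radjoint_bound[OF P_endo gradient_works(1) N(2)[OF p]])
    also have "\<dots> \<le> N * M" using M(2)[OF p] N(1) by (intro mult_left_mono) auto
    finally show ?thesis
      using ratio_bound[OF p _ _ b(1) b(2)[OF p], of _ "N * M"] M(1) N(1) by simp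
  qed
  then have bdd: "bdd_above (?F ` (UNIV \<times> closure D))" by (intro bdd_aboveI2[of _ _ "(N * M) / b"]) auto
  have *: "rnorm g p (radjoint A g p (P \<phi> p) (grad p)) / hess_min A g U p \<le> cp"
    unfolding const_p_def using cSUP_upper[OF _ bdd, of "(\<phi>, p)"] p by simp
  then show "rnorm g p (radjoint A g p (P \<phi> p) (grad p)) \<le> cp * hess_min A g U p"
    using hess_pos[OF p] by (simp add: pos_divide_le_eq)
  have "0 \<le> rnorm g p (radjoint A g p (P \<phi> p) (grad p)) / hess_min A g U p"
    using rnorm_nonneg[OF radjoint_works(1)[OF P_endo gradient_works(1)]] hess_pos[OF p] by simp
  with * show "0 \<le> cp" by linarith
qed

text \<open>For the vanishing tensor field both suprema run over zeros only, so the comparison for general \<open>P\<close>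
  specialises to the undamped one.\<close>

lemma zero_tensor_constants:
  assumes Z: "zero_tensor_field_family A P"
  shows "form_max A g P p = 0" "cp = 0" "cl = 0"
proof -
  have P0: "P \<phi> p v = (\<lambda>_. 0)" if "v \<in> tangent_space A p" for \<phi> p v
    using Z that unfolding zero_tensor_field_family_def by blast
  have n0: "rnorm g p (\<lambda>_. 0) = 0" for p using rnorm_zero_iff[OF zero_tangent] by blast
  have form: "form_max A g P p = 0" for p
    by (rule order_antisym; rule form_max_works[of p P 0, OF P_endo]) (simp_all add: P0 n0)
  then show "form_max A g P p = 0" .
  have "rnorm g p (radjoint A g p (P \<phi> p) (grad p)) = 0" for \<phi> p
  proof -
    have "rnorm g p (radjoint A g p (P \<phi> p) (grad p)) \<le> 0 * rnorm g p (grad p)"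
      by (rule radjoint_bound[OF P_endo gradient_works(1)]) (simp add: P0 n0)
    then show ?thesis
      using rnorm_nonneg[OF radjoint_works(1)[OF P_endo gradient_works(1)], of p \<phi>] by simp
  qed
  moreover have "UNIV \<times> closure D \<noteq> ({} :: ((real ^ 'k) \<times> 'a) set)" using D_nonempty by simp
  ultimately show "cp = 0" unfolding const_p_def by (simp add: case_prod_beta)
  show "cl = 0" unfolding const_l_def using form D_nonempty by simp
qed

text \<open>For nonvanishing \<open>P\<close> the quotient is bounded because the force is bounded away from zero on the
  compact closure. For \<open>P = 0\<close> all terms are zero, even where the force vanishes.\<close>

lemma l_bound:
  assumes p: "p \<in> closure D"
  shows "form_max A g P p \<le> cl * force_max g f p" "0 \<le> cl"
proof -
  have "form_max A g P p \<le> cl * force_max g f p \<and> 0 \<le> cl"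
  proof (cases "zero_tensor_field_family A P")
    case True
    then show ?thesis using zero_tensor_constants by simp
  next
    case False
    note pos = force_pos[OF False]
    have loc: "\<exists>W N. open W \<and> p \<in> W \<and> (\<forall>q\<in>W. inverse (force_max g f q) \<le> N)" if p: "p \<in> closure D" for p
    proof -
      obtain W b where "open W" "p \<in> W" "0 < b" "\<forall>q\<in>W. b \<le> force_max g f q"
        using force_max_locally_positive[OF f pos[OF p]] by blast
      then show ?thesis by (intro exI[of _ W] exI[of _ "inverse b"]) (auto intro!: le_imp_inverse_le)
    qed
    obtain M where M: "0 < M" "\<And>p. p \<in> closure D \<Longrightarrow> inverse (force_max g f p) \<le> M"
      using compact_locally_bounded_above[OF compact_D loc] by blast
    obtain N where N: "0 < N" "\<And>p. p \<in> closure D \<Longrightarrow> form_max A g P p \<le> N"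
      "\<And>p. p \<in> closure D \<Longrightarrow> 0 \<le> form_max A g P p" by (rule form_max_bounds) blast
    have "form_max A g P p / force_max g f p \<le> N * M" if p: "p \<in> closure D" for p
      unfolding divide_inverse using N(2)[OF p] M(2)[OF p] N(1) pos[OF p]
      by (intro mult_mono) (auto simp: less_imp_le)
    then have "bdd_above ((\<lambda>p. form_max A g P p / force_max g f p) ` closure D)" by (rule bdd_aboveI2)
    from cSUP_upper[OF p this] have *: "form_max A g P p / force_max g f p \<le> cl" unfolding const_l_def .
    have "0 \<le> form_max A g P p / force_max g f p"
      using N(3)[OF p] pos[OF p] by simp
    with * have "0 \<le> cl" by linarith
    with * pos[OF p] show ?thesis by (simp add: pos_divide_le_eq)
  qed
  then show "form_max A g P p \<le> cl * force_max g f p" "0 \<le> cl" by auto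
qed

lemma damping_bound:
  assumes p: "p \<in> closure D" and v: "v \<in> tangent_space A p"
  shows "\<bar>g p (P \<phi> p v) v\<bar> \<le> cl * force_max g f p * (rnorm g p v)\<^sup>2"
proof -
  have "\<bar>g p (P \<phi> p v) v\<bar> \<le> form_max A g P p * g p v v"
    by (rule form_max_bounds) (use p v in blast)
  also have "\<dots> \<le> cl * force_max g f p * g p v v"
    using l_bound(1)[OF p] metric_nonneg[OF v] by (rule mult_right_mono)
  finally show ?thesis by (simp add: rnorm_power2[OF v])
qed

sublocale comparison: speed_comparison cp cq cl
proof -
  obtain p where "p \<in> closure D" by (rule closure_nonempty)
  then show "speed_comparison cp cq cl" by unfold_locales (use p_bound(2) q_bound(2) l_bound(2) in auto)
qed

lemma z_plus_eq: "z_plus A g U D f P = comparison.z0"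
  unfolding z_plus_def comparison.z0_def ..

lemma I_fun_eq: "I_fun A g U D f P = comparison.primitive"
  unfolding I_fun_def comparison.primitive_def comparison.rate_def z_plus_eq fun_eq_iff by simp

text \<open>For nonvanishing \<open>P\<close> this is monotonicity of the primitive. For \<open>P = 0\<close> the primitive at \<open>q * \<zeta>\<close> is
  \<open>q ^ 3 / 3 * (\<zeta> ^ 3 - 3 * \<zeta> + 2)\<close>, so the bound on it says that the cubic in the definition of
  \<open>zeta_star\<close> is nonpositive at \<open>\<zeta>\<close>; speeds below \<open>q\<close> are covered by \<open>\<zeta> = 1\<close>, where the bracket vanishes.\<close>

lemma le_z_star:
  assumes w: "comparison.z0 < w \<Longrightarrow> comparison.primitive w \<le> cf * cU * comparison.z0"
  shows "w \<le> z_star A g U D f P"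
proof -
  let ?C = "cf * cU * comparison.z0"
  obtain p where p: "p \<in> closure D" by (rule closure_nonempty)
  have C: "0 \<le> ?C" using force_le_Cf(2)[OF p] grad_le_CU(2)[OF p] comparison.z0_pos by simp
  show ?thesis
  proof (cases "zero_tensor_field_family A P")
    case False
    have "\<exists>!z. z \<ge> z_plus A g U D f P \<and> I_fun A g U D f P z = cf * cU * z_plus A g U D f P"
      unfolding z_plus_eq I_fun_eq by (rule comparison.primitive_root[OF C])
    from theI'[OF this] False
    have "comparison.z0 \<le> z_star A g U D f P" "comparison.primitive (z_star A g U D f P) = ?C"
      unfolding z_star_def z_plus_eq I_fun_eq by auto
    then show ?thesis using w by (rule comparison.primitive_le_root)
  next
    case True
    note zero = zero_tensor_constants(2,3)[OF True]
    \<comment> \<open>The cubic formula for the primitive is valid from \<open>cq\<close> on.\<close>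
    let ?m = "cf * cU / cq\<^sup>2" and ?w = "max w cq"
    have q: "0 < cq" by (rule q_bound(2))
    have z0: "comparison.z0 = cq" by (rule comparison.primitive_cubic(1)[OF zero order_refl])
    have "comparison.primitive ?w \<le> cf * cU * cq"
      using w C comparison.primitive_z0 unfolding z0 by (cases "cq < w") (auto simp: max_def)
    then have *: "?w ^ 3 / 3 - cq\<^sup>2 * ?w + 2 * cq ^ 3 / 3 \<le> cf * cU * cq"
      using comparison.primitive_cubic(2)[OF zero, of ?w] by simp
    have "(?w / cq) ^ 3 - 3 * (?w / cq) + 2 - 3 * ?m
        = 3 / cq ^ 3 * (?w ^ 3 / 3 - cq\<^sup>2 * ?w + 2 * cq ^ 3 / 3 - cf * cU * cq)"
      using q by (simp add: field_simps power2_eq_square power3_eq_cube)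
    also have "\<dots> \<le> 0" using * q by (intro mult_nonneg_nonpos) auto
    finally have "(?w / cq) ^ 3 - 3 * (?w / cq) + 2 - 3 * ?m \<le> 0" .
    moreover have "0 \<le> ?m" using force_le_Cf(2)[OF p] grad_le_CU(2)[OF p] by simp
    ultimately have "?w / cq \<le> zeta_star ?m" by (intro zeta_star_ge)
    then have "?w \<le> cq * zeta_star ?m" using q by (simp add: pos_divide_le_eq mult.commute)
    then show ?thesis using True unfolding z_star_def by simp
  qed
qed


section \<open>The bound for the speed\<close>

text \<open>The solution provides the data of a speed excursion: \<open>E\<close> is the squared speed, \<open>h\<close> the derivative of
  \<open>U\<close> along the solution. The equation of motion enters through the covariant acceleration in \<open>E'\<close> and
  \<open>h'\<close>; the damping term in \<open>h'\<close> is moved to the gradient by the adjoint.\<close>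

lemma solution_speed_bound:
  assumes sol: "is_solution A g f P \<omega> {s..} x" and inD: "x ` {s..} \<subseteq> closure D"
    and start: "rnorm g (x s) (velocity A {s..} x s) \<le> z_plus A g U D f P" and st: "s \<le> t"
  shows "rnorm g (x t) (velocity A {s..} x t) \<le> z_star A g U D f P"
proof -
  let ?I = "{s..}"
  let ?V = "velocity A ?I x"
  define a where "a t = cov_deriv_along A g ?I x ?V t" for t
  have cont: "continuous_on ?I x" using sol unfolding is_solution_def by blast
  have diff: "(cmap c \<circ> x) differentiable (at t within ?I)"
    and diff2: "(\<lambda>\<tau>. vector_derivative (cmap c \<circ> x) (at \<tau> within ?I)) differentiable (at t within ?I)"
    if "s \<le> t" "c \<in> charts_at A (x t)" for t c
    using sol that unfolding is_solution_def by auto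
  have a_eq: "a t = tcomb 1 (f (t *\<^sub>R \<omega>) (x t)) 1 (P (t *\<^sub>R \<omega>) (x t) (?V t))" if "s \<le> t" for t
    using sol that unfolding is_solution_def a_def tcomb_def by simp
  have D: "x t \<in> closure D" if "s \<le> t" for t using inD that by auto
  have nontrivial: "at t within ?I \<noteq> bot" if "s \<le> t" for t
  proof -
    have "t islimpt {t..t + 1}" by (simp add: islimpt_Icc)
    then have "t islimpt ?I" by (rule islimpt_subset) (use that in auto)
    then show ?thesis using trivial_limit_within by blast
  qed
  have V: "?V t \<in> tangent_space A (x t)" if "s \<le> t" for t
    using velocity_tangent[OF cont _ nontrivial[OF that] diff[OF that]] that by simp
  have a_tangent: "a t \<in> tangent_space A (x t)" if "s \<le> t" for t
    unfolding a_eq[OF that] by (intro tcomb_tangent f_tangent P_tangent V that)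
  let ?E = "\<lambda>t. g (x t) (?V t) (?V t)"
  let ?h = "\<lambda>t. g (x t) (grad (x t)) (?V t)"
  let ?H = "\<lambda>t. g (x t) (cov_deriv A g grad (x t) (?V t)) (?V t)"
  have dV: "((\<lambda>\<tau>. ?V \<tau> c) has_vector_derivative vector_derivative (\<lambda>\<tau>. ?V \<tau> c) (at t within ?I)) (at t within ?I)"
    if t: "s \<le> t" and c: "c \<in> charts_at A (x t)" for t c
  proof -
    let ?d = "\<lambda>\<tau>. vector_derivative (cmap c \<circ> x) (at \<tau> within ?I)"
    have tI: "t \<in> ?I" using t by simp
    have d: "(?d has_vector_derivative vector_derivative ?d (at t within ?I)) (at t within ?I)"
      using diff2[OF t c] by (simp add: vector_derivative_works)
    have "\<forall>\<^sub>F \<tau> in at t within ?I. ?d \<tau> = ?V \<tau> c"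
      using eventually_in_chart[OF cont tI c] by (rule eventually_mono) (simp add: velocity_def)
    then have "((\<lambda>\<tau>. ?V \<tau> c) has_vector_derivative vector_derivative ?d (at t within ?I)) (at t within ?I)"
      by (rule has_vector_derivative_transform_eventually[OF d _ tI]) (use c in \<open>simp add: velocity_def\<close>)
    then show ?thesis by (meson differentiableI_vector vector_derivative_works)
  qed
  have dE: "(?E has_real_derivative 2 * g (x t) (a t) (?V t)) (at t within ?I)" if t: "s \<le> t" for t
  proof -
    obtain c where c: "c \<in> charts_at A (x t)" by (rule chart_exists)
    have tI: "t \<in> ?I" using t by simp
    have a_c: "a t c = vector_derivative (\<lambda>\<tau>. ?V \<tau> c) (at t within ?I)
        + christoffel_form A g c (cmap c (x t)) (?V t c) (?V t c)"
      unfolding a_def cov_deriv_along_def using c by simp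
    have "(?E has_real_derivative gform c (cmap c (x t)) (a t c) (?V t c) + gform c (cmap c (x t)) (?V t c) (a t c)) (at t within ?I)"
      unfolding a_c
      by (rule metric_along_has_derivative[where X = ?V and Y = ?V, OF cont tI c velocity_component[OF c diff[OF t c]] _ dV[OF t c] _ dV[OF t c]])
        (use V in auto)
    then show ?thesis
      using metric_components[OF a_tangent[OF t] V[OF t] c] metric_components[OF V[OF t] a_tangent[OF t] c]
        metric_commute[OF a_tangent[OF t] V[OF t]] by simp
  qed
  have dh: "(?h has_real_derivative ?H t + g (x t) (grad (x t)) (a t)) (at t within ?I)" if t: "s \<le> t" for t
  proof -
    obtain c where c: "c \<in> charts_at A (x t)" by (rule chart_exists)
    note cA = chart_atD[OF c]
    have tI: "t \<in> ?I" using t by simp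
    let ?y = "cmap c (x t)"
    let ?DW = "frechet_derivative (grad_comp c) (at ?y)"
    have a_c: "a t c = vector_derivative (\<lambda>\<tau>. ?V \<tau> c) (at t within ?I)
        + christoffel_form A g c ?y (?V t c) (?V t c)"
      unfolding a_def cov_deriv_along_def using c by simp
    have W: "(grad_comp c has_derivative ?DW) (at ?y)"
      using grad_comp_differentiable[OF cA(1,3)] by (simp add: frechet_derivative_works)
    have "((\<lambda>\<tau>. grad_comp c ((cmap c \<circ> x) \<tau>)) has_derivative (\<lambda>r. ?DW (r *\<^sub>R ?V t c))) (at t within ?I)"
      using has_derivative_compose[OF velocity_component[OF c diff[OF t c], unfolded has_vector_derivative_def], of "grad_comp c" ?DW]
        W by simp
    then have "((\<lambda>\<tau>. grad_comp c ((cmap c \<circ> x) \<tau>)) has_vector_derivative ?DW (?V t c)) (at t within ?I)"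
      unfolding has_vector_derivative_def using linear_scale[OF has_derivative_linear[OF W]] by simp
    moreover have "\<forall>\<^sub>F \<tau> in at t within ?I. grad_comp c ((cmap c \<circ> x) \<tau>) = grad (x \<tau>) c"
      using eventually_in_chart[OF cont tI c] by (rule eventually_mono) (simp add: chart_atD(4))
    ultimately have dW: "((\<lambda>\<tau>. grad (x \<tau>) c) has_vector_derivative ?DW (?V t c)) (at t within ?I)"
      by (rule has_vector_derivative_transform_eventually[OF _ _ tI]) (simp add: cA(4))
    have cov_c: "cov_deriv A g grad (x t) (?V t) c = ?DW (?V t c) + christoffel_form A g c ?y (?V t c) (grad (x t) c)"
      unfolding cov_deriv_def using c by simp
    have "(?h has_real_derivative gform c ?y (cov_deriv A g grad (x t) (?V t) c) (?V t c)
        + gform c ?y (grad (x t) c) (a t c)) (at t within ?I)"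
      unfolding a_c cov_c
      by (rule metric_along_has_derivative[where X = "\<lambda>\<tau>. grad (x \<tau>)" and Y = ?V, OF cont tI c velocity_component[OF c diff[OF t c]] _ dW _ dV[OF t c]])
        (use V gradient_works(1) in auto)
    then show ?thesis
      using metric_components[OF gradient_cov_deriv_tangent[OF V[OF t]] V[OF t] c]
        metric_components[OF gradient_works(1) a_tangent[OF t] c] by simp
  qed
  have du: "((\<lambda>t. U (x t)) has_real_derivative ?h t) (at t within ?I)" if t: "s \<le> t" for t
  proof -
    obtain c where c: "c \<in> charts_at A (x t)" by (rule chart_exists)
    note cA = chart_atD[OF c]
    have tI: "t \<in> ?I" using t by simp
    let ?y = "cmap c (x t)"
    have lin: "linear (dU c ?y)" using U_has_derivative[OF cA(1,3)] has_derivative_linear by blast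
    have "((\<lambda>\<tau>. (U \<circ> cinv c) ((cmap c \<circ> x) \<tau>)) has_derivative (\<lambda>r. dU c ?y (r *\<^sub>R ?V t c))) (at t within ?I)"
      using has_derivative_compose[OF velocity_component[OF c diff[OF t c], unfolded has_vector_derivative_def], of "U \<circ> cinv c" "dU c ?y"]
        U_has_derivative[OF cA(1,3)] by simp
    moreover have "\<forall>\<^sub>F \<tau> in at t within ?I. (U \<circ> cinv c) ((cmap c \<circ> x) \<tau>) = U (x \<tau>)"
      using eventually_in_chart[OF cont tI c] by (rule eventually_mono) (simp add: chart_atD(4))
    moreover have "(U \<circ> cinv c) ((cmap c \<circ> x) t) = U (x t)" by (simp add: cA(4))
    ultimately have "((\<lambda>t. U (x t)) has_derivative (\<lambda>r. dU c ?y (r *\<^sub>R ?V t c))) (at t within ?I)"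
      using tI by (rule has_derivative_transform_eventually)
    then show ?thesis
      unfolding has_field_derivative_def gradient_works(2)[OF V[OF t] c]
      by (simp add: linear_scale[OF lin] mult_commute_abs)
  qed
  have "compact (U ` closure D)"
    by (rule compact_continuous_image[OF continuous_on_subset[OF U_continuous subset_UNIV] compact_D])
  then obtain B where "\<forall>r\<in>U ` closure D. norm r \<le> B" using compact_imp_bounded bounded_iff by metis
  then have B: "\<bar>U p\<bar> \<le> B" if "p \<in> closure D" for p using that by auto
  have speed: "sqrt (?E t) = rnorm g (x t) (?V t)" for t by (simp add: rnorm_def)
  interpret speed_excursion cp cq cl s cf cU B ?E "\<lambda>t. 2 * g (x t) (a t) (?V t)" "\<lambda>t. U (x t)" ?h
      "\<lambda>t. ?H t + g (x t) (grad (x t)) (a t)" "\<lambda>t. force_max g f (x t)" "\<lambda>t. hess_min A g U (x t)"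
  proof
    fix t assume t: "s \<le> t"
    let ?f = "f (t *\<^sub>R \<omega>) (x t)" and ?P = "P (t *\<^sub>R \<omega>) (x t)" and ?n = "rnorm g (x t) (?V t)"
    have n: "0 \<le> ?n" by (rule rnorm_nonneg[OF V[OF t]])
    show "(?E has_real_derivative 2 * g (x t) (a t) (?V t)) (at t within ?I)" by (rule dE[OF t])
    show "0 \<le> ?E t" by (rule metric_nonneg[OF V[OF t]])
    show "((\<lambda>t. U (x t)) has_real_derivative ?h t) (at t within ?I)" by (rule du[OF t])
    show "\<bar>U (x t)\<bar> \<le> B" by (rule B[OF D[OF t]])
    show "(?h has_real_derivative ?H t + g (x t) (grad (x t)) (a t)) (at t within ?I)" by (rule dh[OF t])
    show "0 < hess_min A g U (x t)" by (rule hess_pos[OF D[OF t]])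
    show "force_max g f (x t) \<le> cf * hess_min A g U (x t)" by (rule force_le_Cf(1)[OF D[OF t]])
    show "\<bar>?h t\<bar> \<le> cU * sqrt (?E t)"
      unfolding speed
      using metric_cauchy_schwarz[OF gradient_works(1) V[OF t]] mult_right_mono[OF grad_le_CU(1)[OF D[OF t]] n]
      by linarith
    show "\<bar>2 * g (x t) (a t) (?V t)\<bar> \<le> 2 * force_max g f (x t) * (sqrt (?E t) + cl * (sqrt (?E t))\<^sup>2)"
    proof -
      have "g (x t) (a t) (?V t) = g (x t) ?f (?V t) + g (x t) (?P (?V t)) (?V t)"
        unfolding a_eq[OF t] by (simp add: metric_tcomb f_tangent P_tangent V t)
      moreover have "\<bar>g (x t) ?f (?V t)\<bar> \<le> force_max g f (x t) * ?n"
        using metric_cauchy_schwarz[OF f_tangent V[OF t], of "t *\<^sub>R \<omega>"]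
          mult_right_mono[OF force_max_works(1)[OF f, of "x t" "t *\<^sub>R \<omega>"] n] by linarith
      moreover have "\<bar>g (x t) (?P (?V t)) (?V t)\<bar> \<le> cl * force_max g f (x t) * ?n\<^sup>2"
        by (rule damping_bound[OF D[OF t] V[OF t]])
      ultimately have "\<bar>g (x t) (a t) (?V t)\<bar> \<le> force_max g f (x t) * ?n + cl * force_max g f (x t) * ?n\<^sup>2" by linarith
      then show ?thesis unfolding speed by (simp add: abs_mult algebra_simps)
    qed
    show "hess_min A g U (x t) * ((sqrt (?E t))\<^sup>2 - cp * sqrt (?E t) - cq\<^sup>2) \<le> ?H t + g (x t) (grad (x t)) (a t)"
    proof -
      let ?R = "radjoint A g (x t) ?P (grad (x t))"
      note R = radjoint_works[OF P_endo gradient_works(1)]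
      have "g (x t) (grad (x t)) (a t) = g (x t) (grad (x t)) ?f + g (x t) ?R (?V t)"
        unfolding a_eq[OF t] by (simp add: metric_tcomb f_tangent P_tangent V t gradient_works(1) R(2))
      moreover have "- (cq\<^sup>2 * hess_min A g U (x t)) \<le> g (x t) (grad (x t)) ?f" by (rule q_bound(1)[OF D[OF t]])
      moreover have "- (cp * hess_min A g U (x t) * ?n) \<le> g (x t) ?R (?V t)"
        using metric_cauchy_schwarz[OF R(1) V[OF t], of "t *\<^sub>R \<omega>"]
          mult_right_mono[OF p_bound(1)[OF D[OF t], of "t *\<^sub>R \<omega>"] n] by linarith
      moreover have "hess_min A g U (x t) * ?n\<^sup>2 \<le> ?H t"
        unfolding rnorm_power2[OF V[OF t]] by (rule hess_min_works(1)[OF V[OF t]])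
      ultimately show ?thesis unfolding speed by (simp add: algebra_simps)
    qed
  next
    obtain p where "p \<in> closure D" by (rule closure_nonempty)
    then show "0 \<le> cf" by (rule force_le_Cf(2))
    show "sqrt (?E s) \<le> comparison.z0" using start unfolding speed z_plus_eq .
  qed
  show ?thesis
    using le_z_star[of "rnorm g (x t) (?V t)"] primitive_speed_bound[OF st] unfolding speed by blast
qed

end

theorem proposition2:
  fixes A :: "('a::{t2_space,second_countable_topology}, 'm::finite) chart set"
    and g :: "('a, 'm) rmetric"
    and f :: "real ^ 'k::finite \<Rightarrow> 'a \<Rightarrow> ('a, 'm) tvec"
    and P :: "real ^ 'k \<Rightarrow> 'a \<Rightarrow> ('a, 'm) tvec \<Rightarrow> ('a, 'm) tvec"
    and \<omega> :: "real ^ 'k"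
    and U :: "'a \<Rightarrow> real"
    and D :: "'a set"
    and x :: "real \<Rightarrow> 'a"
    and s :: real
  assumes "complete_riemannian_manifold A g"
    and "smooth_vector_field_family A f"
    and "smooth_tensor_field_family A P"
    and "rationally_independent \<omega>"
    and "smooth_function A U"
    and "bounded_domain A g D"
    and "\<forall>p\<in>closure D. hess_min A g U p > 0"
    and "(INF (\<phi>, p) \<in> UNIV \<times> closure D. g p (gradient A g U p) (f \<phi> p)) < 0"
    and "\<not> zero_tensor_field_family A P \<longrightarrow> (\<forall>p\<in>closure D. force_max g f p > 0)"
    and "is_solution A g f P \<omega> {s..} x"
    and "x ` {s..} \<subseteq> closure D"
    and "rnorm g (x s) (velocity A {s..} x s) \<le> z_plus A g U D f P"
  shows "(SUP t\<in>{s..}. ereal (rnorm g (x t) (velocity A {s..} x t))) \<le> ereal (z_star A g U D f P)"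
proof -
  interpret connected_riemannian A g
    using assms(1) unfolding complete_riemannian_manifold_def by unfold_locales auto
  have "compact (closure D)"
    using assms(1,6) unfolding complete_riemannian_manifold_def bounded_domain_def
    by (intro compact_closure_of_bounded) auto
  then interpret forced_system A g U f P D
    using assms unfolding bounded_domain_def by unfold_locales auto
  show ?thesis
    by (rule SUP_least) (use solution_speed_bound[OF assms(10-12)] in simp)
qed

end
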